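(* Suppose $V_0\subseteq V_1$ are models of set theory, $\kappa$ is an infinite ordinal, $X,\mathscr{L}\in V_0$ with $X$ infinite and $\mathscr{L}$ a relational language, and let $\mu\in V_0$ be an invariant measure on $[\mathrm{Str}^\kappa_{\mathscr{L}}(X)]^{V_0}$. Then $\mu$ is extreme in $V_0$ if and only if $\mu^{V_1}$ is extreme in $V_1$.
   Context: A model of set theory is a transitive model of ZFC (contained in a fixed background model); $\kappa\in V_0$ need not be a cardinal in any given model. Structures and measures: $\mathrm{Str}_{\mathscr{L}}(X)$ is the set of $\mathscr{L}$-structures with underlying set $X$. An $\mathscr{L}$-literal is an atomic formula or a (possibly iterated) negation of one. $\sigma_\kappa(\mathrm{Str}_{\mathscr{L}}(X))$ is the smallest family of subsets of $\mathrm{Str}_{\mathscr{L}}(X)$ closed under complements and under unions of size $\le\kappa$ and containing all sets $\{\mathcal{M}:\mathcal{M}\models\varphi(\bar a)\}$ for $\varphi$ a literal and $\bar a$ a tuple from $X$. $\mathrm{Str}^\kappa_{\mathscr{L}}(X)$ is $\mathrm{Str}_{\mathscr{L}}(X)$ with this family of measurable sets. A probability $\kappa$-measure on it is a probability measure $\mu$ with $\mu(\bigcup_{i\in\kappa}A_i)=\sum_{i\in\kappa}\mu(A_i)$ for pairwise disjoint measurable $A_i$. $\mathrm{Sym}(X)$ acts by $g\mathcal{M}\models R(g(a_0),\dots)$ iff $\mathcal{M}\models R(a_0,\dots)$; $\mu$ is invariant if $\mu(g[A])=\mu(A)$ for all $g\in\mathrm{Sym}(X)$ and measurable $A$. "Invariant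 measure" means invariant probability $\kappa$-measure. An invariant measure $\mu$ on $\mathrm{Str}^\kappa_{\mathscr{L}}(X)$ is extreme if, whenever $\nu$ and $\eta$ are distinct invariant measures on $\mathrm{Str}^\kappa_{\mathscr{L}}(X)$ with $\mu=r\nu+s\eta$ a convex combination ($r,s\ge0$, $r+s=1$), then $r=0$ or $s=0$. Relativization: $\mu^{V_1}$ denotes the relativization of $\mu$ to $V_1$, i.e. the unique probability $\kappa$-measure in $V_1$ on $[\mathrm{Str}^\kappa_{\mathscr{L}}(X)]^{V_1}$ such that for every finite conjunction $\varphi$ of $\mathscr{L}$-literals and tuple $\bar a$ from $X$, the set $\{\mathcal{M}:\mathcal{M}\models\varphi(\bar a)\}$ computed in $V_1$ has the same $\mu^{V_1}$-measure as the $\mu$-measure of that set computed in $V_0$.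
   Formalization: The existence of the relativization μ^{V₁} in V₁ is assumed (its uniqueness and invariance are proved), since for uncountable κ it can fail to exist, e.g. V₀ satisfying MA + c = ω₂, κ = ω₁, and V₁ an extension with the same reals and ω₁ satisfying CH. *)

theory Defs
  imports "HOL-Analysis.Infinite_Sum"
begin

section \<open>Transitive models of ZFC\<close>

datatype set_formula =
    FMem nat nat
  | FEq nat nat
  | FNeg set_formula
  | FConj set_formula set_formula
  | FAll nat set_formula

datatype 'v literal =
    LRel 'v "nat list"
  | LEq nat nat
  | LNeg "'v literal"

text \<open>
  The type \<open>'v\<close> with the relation \<open>\<epsilon>\<close> is the background universe of sets.  A model of set theory
  is given by its class \<open>V\<close> of elements; a notion with an argument \<open>V\<close> is that notion
  as computed in \<open>V\<close>.  Notions without that argument are absolute between transitive models.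
\<close>

context
  fixes mem :: "'v \<Rightarrow> 'v \<Rightarrow> bool"  (infix \<open>\<epsilon>\<close> 50)
begin

primrec sat :: "'v set \<Rightarrow> set_formula \<Rightarrow> (nat \<Rightarrow> 'v) \<Rightarrow> bool" where
  "sat V (FMem i j) e \<longleftrightarrow> e i \<epsilon> e j"
| "sat V (FEq i j) e \<longleftrightarrow> e i = e j"
| "sat V (FNeg \<phi>) e \<longleftrightarrow> \<not> sat V \<phi> e"
| "sat V (FConj \<phi> \<psi>) e \<longleftrightarrow> sat V \<phi> e \<and> sat V \<psi> e"
| "sat V (FAll i \<phi>) e \<longleftrightarrow> (\<forall>x\<in>V. sat V \<phi> (e(i := x)))"

definition extensionality :: "'v set \<Rightarrow> bool" where
  "extensionality V \<longleftrightarrow> (\<forall>x\<in>V. \<forall>y\<in>V. (\<forall>z\<in>V. z \<epsilon> x \<longleftrightarrow> z \<epsilon> y) \<longrightarrow> x = y)"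

definition foundation :: "'v set \<Rightarrow> bool" where
  "foundation V \<longleftrightarrow>
     (\<forall>x\<in>V. (\<exists>y\<in>V. y \<epsilon> x) \<longrightarrow> (\<exists>y\<in>V. y \<epsilon> x \<and> \<not> (\<exists>z\<in>V. z \<epsilon> x \<and> z \<epsilon> y)))"

definition pairing :: "'v set \<Rightarrow> bool" where
  "pairing V \<longleftrightarrow> (\<forall>x\<in>V. \<forall>y\<in>V. \<exists>p\<in>V. \<forall>z\<in>V. z \<epsilon> p \<longleftrightarrow> z = x \<or> z = y)"

definition union :: "'v set \<Rightarrow> bool" where
  "union V \<longleftrightarrow> (\<forall>x\<in>V. \<exists>u\<in>V. \<forall>z\<in>V. z \<epsilon> u \<longleftrightarrow> (\<exists>y\<in>V. y \<epsilon> x \<and> z \<epsilon> y))"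

definition powerset :: "'v set \<Rightarrow> bool" where
  "powerset V \<longleftrightarrow> (\<forall>x\<in>V. \<exists>p\<in>V. \<forall>y\<in>V. y \<epsilon> p \<longleftrightarrow> (\<forall>z\<in>V. z \<epsilon> y \<longrightarrow> z \<epsilon> x))"

definition infinity :: "'v set \<Rightarrow> bool" where
  "infinity V \<longleftrightarrow>
     (\<exists>x\<in>V. (\<exists>w\<in>V. w \<epsilon> x \<and> (\<forall>z\<in>V. \<not> z \<epsilon> w)) \<and>
            (\<forall>y\<in>V. y \<epsilon> x \<longrightarrow> (\<exists>s\<in>V. s \<epsilon> x \<and> (\<forall>z\<in>V. z \<epsilon> s \<longleftrightarrow> z \<epsilon> y \<or> z = y))))"

definition separation :: "'v set \<Rightarrow> bool" where
  "separation V \<longleftrightarrow>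
     (\<forall>\<phi> e. (\<forall>i. e i \<in> V) \<longrightarrow>
        (\<forall>x\<in>V. \<exists>y\<in>V. \<forall>z\<in>V. z \<epsilon> y \<longleftrightarrow> z \<epsilon> x \<and> sat V \<phi> (e(0 := z))))"

definition replacement :: "'v set \<Rightarrow> bool" where
  "replacement V \<longleftrightarrow>
     (\<forall>\<phi> e. (\<forall>i. e i \<in> V) \<longrightarrow>
        (\<forall>a\<in>V. (\<forall>x\<in>V. x \<epsilon> a \<longrightarrow> (\<exists>!y. y \<in> V \<and> sat V \<phi> (e(0 := x, 1 := y)))) \<longrightarrow>
           (\<exists>b\<in>V. \<forall>y\<in>V. y \<epsilon> b \<longleftrightarrow> (\<exists>x\<in>V. x \<epsilon> a \<and> sat V \<phi> (e(0 := x, 1 := y))))))"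

definition choice :: "'v set \<Rightarrow> bool" where
  "choice V \<longleftrightarrow>
     (\<forall>a\<in>V. (\<forall>x\<in>V. x \<epsilon> a \<longrightarrow> (\<exists>z\<in>V. z \<epsilon> x)) \<and>
             (\<forall>x\<in>V. \<forall>y\<in>V. x \<epsilon> a \<and> y \<epsilon> a \<and> x \<noteq> y \<longrightarrow> \<not> (\<exists>z\<in>V. z \<epsilon> x \<and> z \<epsilon> y)) \<longrightarrow>
        (\<exists>c\<in>V. \<forall>x\<in>V. x \<epsilon> a \<longrightarrow> (\<exists>!z. z \<in> V \<and> z \<epsilon> x \<and> z \<epsilon> c)))"

definition ZFC :: "'v set \<Rightarrow> bool" where
  "ZFC V \<longleftrightarrow> extensionality V \<and> foundation V \<and> pairing V \<and> union V \<and> powerset V \<and>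
     infinity V \<and> separation V \<and> replacement V \<and> choice V"

definition background_model :: bool where
  "background_model \<longleftrightarrow> wfp (\<epsilon>) \<and> ZFC UNIV"

definition model_of_set_theory :: "'v set \<Rightarrow> bool" where
  "model_of_set_theory V \<longleftrightarrow> (\<forall>y\<in>V. \<forall>x. x \<epsilon> y \<longrightarrow> x \<in> V) \<and> ZFC V"


section \<open>Coding of mathematical objects as sets\<close>

definition elts :: "'v \<Rightarrow> 'v set" where
  "elts x = {y. y \<epsilon> x}"

text \<open>Only meaningful if some set of the background universe has exactly the elements \<open>A\<close>.\<close>

definition set_of :: "'v set \<Rightarrow> 'v" where
  "set_of A = (THE x. elts x = A)"

definition opair :: "'v \<Rightarrow> 'v \<Rightarrow> 'v" where
  "opair a b = set_of {set_of {a}, set_of {a, b}}"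

primrec tup :: "'v list \<Rightarrow> 'v" where
  "tup [] = set_of {}"
| "tup (a # as) = opair a (tup as)"

definition is_ordinal :: "'v \<Rightarrow> bool" where
  "is_ordinal \<alpha> \<longleftrightarrow>
     (\<forall>\<beta>\<in>elts \<alpha>. elts \<beta> \<subseteq> elts \<alpha>) \<and> (\<forall>\<beta>\<in>elts \<alpha>. \<forall>\<gamma>\<in>elts \<beta>. elts \<gamma> \<subseteq> elts \<beta>)"

primrec nat_code :: "nat \<Rightarrow> 'v" where
  "nat_code 0 = set_of {}"
| "nat_code (Suc n) = set_of (insert (nat_code n) (elts (nat_code n)))"

text \<open>
  The rational \<open>a / b\<close> in lowest terms with \<open>b > 0\<close> is coded by the positive part of \<open>a\<close>,
  the negative part of \<open>a\<close> and \<open>b\<close>; a real is coded by its open lower Dedekind cut.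
  Coding of reals is a relation since not every real of HOL need have a code in the
  background universe.
\<close>

definition rat_code :: "rat \<Rightarrow> 'v" where
  "rat_code q = (case quotient_of q of (a, b) \<Rightarrow>
     opair (opair (nat_code (nat a)) (nat_code (nat (- a)))) (nat_code (nat b)))"

definition codes_real :: "'v \<Rightarrow> real \<Rightarrow> bool" where
  "codes_real x r \<longleftrightarrow> elts x = rat_code ` {q. of_rat q < r}"

definition reals_of :: "'v set \<Rightarrow> real set" where
  "reals_of V = {r. \<exists>x\<in>V. codes_real x r}"

definition is_fun :: "'v \<Rightarrow> 'v set \<Rightarrow> bool" where
  "is_fun f D \<longleftrightarrow>
     (\<forall>p\<in>elts f. \<exists>x\<in>D. \<exists>y. p = opair x y) \<and> (\<forall>x\<in>D. \<exists>!y. opair x y \<in> elts f)"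

definition app :: "'v \<Rightarrow> 'v \<Rightarrow> 'v" where
  "app f x = (THE y. opair x y \<in> elts f)"

definition size_le :: "'v set \<Rightarrow> 'v \<Rightarrow> 'v \<Rightarrow> bool" where
  "size_le V S \<kappa> \<longleftrightarrow>
     (\<exists>f\<in>V. is_fun f (elts S) \<and> inj_on (app f) (elts S) \<and> app f ` elts S \<subseteq> elts \<kappa>)"

definition Sym :: "'v set \<Rightarrow> 'v \<Rightarrow> 'v set" where
  "Sym V X = {g\<in>V. is_fun g (elts X) \<and> bij_betw (app g) (elts X) (elts X)}"


section \<open>Structures and literals\<close>

text \<open>A relational language is coded by its arity function.\<close>

definition relational_language :: "'v \<Rightarrow> bool" where
  "relational_language L \<longleftrightarrow>
     (\<exists>S. is_fun L S \<and> (\<forall>R\<in>S. \<exists>n. app L R = nat_code n))"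

definition has_arity :: "'v \<Rightarrow> 'v \<Rightarrow> nat \<Rightarrow> bool" where
  "has_arity L R n \<longleftrightarrow> opair R (nat_code n) \<in> elts L"

text \<open>
  A structure on \<open>X\<close> is coded by the set of all pairs \<open>(R, as)\<close> such that \<open>R(as)\<close> holds in it.
\<close>

definition Str :: "'v set \<Rightarrow> 'v \<Rightarrow> 'v \<Rightarrow> 'v set" where
  "Str V L X = {M\<in>V. elts M \<subseteq>
     {opair R (tup as) | R as. has_arity L R (length as) \<and> set as \<subseteq> elts X}}"

definition act :: "'v \<Rightarrow> 'v \<Rightarrow> 'v" where
  "act g M = set_of {opair R (tup (map (app g) as)) | R as. opair R (tup as) \<in> elts M}"

text \<open>\<open>is_literal L n \<phi>\<close>: \<open>\<phi>\<close> is an \<open>L\<close>-literal whose variables are among \<open>x\<^sub>0, \<dots>, x\<^sub>n\<^sub>-\<^sub>1\<close>.\<close>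

primrec is_literal :: "'v \<Rightarrow> nat \<Rightarrow> 'v literal \<Rightarrow> bool" where
  "is_literal L n (LRel R is) \<longleftrightarrow> has_arity L R (length is) \<and> (\<forall>i\<in>set is. i < n)"
| "is_literal L n (LEq i j) \<longleftrightarrow> i < n \<and> j < n"
| "is_literal L n (LNeg \<phi>) \<longleftrightarrow> is_literal L n \<phi>"

primrec holds :: "'v \<Rightarrow> 'v literal \<Rightarrow> 'v list \<Rightarrow> bool" where
  "holds M (LRel R is) as \<longleftrightarrow> opair R (tup (map (\<lambda>i. as ! i) is)) \<in> elts M"
| "holds M (LEq i j) as \<longleftrightarrow> as ! i = as ! j"
| "holds M (LNeg \<phi>) as \<longleftrightarrow> \<not> holds M \<phi> as"

text \<open>A finite conjunction of literals is given as the list of its conjuncts.\<close>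

definition ext :: "'v set \<Rightarrow> 'v \<Rightarrow> 'v \<Rightarrow> 'v literal list \<Rightarrow> 'v list \<Rightarrow> 'v" where
  "ext V L X \<phi>s as = set_of {M\<in>Str V L X. \<forall>\<phi>\<in>set \<phi>s. holds M \<phi> as}"


section \<open>Measurable sets and invariant measures\<close>

definition closed_family :: "'v set \<Rightarrow> 'v \<Rightarrow> 'v \<Rightarrow> 'v \<Rightarrow> 'v \<Rightarrow> bool" where
  "closed_family V \<kappa> L X F \<longleftrightarrow>
     (\<forall>A\<in>elts F. elts A \<subseteq> Str V L X) \<and>
     (\<forall>A\<in>elts F. set_of (Str V L X - elts A) \<in> elts F) \<and>
     (\<forall>S\<in>V. elts S \<subseteq> elts F \<and> size_le V S \<kappa> \<longrightarrow> set_of (\<Union>A\<in>elts S. elts A) \<in> elts F) \<and>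
     (\<forall>\<phi> as. is_literal L (length as) \<phi> \<and> set as \<subseteq> elts X \<longrightarrow> ext V L X [\<phi>] as \<in> elts F)"

definition measurable_sets :: "'v set \<Rightarrow> 'v \<Rightarrow> 'v \<Rightarrow> 'v \<Rightarrow> 'v set" where
  "measurable_sets V \<kappa> L X =
     {A\<in>V. elts A \<subseteq> Str V L X \<and> (\<forall>F\<in>V. closed_family V \<kappa> L X F \<longrightarrow> A \<in> elts F)}"

definition val :: "'v \<Rightarrow> 'v \<Rightarrow> real" where
  "val \<mu> A = (THE r. codes_real (app \<mu> A) r)"

definition additive :: "'v set \<Rightarrow> 'v \<Rightarrow> 'v \<Rightarrow> 'v \<Rightarrow> 'v \<Rightarrow> 'v set \<Rightarrow> bool" where
  "additive V \<kappa> L X \<mu> I \<longleftrightarrow>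
     (\<forall>A\<in>V. is_fun A I \<and> app A ` I \<subseteq> measurable_sets V \<kappa> L X \<and>
            (\<forall>i\<in>I. \<forall>j\<in>I. i \<noteq> j \<longrightarrow> elts (app A i) \<inter> elts (app A j) = {}) \<longrightarrow>
        ((\<lambda>i. val \<mu> (app A i)) has_sum val \<mu> (set_of (\<Union>i\<in>I. elts (app A i)))) I)"

definition probability_measure :: "'v set \<Rightarrow> 'v \<Rightarrow> 'v \<Rightarrow> 'v \<Rightarrow> 'v \<Rightarrow> bool" where
  "probability_measure V \<kappa> L X \<mu> \<longleftrightarrow>
     \<mu> \<in> V \<and> is_fun \<mu> (measurable_sets V \<kappa> L X) \<and>
     (\<forall>A\<in>measurable_sets V \<kappa> L X. (\<exists>r. codes_real (app \<mu> A) r) \<and> val \<mu> A \<ge> 0) \<and>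
     val \<mu> (set_of {}) = 0 \<and> val \<mu> (set_of (Str V L X)) = 1 \<and>
     additive V \<kappa> L X \<mu> (range nat_code)"

definition probability_kappa_measure :: "'v set \<Rightarrow> 'v \<Rightarrow> 'v \<Rightarrow> 'v \<Rightarrow> 'v \<Rightarrow> bool" where
  "probability_kappa_measure V \<kappa> L X \<mu> \<longleftrightarrow>
     probability_measure V \<kappa> L X \<mu> \<and> additive V \<kappa> L X \<mu> (elts \<kappa>)"

definition invariant_measure :: "'v set \<Rightarrow> 'v \<Rightarrow> 'v \<Rightarrow> 'v \<Rightarrow> 'v \<Rightarrow> bool" where
  "invariant_measure V \<kappa> L X \<mu> \<longleftrightarrow>
     probability_kappa_measure V \<kappa> L X \<mu> \<and>
     (\<forall>g\<in>Sym V X. \<forall>A\<in>measurable_sets V \<kappa> L X. val \<mu> (set_of (act g ` elts A)) = val \<mu> A)"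

definition extreme :: "'v set \<Rightarrow> 'v \<Rightarrow> 'v \<Rightarrow> 'v \<Rightarrow> 'v \<Rightarrow> bool" where
  "extreme V \<kappa> L X \<mu> \<longleftrightarrow>
     invariant_measure V \<kappa> L X \<mu> \<and>
     (\<forall>\<nu> \<eta>. \<forall>r\<in>reals_of V. \<forall>s\<in>reals_of V.
        invariant_measure V \<kappa> L X \<nu> \<and> invariant_measure V \<kappa> L X \<eta> \<and> \<nu> \<noteq> \<eta> \<and>
        r \<ge> 0 \<and> s \<ge> 0 \<and> r + s = 1 \<and>
        (\<forall>A\<in>measurable_sets V \<kappa> L X. val \<mu> A = r * val \<nu> A + s * val \<eta> A) \<longrightarrow>
        r = 0 \<or> s = 0)"

definition is_relativization ::
    "'v set \<Rightarrow> 'v set \<Rightarrow> 'v \<Rightarrow> 'v \<Rightarrow> 'v \<Rightarrow> 'v \<Rightarrow> 'v \<Rightarrow> bool" where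
  "is_relativization V\<^sub>0 V\<^sub>1 \<kappa> L X \<mu> \<mu>' \<longleftrightarrow>
     probability_kappa_measure V\<^sub>1 \<kappa> L X \<mu>' \<and>
     (\<forall>\<phi>s as. (\<forall>\<phi>\<in>set \<phi>s. is_literal L (length as) \<phi>) \<and> set as \<subseteq> elts X \<longrightarrow>
        val \<mu>' (ext V\<^sub>1 L X \<phi>s as) = val \<mu> (ext V\<^sub>0 L X \<phi>s as))"

text \<open>Only meaningful if a relativization exists in \<open>V\<^sub>1\<close>.\<close>

definition relativization :: "'v set \<Rightarrow> 'v set \<Rightarrow> 'v \<Rightarrow> 'v \<Rightarrow> 'v \<Rightarrow> 'v \<Rightarrow> 'v" where
  "relativization V\<^sub>0 V\<^sub>1 \<kappa> L X \<mu> = (THE \<mu>'. is_relativization V\<^sub>0 V\<^sub>1 \<kappa> L X \<mu> \<mu>')"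

end

end

theory Submission
  imports Defs "HOL-Analysis.Elementary_Metric_Spaces"
begin

text \<open>
  Extremality is equivalent, inside each model, to dissociation: events depending on disjoint
  sets of points are independent.  Dissociation only involves the measures of the sets defined
  by finite conjunctions of literals, and these are the same for a measure and its
  relativization.

  If \<open>\<mu>\<close> is dissociated and a proper convex combination of invariant \<open>\<nu>\<close> and \<open>\<eta>\<close>, the
  Cauchy--Schwarz inequality for \<open>n\<close> translates of \<open>A\<close> with disjoint supports gives
  \<open>r \<nu>(A)\<^sup>2 + s \<eta>(A)\<^sup>2 \<le> \<mu>(A)\<^sup>2 + \<mu>(A) / n\<close>, so \<open>\<nu>(A) = \<eta>(A)\<close> by strict convexity; and measures
  that agree on finite conjunctions are equal since all measurable sets are approximable by
  sets depending on finitely many atomic facts.  Conversely, if \<open>E\<close> and \<open>B\<close> have disjoint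
  supports and are not independent, then \<open>\<nu>(A) = lim \<mu>(\<pi>E \<inter> A) / \<mu>(E)\<close>, where \<open>\<pi>\<close> moves the
  support of \<open>E\<close> away from every finite set, is an invariant measure different from \<open>\<mu>\<close>, and
  \<open>\<mu>\<close> is a convex combination of it and of the same limit for the complement of \<open>E\<close>.  This
  limit has to be an element of the model, so its Dedekind cuts are defined by a first-order
  formula.
\<close>

section \<open>Definability in a model\<close>

text \<open>The obstacle behind the length: the measurable sets of a model form the least closed
  family only among families that are elements of the model. Induction over measurable sets is
  therefore available only for properties whose extension is a set of the model, so each property
  used this way has to be expressed by a formula, and the notions occurring in it get definable
  twins (\<open>tapp\<close>, \<open>vact\<close>, \<open>vimg\<close>). Since background membership
  is well founded, the naturals, finite tuples and finite subsets of a model are exactly those of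
  HOL. Sums, limits and Cauchy arguments can thus be carried out in HOL on real values, and only the
  resulting object needs a code. A measure itself supplies two sets of the model: its domain is the
  family of measurable sets, and its value 1 is the set of codes of rationals below 1. The larger
  model may have new permutations, but on a finite set each agrees with a permutation of the smaller
  one, because a finite injection extends to a permutation moving only finitely many points. This
  carries invariance over to the relativization.\<close>

datatype 'v dterm = Var nat | Par 'v

text \<open>De Bruijn indices with parameters inside the formula make closure under connectives,
  quantifiers and substitution free of bookkeeping about names; the named syntax
  \<open>set_formula\<close> returns only where an axiom scheme is invoked.\<close>

datatype 'v dform =
    DMem "'v dterm" "'v dterm"
  | DEq "'v dterm" "'v dterm"
  | DNeg "'v dform"
  | DConj "'v dform" "'v dform"
  | DAll "'v dform"

primrec tval :: "(nat \<Rightarrow> 'v) \<Rightarrow> 'v dterm \<Rightarrow> 'v" where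
  "tval e (Var i) = e i"
| "tval e (Par c) = c"

primrec ev :: "('v \<Rightarrow> 'v \<Rightarrow> bool) \<Rightarrow> 'v set \<Rightarrow> 'v dform \<Rightarrow> (nat \<Rightarrow> 'v) \<Rightarrow> bool" where
  "ev m V (DMem s t) e \<longleftrightarrow> m (tval e s) (tval e t)"
| "ev m V (DEq s t) e \<longleftrightarrow> tval e s = tval e t"
| "ev m V (DNeg F) e \<longleftrightarrow> \<not> ev m V F e"
| "ev m V (DConj F G) e \<longleftrightarrow> ev m V F e \<and> ev m V G e"
| "ev m V (DAll F) e \<longleftrightarrow> (\<forall>x\<in>V. ev m V F (case_nat x e))"

primrec tpars :: "'v dterm \<Rightarrow> 'v set" where
  "tpars (Var i) = {}"
| "tpars (Par c) = {c}"

primrec pars :: "'v dform \<Rightarrow> 'v set" where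
  "pars (DMem s t) = tpars s \<union> tpars t"
| "pars (DEq s t) = tpars s \<union> tpars t"
| "pars (DNeg F) = pars F"
| "pars (DConj F G) = pars F \<union> pars G"
| "pars (DAll F) = pars F"

lemma finite_tpars: "finite (tpars t)"
  by (cases t) auto

lemma finite_pars: "finite (pars F)"
  by (induction F) (auto simp: finite_tpars)

text \<open>Deeper binders get the even variables from 4 on: apart from 0 and 1, which the axiom
  schemes reassign, and apart from the odd variables of the parameters.\<close>

definition lev :: "nat \<Rightarrow> nat" where
  "lev l = (if l < 2 then l else 2 * l)"

lemma lev_eq_iff: "lev l = lev l' \<longleftrightarrow> l = l'"
  by (auto simp: lev_def)

lemma lev_neq_odd: "odd k \<Longrightarrow> 3 \<le> k \<Longrightarrow> k \<noteq> lev l"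
  by (auto simp: lev_def)

text \<open>
  Under \<open>d\<close> binders the de Bruijn index \<open>i < d\<close> becomes the named variable \<open>lev (d - 1 - i)\<close>;
  so the free indices \<open>1, 0\<close> of a binary formula translated with \<open>d = 2\<close> become the variables
  \<open>0, 1\<close> of the replacement scheme.  Parameters become odd variables from \<open>3\<close> on.
\<close>

definition nmv :: "nat \<Rightarrow> nat \<Rightarrow> nat" where
  "nmv d i = lev (if i < d then d - 1 - i else 0)"

primrec tr_term :: "('v \<Rightarrow> nat) \<Rightarrow> nat \<Rightarrow> 'v dterm \<Rightarrow> nat" where
  "tr_term k d (Var i) = nmv d i"
| "tr_term k d (Par c) = k c"

primrec tr_form :: "('v \<Rightarrow> nat) \<Rightarrow> nat \<Rightarrow> 'v dform \<Rightarrow> set_formula" where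
  "tr_form k d (DMem s t) = FMem (tr_term k d s) (tr_term k d t)"
| "tr_form k d (DEq s t) = FEq (tr_term k d s) (tr_term k d t)"
| "tr_form k d (DNeg F) = FNeg (tr_form k d F)"
| "tr_form k d (DConj F G) = FConj (tr_form k d F) (tr_form k d G)"
| "tr_form k d (DAll F) = FAll (lev d) (tr_form k (Suc d) F)"

lemma tr_term: "(\<And>c. c \<in> tpars t \<Longrightarrow> e (k c) = c) \<Longrightarrow> e (tr_term k d t) = tval (\<lambda>i. e (nmv d i)) t"
  by (cases t) auto

text \<open>The condition \<open>1 \<le> d\<close> protects indices beyond all binders: they fall
  back to variable \<open>lev 0\<close>, which the next binder, named \<open>lev d\<close>, must not
  capture.\<close>

lemma tr_form:
  assumes "\<And>c. odd (k c) \<and> 3 \<le> k c" and "\<And>c. c \<in> pars F \<Longrightarrow> e (k c) = c" and "1 \<le> d"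
  shows "sat m V (tr_form k d F) e \<longleftrightarrow> ev m V F (\<lambda>i. e (nmv d i))"
  using assms(2,3)
proof (induction F arbitrary: d e)
  case (DMem s t)
  then show ?case by (simp add: tr_term)
next
  case (DEq s t)
  then show ?case by (simp add: tr_term)
next
  case (DAll F)
  have "(\<lambda>i. (e(lev d := x)) (nmv (Suc d) i)) = case_nat x (\<lambda>i. e (nmv d i))" for x
    using DAll.prems(2) by (fastforce simp: nmv_def lev_eq_iff split: nat.split)
  moreover have "k c \<noteq> lev d" for c
    using lev_neq_odd assms(1) by blast
  then have "sat m V (tr_form k (Suc d) F) (e(lev d := x)) \<longleftrightarrow>
      ev m V F (\<lambda>i. (e(lev d := x)) (nmv (Suc d) i))" for x
    using DAll.prems by (intro DAll.IH) auto
  ultimately show ?case by simp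
qed auto

text \<open>\<open>P\<close> is any HOL predicate on environments, so mathematical notions can be
  written in HOL and are matched with a formula only through closure rules.\<close>

definition definable :: "('v \<Rightarrow> 'v \<Rightarrow> bool) \<Rightarrow> 'v set \<Rightarrow> ((nat \<Rightarrow> 'v) \<Rightarrow> bool) \<Rightarrow> bool" where
  "definable m V P \<longleftrightarrow> (\<exists>F. pars F \<subseteq> V \<and> (\<forall>e. range e \<subseteq> V \<longrightarrow> (ev m V F e \<longleftrightarrow> P e)))"

text \<open>A formula has finitely many parameters, so they fit into the odd variables
  \<open>2 * h c + 3\<close>; \<open>e0\<close> stores them there, and agreement with
  \<open>e0\<close> from 3 on leaves the variables 0 and 1 at the disposal of the axiom
  schemes.\<close>

lemma definable_formula:
  assumes "definable m V P" "v \<in> V" "1 \<le> d"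
  shows "\<exists>\<phi> e0. (\<forall>i. e0 i \<in> V) \<and> (\<forall>e. (\<forall>i. e i \<in> V) \<longrightarrow> (\<forall>i\<ge>3. e i = e0 i) \<longrightarrow>
    (sat m V \<phi> e \<longleftrightarrow> P (\<lambda>i. e (nmv d i))))"
proof -
  obtain F where "pars F \<subseteq> V \<and> (\<forall>e. range e \<subseteq> V \<longrightarrow> (ev m V F e \<longleftrightarrow> P e))"
    using assms(1) unfolding definable_def by (elim exE)
  then have F: "pars F \<subseteq> V" "\<And>e. range e \<subseteq> V \<Longrightarrow> ev m V F e \<longleftrightarrow> P e"
    by simp_all
  obtain h :: "_ \<Rightarrow> nat" where h: "inj_on h (pars F)"
    using finite_imp_inj_to_nat_seg[OF finite_pars[of F]] by auto
  define k where "k c = 2 * h c + 3" for c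
  define e0 where "e0 i = (if i \<in> k ` pars F then inv_into (pars F) k i else v)" for i
  have k3: "odd (k c)" "3 \<le> k c" for c
    by (auto simp: k_def)
  have inj: "inj_on k (pars F)"
    using h by (auto simp: inj_on_def k_def)
  have 1: "e0 i \<in> V" for i
    using assms(2) F(1) inv_into_into[of i k "pars F"] by (auto simp: e0_def)
  have 2: "sat m V (tr_form k d F) e \<longleftrightarrow> P (\<lambda>i. e (nmv d i))"
    if e: "\<And>i. e i \<in> V" "\<And>i. 3 \<le> i \<Longrightarrow> e i = e0 i" for e
  proof -
    have "e (k c) = c" if "c \<in> pars F" for c
      using that inj e(2)[of "k c"] inv_into_f_f[OF inj that] k3[of c] by (simp add: e0_def)
    then have "sat m V (tr_form k d F) e \<longleftrightarrow> ev m V F (\<lambda>i. e (nmv d i))"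
      using assms(3) k3 by (intro tr_form) auto
    also have "\<dots> \<longleftrightarrow> P (\<lambda>i. e (nmv d i))"
      using e(1) by (intro F(2)) auto
    finally show ?thesis .
  qed
  show ?thesis
    by (intro exI[of _ "tr_form k d F"] exI[of _ e0] conjI allI impI 1 2) simp_all
qed

section \<open>Renaming of free indices\<close>

primrec tren :: "(nat \<Rightarrow> nat) \<Rightarrow> 'v dterm \<Rightarrow> 'v dterm" where
  "tren f (Var i) = Var (f i)"
| "tren f (Par c) = Par c"

primrec ren :: "(nat \<Rightarrow> nat) \<Rightarrow> 'v dform \<Rightarrow> 'v dform" where
  "ren f (DMem s t) = DMem (tren f s) (tren f t)"
| "ren f (DEq s t) = DEq (tren f s) (tren f t)"
| "ren f (DNeg F) = DNeg (ren f F)"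
| "ren f (DConj F G) = DConj (ren f F) (ren f G)"
| "ren f (DAll F) = DAll (ren (case_nat 0 (\<lambda>i. Suc (f i))) F)"

lemma tval_tren: "tval e (tren f t) = tval (\<lambda>i. e (f i)) t"
  by (cases t) auto

lemma ev_ren: "ev m V (ren f F) e \<longleftrightarrow> ev m V F (\<lambda>i. e (f i))"
proof (induction F arbitrary: f e)
  case (DAll F)
  have "(\<lambda>i. case_nat x e (case_nat 0 (\<lambda>i. Suc (f i)) i)) = case_nat x (\<lambda>i. e (f i))" for x
    by (auto split: nat.split)
  then show ?case by (simp add: DAll.IH)
qed (auto simp: tval_tren)

lemma tpars_tren: "tpars (tren f t) = tpars t"
  by (cases t) auto

lemma pars_ren: "pars (ren f F) = pars F"
  by (induction F arbitrary: f) (auto simp: tpars_tren)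

section \<open>The background universe and its ordered pairs\<close>

locale universe =
  fixes mem :: "'v \<Rightarrow> 'v \<Rightarrow> bool"
  assumes wf: "wfp mem"
    and elts_inject: "elts mem x = elts mem y \<Longrightarrow> x = y"
    and pair_exists: "\<exists>p. elts mem p = {a, b}"
begin

abbreviation "El \<equiv> elts mem"
abbreviation "SET \<equiv> set_of mem"
abbreviation "PR \<equiv> opair mem"

lemma SET_El [simp]: "SET (El x) = x"
  unfolding set_of_def using elts_inject by (intro the_equality) auto

lemma SET_eqI: "El x = A \<Longrightarrow> SET A = x"
  using SET_El by auto

lemma El_SET_pair [simp]: "El (SET {a, b}) = {a, b}"
  using pair_exists[of a b] SET_El by metis

lemma El_SET_single [simp]: "El (SET {a}) = {a}"
  using El_SET_pair[of a a] by simp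

lemma El_PR: "El (PR a b) = {SET {a}, SET {a, b}}"
  by (simp add: opair_def)

lemma PR_eq_iff [simp]: "PR a b = PR c d \<longleftrightarrow> a = c \<and> b = d"
proof
  assume "PR a b = PR c d"
  then have "{SET {a}, SET {a, b}} = {SET {c}, SET {c, d}}"
    by (metis El_PR)
  then have "El ` {SET {a}, SET {a, b}} = El ` {SET {c}, SET {c, d}}" by simp
  then have "{{a}, {a, b}} = {{c}, {c, d}}" by simp
  then show "a = c \<and> b = d"
    by (auto simp: doubleton_eq_iff)
qed simp

lemma mem_iff: "mem x y \<longleftrightarrow> x \<in> El y"
  by (simp add: elts_def)

lemma El_induct: "(\<And>x. (\<And>y. y \<in> El x \<Longrightarrow> P y) \<Longrightarrow> P x) \<Longrightarrow> P x"
  using wfp_induct_rule[OF wf, of P x] by (simp add: elts_def)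

lemma El_irrefl: "x \<notin> El x"
  by (induction x rule: El_induct) blast

end

section \<open>Definable predicates and functions of a transitive model\<close>

locale model = universe mem for mem :: "'v \<Rightarrow> 'v \<Rightarrow> bool" +
  fixes V :: "'v set"
  assumes transitive: "y \<in> V \<Longrightarrow> x \<in> elts mem y \<Longrightarrow> x \<in> V"
    and ZFC: "ZFC mem V"
begin

text \<open>Working with extensions as HOL sets keeps ordinary set reasoning usable;
  \<open>SET\<close> goes back to the code when an element of the model is required.\<close>

definition vset :: "'v set \<Rightarrow> bool" where
  "vset A \<longleftrightarrow> (\<exists>x\<in>V. El x = A)"

lemma vset_El: "x \<in> V \<Longrightarrow> vset (El x)"
  by (auto simp: vset_def)

lemma vset_SET_in: "vset A \<Longrightarrow> SET A \<in> V"
  by (auto simp: vset_def)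

lemma El_SET: "vset A \<Longrightarrow> El (SET A) = A"
  by (auto simp: vset_def)

lemma vset_subset: "vset A \<Longrightarrow> x \<in> A \<Longrightarrow> x \<in> V"
  using transitive by (auto simp: vset_def)

lemma nonempty: "\<exists>x. x \<in> V"
  using ZFC by (auto simp: ZFC_def infinity_def)

abbreviation D :: "((nat \<Rightarrow> 'v) \<Rightarrow> bool) \<Rightarrow> bool" where
  "D \<equiv> definable mem V"

lemma D_congI: "D P \<Longrightarrow> (\<And>e. range e \<subseteq> V \<Longrightarrow> P e \<longleftrightarrow> Q e) \<Longrightarrow> D Q"
  by (simp add: definable_def)

lemma DI: "pars F \<subseteq> V \<Longrightarrow> (\<And>e. range e \<subseteq> V \<Longrightarrow> ev mem V F e \<longleftrightarrow> P e) \<Longrightarrow> D P"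
  unfolding definable_def by (intro exI[of _ F]) simp

lemma D_rename:
  assumes "D P" shows "D (\<lambda>e. P (\<lambda>i. e (f i)))"
proof -
  obtain F where F: "pars F \<subseteq> V \<and> (\<forall>e. range e \<subseteq> V \<longrightarrow> (ev mem V F e \<longleftrightarrow> P e))"
    using assms unfolding definable_def by (elim exE)
  show ?thesis
    by (rule DI[of "ren f F"]) (simp_all add: pars_ren ev_ren F image_subset_iff)
qed

lemma D_neg: "D P \<Longrightarrow> D (\<lambda>e. \<not> P e)"
  unfolding definable_def by (elim exE, rule_tac x = "DNeg F" in exI) simp

lemma D_conj: "D P \<Longrightarrow> D Q \<Longrightarrow> D (\<lambda>e. P e \<and> Q e)"
  unfolding definable_def by (elim exE, rule_tac x = "DConj F Fa" in exI) simp

lemma D_disj: "D P \<Longrightarrow> D Q \<Longrightarrow> D (\<lambda>e. P e \<or> Q e)"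
  using D_neg[OF D_conj[OF D_neg D_neg], of P Q] by simp

lemma D_imp: "D P \<Longrightarrow> D Q \<Longrightarrow> D (\<lambda>e. P e \<longrightarrow> Q e)"
  unfolding imp_conv_disj by (intro D_disj D_neg)

lemma D_iff: "D P \<Longrightarrow> D Q \<Longrightarrow> D (\<lambda>e. P e \<longleftrightarrow> Q e)"
  unfolding iff_conv_conj_imp by (intro D_conj D_imp)

lemma D_const: "D (\<lambda>e. b)"
proof -
  have "D (\<lambda>e. True)"
    by (rule DI[of "DEq (Var 0) (Var 0)"]) auto
  then show ?thesis using D_neg[of "\<lambda>e. True"] by (cases b) auto
qed

lemma D_all:
  assumes "D (\<lambda>e. P (e 0) (\<lambda>i. e (Suc i)))"
  shows "D (\<lambda>e. \<forall>x\<in>V. P x e)"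
proof -
  obtain F where F: "pars F \<subseteq> V \<and>
      (\<forall>e. range e \<subseteq> V \<longrightarrow> (ev mem V F e \<longleftrightarrow> P (e 0) (\<lambda>i. e (Suc i))))"
    using assms unfolding definable_def by (elim exE)
  have "ev mem V F (case_nat x e) \<longleftrightarrow> P x e" if "x \<in> V" "range e \<subseteq> V" for x e
  proof -
    have "range (case_nat x e) \<subseteq> V"
      using that by (auto simp: image_subset_iff split: nat.split)
    from conjunct2[OF F, rule_format, OF this] show ?thesis by simp
  qed
  then show ?thesis
    using F by (intro DI[of "DAll F"]) simp_all
qed

lemma D_ex: "D (\<lambda>e. P (e 0) (\<lambda>i. e (Suc i))) \<Longrightarrow> D (\<lambda>e. \<exists>x\<in>V. P x e)"
  using D_neg[OF D_all[OF D_neg, of P]] by simp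

text \<open>The graph alone says nothing about values outside \<open>V\<close>, hence the first conjunct.\<close>

definition dfun :: "((nat \<Rightarrow> 'v) \<Rightarrow> 'v) \<Rightarrow> bool" where
  "dfun t \<longleftrightarrow> (\<forall>e. range e \<subseteq> V \<longrightarrow> t e \<in> V) \<and> D (\<lambda>e. e 0 = t (\<lambda>i. e (Suc i)))"

lemma dfun_in: "dfun t \<Longrightarrow> range e \<subseteq> V \<Longrightarrow> t e \<in> V"
  by (simp add: dfun_def)

lemma D_mem_var: "D (\<lambda>e. e i \<in> El (e j))"
  by (rule DI[of "DMem (Var i) (Var j)"]) (simp_all add: elts_def)

lemma D_eq_var: "D (\<lambda>e. e i = e j)"
  by (rule DI[of "DEq (Var i) (Var j)"]) simp_all

lemma dfun_var: "dfun (\<lambda>e. e i)"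
  unfolding dfun_def using D_eq_var by auto

lemma dfun_const: "c \<in> V \<Longrightarrow> dfun (\<lambda>e. c)"
  unfolding dfun_def by (auto intro: DI[of "DEq (Var 0) (Par c)"])

lemma dfun_rename: "dfun t \<Longrightarrow> dfun (\<lambda>e. t (\<lambda>i. e (f i)))"
  unfolding dfun_def
  using D_rename[of "\<lambda>e. e 0 = t (\<lambda>i. e (Suc i))" "case_nat 0 (\<lambda>i. Suc (f i))"]
  by (auto simp: image_subset_iff)

text \<open>Substituting a term amounts to an existential quantifier over its value; the quantifier
  may range over \<open>V\<close> because \<open>dfun\<close> keeps values there.\<close>

lemma D_subst:
  assumes "dfun t" "D (\<lambda>e. P (e 0) (\<lambda>i. e (Suc i)))"
  shows "D (\<lambda>e. P (t e) e)"
proof -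
  have "D (\<lambda>e. \<exists>x\<in>V. x = t e \<and> P x e)"
    using assms by (intro D_ex D_conj) (auto simp: dfun_def)
  moreover have "(\<exists>x\<in>V. x = t e \<and> P x e) \<longleftrightarrow> P (t e) e" if "range e \<subseteq> V" for e
    using dfun_in[OF assms(1) that] by auto
  ultimately show ?thesis by (rule D_congI)
qed

lemma D_mem: "dfun s \<Longrightarrow> dfun t \<Longrightarrow> D (\<lambda>e. s e \<in> El (t e))"
  by (rule D_subst[where t = s], assumption, rule D_subst[where t = "\<lambda>e. t (\<lambda>i. e (Suc i))"])
    (auto intro: dfun_rename D_mem_var)

lemma D_eq: "dfun s \<Longrightarrow> dfun t \<Longrightarrow> D (\<lambda>e. s e = t e)"
  by (rule D_subst[where t = s], assumption, rule D_subst[where t = "\<lambda>e. t (\<lambda>i. e (Suc i))"])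
    (auto intro: dfun_rename D_eq_var)

lemma D_in: "vset A \<Longrightarrow> dfun s \<Longrightarrow> D (\<lambda>e. s e \<in> A)"
  using D_mem[of s "\<lambda>e. SET A"] dfun_const[of "SET A"] by (simp add: El_SET vset_SET_in)

lemma D_ball_El:
  assumes "dfun t" "D (\<lambda>e. P (e 0) (\<lambda>i. e (Suc i)))"
  shows "D (\<lambda>e. \<forall>x\<in>El (t e). P x e)"
proof -
  have "D (\<lambda>e. \<forall>x\<in>V. x \<in> El (t e) \<longrightarrow> P x e)"
    using assms by (intro D_all D_imp D_mem dfun_var) (auto intro: dfun_rename)
  moreover have "(\<forall>x\<in>V. x \<in> El (t e) \<longrightarrow> P x e) \<longleftrightarrow> (\<forall>x\<in>El (t e). P x e)" if "range e \<subseteq> V" for e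
    using dfun_in[OF assms(1) that] transitive by auto
  ultimately show ?thesis by (rule D_congI)
qed

lemma D_bex_El: "dfun t \<Longrightarrow> D (\<lambda>e. P (e 0) (\<lambda>i. e (Suc i))) \<Longrightarrow> D (\<lambda>e. \<exists>x\<in>El (t e). P x e)"
  using D_neg[OF D_ball_El[OF _ D_neg, of t P]] by simp

lemma D_ball: "vset A \<Longrightarrow> D (\<lambda>e. P (e 0) (\<lambda>i. e (Suc i))) \<Longrightarrow> D (\<lambda>e. \<forall>x\<in>A. P x e)"
  using D_ball_El[of "\<lambda>e. SET A" P] dfun_const[of "SET A"] by (simp add: El_SET vset_SET_in)

lemma D_bex: "vset A \<Longrightarrow> D (\<lambda>e. P (e 0) (\<lambda>i. e (Suc i))) \<Longrightarrow> D (\<lambda>e. \<exists>x\<in>A. P x e)"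
  using D_bex_El[of "\<lambda>e. SET A" P] dfun_const[of "SET A"] by (simp add: El_SET vset_SET_in)

lemmas dfn_basic = D_all D_ex D_ball D_bex D_ball_El D_bex_El D_neg D_conj D_disj D_imp D_iff
  D_mem D_eq D_in D_const dfun_var dfun_const

text \<open>Makes set-builder terms usable inside formulas: being equal to \<open>SET A\<close> is
  having the same members within \<open>V\<close>, and by transitivity no members lie
  elsewhere.\<close>

lemma dfun_SET:
  assumes "\<And>e. range e \<subseteq> V \<Longrightarrow> vset (A e)" "D (\<lambda>e. e 0 \<in> A (\<lambda>i. e (Suc i)))"
  shows "dfun (\<lambda>e. SET (A e))"
proof -
  have "D (\<lambda>e. \<forall>z\<in>V. z \<in> El (e 0) \<longleftrightarrow> z \<in> A (\<lambda>i. e (Suc i)))"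
    using D_rename[OF assms(2), of "case_nat 0 (\<lambda>i. Suc (Suc i))"]
    by (intro D_all D_iff D_mem_var) simp
  moreover have "(\<forall>z\<in>V. z \<in> El (e 0) \<longleftrightarrow> z \<in> A (\<lambda>i. e (Suc i))) \<longleftrightarrow> e 0 = SET (A (\<lambda>i. e (Suc i)))"
    if "range e \<subseteq> V" for e
  proof -
    have e: "e 0 \<in> V" "vset (A (\<lambda>i. e (Suc i)))"
      using that by (auto intro!: assms(1))
    then have "(\<forall>z\<in>V. z \<in> El (e 0) \<longleftrightarrow> z \<in> A (\<lambda>i. e (Suc i))) \<longleftrightarrow> El (e 0) = A (\<lambda>i. e (Suc i))"
      using transitive vset_subset by blast
    then show ?thesis using e by (metis El_SET SET_El)
  qed
  ultimately have "D (\<lambda>e. e 0 = SET (A (\<lambda>i. e (Suc i))))" by (rule D_congI)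
  then show ?thesis using assms(1) vset_SET_in by (simp add: dfun_def)
qed

lemma vset_sep:
  assumes "vset A" "D (\<lambda>e. P (e 0))"
  shows "vset {x \<in> A. P x}"
proof -
  obtain v where v: "v \<in> V" using nonempty by blast
  from definable_formula[OF assms(2) v, of 1, OF order_refl]
  obtain \<phi> e0 where e0': "(\<forall>i. e0 i \<in> V) \<and> (\<forall>e. (\<forall>i. e i \<in> V) \<longrightarrow> (\<forall>i\<ge>3. e i = e0 i) \<longrightarrow>
      (sat mem V \<phi> e \<longleftrightarrow> P (e (nmv 1 0))))"
    by (elim exE)
  have e0: "e0 i \<in> V" for i using e0' by blast
  obtain x where x: "x \<in> V" "El x = A" using assms(1) by (auto simp: vset_def)
  have "\<forall>x\<in>V. \<exists>y\<in>V. \<forall>z\<in>V. mem z y \<longleftrightarrow> mem z x \<and> sat mem V \<phi> (e0(0 := z))"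
    using ZFC e0 by (auto simp: ZFC_def separation_def)
  then obtain y where y: "y \<in> V" "\<forall>z\<in>V. mem z y \<longleftrightarrow> mem z x \<and> sat mem V \<phi> (e0(0 := z))"
    using x by blast
  have P: "sat mem V \<phi> (e0(0 := z)) \<longleftrightarrow> P z" if "z \<in> V" for z
    using e0'[THEN conjunct2, rule_format, of "e0(0 := z)"] e0 that by (simp add: nmv_def lev_def)
  have "z \<in> El y \<longleftrightarrow> z \<in> A \<and> P z" for z
    using y(2)[THEN bspec, of z] P[of z] transitive[OF y(1), of z] transitive[OF x(1), of z] x(2)
    by (metis mem_iff)
  then have "El y = {z \<in> A. P z}" by blast
  then show ?thesis using y by (auto simp: vset_def)
qed

lemma vset_repl:
  assumes "vset A" "D (\<lambda>e. R (e 1) (e 0))" "\<And>x. x \<in> A \<Longrightarrow> \<exists>!y. y \<in> V \<and> R x y"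
  shows "vset {y \<in> V. \<exists>x\<in>A. R x y}"
proof -
  obtain v where v: "v \<in> V" using nonempty by blast
  from definable_formula[OF assms(2) v, of 2, OF one_le_numeral]
  obtain \<phi> e0 where e0': "(\<forall>i. e0 i \<in> V) \<and> (\<forall>e. (\<forall>i. e i \<in> V) \<longrightarrow> (\<forall>i\<ge>3. e i = e0 i) \<longrightarrow>
      (sat mem V \<phi> e \<longleftrightarrow> R (e (nmv 2 1)) (e (nmv 2 0))))"
    by (elim exE)
  have e0: "e0 i \<in> V" for i using e0' by blast
  obtain a where a: "a \<in> V" "El a = A" using assms(1) by (auto simp: vset_def)
  have R: "sat mem V \<phi> (e0(0 := x, 1 := y)) \<longleftrightarrow> R x y" if "x \<in> V" "y \<in> V" for x y
    using e0'[THEN conjunct2, rule_format, of "e0(0 := x, 1 := y)"] e0 that by (simp add: nmv_def lev_def)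
  have "\<forall>x\<in>V. mem x a \<longrightarrow> (\<exists>!y. y \<in> V \<and> sat mem V \<phi> (e0(0 := x, 1 := y)))"
    using assms(3) a R by (metis mem_iff)
  moreover have "\<forall>a\<in>V. (\<forall>x\<in>V. mem x a \<longrightarrow> (\<exists>!y. y \<in> V \<and> sat mem V \<phi> (e0(0 := x, 1 := y)))) \<longrightarrow>
      (\<exists>b\<in>V. \<forall>y\<in>V. mem y b \<longleftrightarrow> (\<exists>x\<in>V. mem x a \<and> sat mem V \<phi> (e0(0 := x, 1 := y))))"
    using ZFC e0 unfolding ZFC_def replacement_def by blast
  ultimately obtain b where b: "b \<in> V"
    "\<forall>y\<in>V. mem y b \<longleftrightarrow> (\<exists>x\<in>V. mem x a \<and> sat mem V \<phi> (e0(0 := x, 1 := y)))"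
    using a by blast
  have "y \<in> El b \<longleftrightarrow> y \<in> V \<and> (\<exists>x\<in>A. R x y)" for y
    using b(2)[THEN bspec, of y] R[of _ y] transitive[OF b(1), of y] transitive[OF a(1)] a(2)
    by (metis mem_iff)
  then have "El b = {y \<in> V. \<exists>x\<in>A. R x y}" by blast
  then show ?thesis using b by (auto simp: vset_def)
qed

end

section \<open>Elementary set theory in a model\<close>

named_theorems dfn

context model
begin

lemmas [dfn] = dfn_basic

lemma vset_empty: "vset {}"
  using vset_sep[of "El v" "\<lambda>x. False" for v] nonempty vset_El by (auto simp: D_const)

lemma vset_pair:
  assumes "a \<in> V" "b \<in> V" shows "vset {a, b}"
proof -
  have "pairing mem V" using ZFC by (simp add: ZFC_def)
  then obtain p where p: "p \<in> V" "\<forall>z\<in>V. mem z p \<longleftrightarrow> z = a \<or> z = b"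
    using assms unfolding pairing_def by blast
  have "El p = {a, b}"
    using p assms transitive[OF p(1)] by (auto simp: mem_iff)
  then show ?thesis using p by (auto simp: vset_def)
qed

lemma vset_single: "a \<in> V \<Longrightarrow> vset {a}"
  using vset_pair[of a a] by simp

lemma vset_UN: 
  assumes "vset A" shows "vset (\<Union>x\<in>A. El x)"
proof -
  have "union mem V" using ZFC by (simp add: ZFC_def)
  then obtain u where u: "u \<in> V" "\<forall>z\<in>V. mem z u \<longleftrightarrow> (\<exists>y\<in>V. mem y (SET A) \<and> mem z y)"
    using vset_SET_in[OF assms] unfolding union_def by blast
  have "z \<in> El u \<longleftrightarrow> z \<in> (\<Union>x\<in>A. El x)" for z
    using u(2)[THEN bspec, of z] transitive[OF u(1), of z] transitive[OF vset_subset[OF assms]]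
      vset_subset[OF assms] by (auto simp: mem_iff El_SET[OF assms])
  then have "El u = (\<Union>x\<in>A. El x)" by blast
  then show ?thesis using u(1) by (auto simp: vset_def)
qed

lemma vset_Un: "vset A \<Longrightarrow> vset B \<Longrightarrow> vset (A \<union> B)"
  using vset_UN[OF vset_pair[OF vset_SET_in vset_SET_in, of A B]] by (simp add: El_SET)

lemma vset_insert: "a \<in> V \<Longrightarrow> vset A \<Longrightarrow> vset (insert a A)"
  using vset_Un[OF vset_single] by simp

lemma vset_finite: "finite A \<Longrightarrow> A \<subseteq> V \<Longrightarrow> vset A"
  by (induction A rule: finite_induct) (auto simp: vset_empty vset_insert)

lemma vset_Pow:
  assumes "vset A" shows "vset {y \<in> V. El y \<subseteq> A}"
proof -
  have "powerset mem V" using ZFC by (simp add: ZFC_def)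
  then obtain p where p: "p \<in> V" "\<forall>y\<in>V. mem y p \<longleftrightarrow> (\<forall>z\<in>V. mem z y \<longrightarrow> mem z (SET A))"
    using vset_SET_in[OF assms] unfolding powerset_def by blast
  have "y \<in> El p \<longleftrightarrow> y \<in> V \<and> El y \<subseteq> A" for y
  proof (cases "y \<in> V")
    case True
    then have "(\<forall>z\<in>V. mem z y \<longrightarrow> mem z (SET A)) \<longleftrightarrow> El y \<subseteq> A"
      using transitive[OF True] by (auto simp: mem_iff El_SET[OF assms])
    then show ?thesis using p(2) True by (simp add: mem_iff)
  qed (use transitive[OF p(1)] in blast)
  then have "El p = {y \<in> V. El y \<subseteq> A}" by blast
  then show ?thesis using p(1) by (auto simp: vset_def)
qed

lemma vset_Int: "vset A \<Longrightarrow> vset B \<Longrightarrow> vset (A \<inter> B)"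
  using vset_sep[of A "\<lambda>x. x \<in> B"] by (simp add: Int_def D_in dfun_var)

lemma vset_Diff: "vset A \<Longrightarrow> vset B \<Longrightarrow> vset (A - B)"
  using vset_sep[of A "\<lambda>x. x \<notin> B"] by (simp add: set_diff_eq D_in D_neg dfun_var)

text \<open>A common shape of the existence proofs below: a bounding set from the axioms together
  with a definable membership condition.\<close>

lemma vset_subsetI: "vset A \<Longrightarrow> D (\<lambda>e. e 0 \<in> B) \<Longrightarrow> B \<subseteq> A \<Longrightarrow> vset B"
  using vset_sep[of A "\<lambda>x. x \<in> B"] by (simp add: Collect_conj_eq Int_absorb1)

lemma dfun_pair [dfn]:
  assumes "dfun s" "dfun t" shows "dfun (\<lambda>e. SET {s e, t e})"
proof (rule dfun_SET)
  show "D (\<lambda>e. e 0 \<in> {s (\<lambda>i. e (Suc i)), t (\<lambda>i. e (Suc i))})"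
    unfolding insert_iff empty_iff
    by (intro dfn dfun_rename[OF assms(1)] dfun_rename[OF assms(2)])
qed (intro vset_pair dfun_in assms)

lemma dfun_single [dfn]: "dfun s \<Longrightarrow> dfun (\<lambda>e. SET {s e})"
  using dfun_pair[of s s] by simp

lemma dfun_PR [dfn]: "dfun s \<Longrightarrow> dfun t \<Longrightarrow> dfun (\<lambda>e. PR (s e) (t e))"
  unfolding opair_def by (intro dfun_pair dfun_single)

lemma PR_in_iff [simp]: "PR a b \<in> V \<longleftrightarrow> a \<in> V \<and> b \<in> V"
proof
  assume "PR a b \<in> V"
  then have "SET {a, b} \<in> V" using transitive El_PR by blast
  then show "a \<in> V \<and> b \<in> V" using transitive[of "SET {a, b}"] by simp
qed (simp add: opair_def vset_SET_in vset_pair vset_single)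

lemma dfun_Un [dfn]:
  assumes "dfun s" "dfun t" shows "dfun (\<lambda>e. SET (El (s e) \<union> El (t e)))"
proof (rule dfun_SET)
  show "D (\<lambda>e. e 0 \<in> El (s (\<lambda>i. e (Suc i))) \<union> El (t (\<lambda>i. e (Suc i))))"
    unfolding Un_iff
    by (intro dfn dfun_rename[OF assms(1)] dfun_rename[OF assms(2)])
qed (intro vset_Un vset_El dfun_in assms)

lemma dfun_insert [dfn]:
  assumes "dfun s" "dfun t" shows "dfun (\<lambda>e. SET (insert (s e) (El (t e))))"
proof (rule dfun_SET)
  show "D (\<lambda>e. e 0 \<in> insert (s (\<lambda>i. e (Suc i))) (El (t (\<lambda>i. e (Suc i)))))"
    unfolding insert_iff
    by (intro dfn dfun_rename[OF assms(1)] dfun_rename[OF assms(2)])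
qed (intro vset_insert vset_El dfun_in assms)

text \<open>Turns one definability proof for a relation, stated at the indices 1 and 0, into a rule
  for arbitrary terms, so that the automation by \<open>dfn\<close> can pass through defined
  relations.\<close>

lemma D_app2:
  assumes "D (\<lambda>e. R (e 1) (e 0))" "dfun s" "dfun t"
  shows "D (\<lambda>e. R (s e) (t e))"
proof -
  have "D (\<lambda>e. R (e 0) (t (\<lambda>i. e (Suc i))))"
    using assms(1) by (intro D_subst[where P = "\<lambda>x e. R (e 0) x", OF dfun_rename[OF assms(3)]]) simp
  then show ?thesis by (rule D_subst[where P = "\<lambda>x e. R x (t e)", OF assms(2)])
qed

lemma D_app3:
  assumes "D (\<lambda>e. R (e 2) (e 1) (e 0))" "dfun r" "dfun s" "dfun t"
  shows "D (\<lambda>e. R (r e) (s e) (t e))"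
proof -
  have "D (\<lambda>e. R (e 1) (e 0) (t (\<lambda>i. e (Suc (Suc i)))))"
    using assms(1) by (intro D_subst[where P = "\<lambda>x e. R (e 1) (e 0) x", OF dfun_rename[OF assms(4)]])
      (simp add: numeral_2_eq_2)
  then have "D (\<lambda>e. R (e 0) (s (\<lambda>i. e (Suc i))) (t (\<lambda>i. e (Suc i))))"
    by (intro D_subst[where P = "\<lambda>x e. R (e 0) x (t (\<lambda>i. e (Suc i)))", OF dfun_rename[OF assms(3)]]) simp
  then show ?thesis by (rule D_subst[where P = "\<lambda>x e. R x (s e) (t e)", OF assms(2)])
qed

lemma dfun_app1:
  assumes "dfun (\<lambda>e. f (e 0))" "dfun s"
  shows "dfun (\<lambda>e. f (s e))"
  unfolding dfun_def
proof (intro conjI allI impI)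
  show "f (s e) \<in> V" if "range e \<subseteq> V" for e
    using dfun_in[OF assms(2) that] dfun_in[OF assms(1), of "\<lambda>_. s e"] by auto
  have "D (\<lambda>e. e 0 = f (e 1))"
    using assms(1) by (simp add: dfun_def)
  \<comment> \<open>The graph of \<open>f\<close> has its value at index 0, whereas
    \<open>D_app2\<close> expects its first term at index 1; the renaming \<open>1 - i\<close> swaps
    the two.\<close>
  then show "D (\<lambda>e. e 0 = f (s (\<lambda>i. e (Suc i))))"
    using D_rename[of "\<lambda>e. e 0 = f (e 1)" "\<lambda>i. 1 - i"]
    by (intro D_app2[of "\<lambda>a b. a = f b", OF _ dfun_var dfun_rename[OF assms(2)]]) simp
qed

lemma dfun_app2:
  assumes "dfun (\<lambda>e. f (e 1) (e 0))" "dfun s" "dfun t"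
  shows "dfun (\<lambda>e. f (s e) (t e))"
  unfolding dfun_def
proof (intro conjI allI impI)
  show "f (s e) (t e) \<in> V" if "range e \<subseteq> V" for e
    using dfun_in[OF assms(2) that] dfun_in[OF assms(3) that]
      dfun_in[OF assms(1), of "\<lambda>i. if i = 0 then t e else s e"] by auto
  have "D (\<lambda>e. e 0 = f (e 2) (e 1))"
    using assms(1) by (simp add: dfun_def numeral_2_eq_2)
  then show "D (\<lambda>e. e 0 = f (s (\<lambda>i. e (Suc i))) (t (\<lambda>i. e (Suc i))))"
    using D_rename[of "\<lambda>e. e 0 = f (e 2) (e 1)" "\<lambda>i. if i = 0 then 2 else if i = 1 then 0 else 1"]
    by (intro D_app3[of "\<lambda>a b c. a = f b c",
          OF _ dfun_var dfun_rename[OF assms(2)] dfun_rename[OF assms(3)]]) simp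
qed

lemma vset_image:
  assumes "vset A" "\<And>x. x \<in> A \<Longrightarrow> f x \<in> V" "D (\<lambda>e. e 0 = f (e 1))"
  shows "vset (f ` A)"
proof -
  have "{y \<in> V. \<exists>x\<in>A. y = f x} = f ` A" using assms(2) by auto
  moreover have "\<exists>!y. y \<in> V \<and> y = f x" if "x \<in> A" for x using assms(2)[OF that] by auto
  ultimately show ?thesis
    using vset_repl[of A "\<lambda>x y. y = f x", OF assms(1,3)] by simp
qed

lemma vset_image_dfun: "vset A \<Longrightarrow> dfun (\<lambda>e. f (e 0)) \<Longrightarrow> vset (f ` A)"
  using dfun_in[of "\<lambda>e. f (e 0)" "\<lambda>_. x" for x]
  by (intro vset_image) (auto simp: dfun_def dest: vset_subset)

text \<open>Kuratowski pairs of members of \<open>A\<close> and \<open>B\<close> lie in the double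
  power set of \<open>A \<union> B\<close>, which bounds the product.\<close>

lemma vset_times:
  assumes "vset A" "vset B"
  shows "vset {PR a b | a b. a \<in> A \<and> b \<in> B}"
proof -
  let ?P = "{y \<in> V. El y \<subseteq> {y \<in> V. El y \<subseteq> A \<union> B}}"
  note in_V = vset_subset[OF assms(1)] vset_subset[OF assms(2)]
  have "PR a b \<in> ?P" if "a \<in> A" "b \<in> B" for a b
  proof -
    have "vset {a}" "vset {a, b}" using that in_V by (auto intro: vset_pair vset_single)
    then have "SET {a} \<in> {y \<in> V. El y \<subseteq> A \<union> B}" "SET {a, b} \<in> {y \<in> V. El y \<subseteq> A \<union> B}"
      using that by (simp_all add: El_SET vset_SET_in)
    then show ?thesis using that in_V by (simp add: El_PR)
  qed
  then have "{PR a b | a b. a \<in> A \<and> b \<in> B} \<subseteq> ?P" by auto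
  moreover have "vset ?P" using assms by (intro vset_Pow vset_Un)
  moreover have "D (\<lambda>e. \<exists>a\<in>A. \<exists>b\<in>B. e 0 = PR a b)"
    using assms by (intro dfn)
  then have "D (\<lambda>e. e 0 \<in> {PR a b | a b. a \<in> A \<and> b \<in> B})"
    by (rule D_congI) auto
  ultimately show ?thesis by (rule vset_subsetI[rotated 2])
qed

text \<open>Replacement takes one argument, so it is applied to the product of \<open>A\<close> and
  \<open>B\<close>.\<close>

lemma vset_image2:
  assumes "vset A" "vset B" "dfun (\<lambda>e. f (e 1) (e 0))"
  shows "vset {f a b | a b. a \<in> A \<and> b \<in> B}"
proof -
  note in_V = vset_subset[OF assms(1)] vset_subset[OF assms(2)]
  have f: "f a b \<in> V" if "a \<in> V" "b \<in> V" for a b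
    using dfun_in[OF assms(3), of "\<lambda>i. if i = 0 then b else a"] that by auto
  let ?R = "\<lambda>x y. \<exists>a\<in>A. \<exists>b\<in>B. x = PR a b \<and> y = f a b"
  have "vset {y \<in> V. \<exists>x\<in>{PR a b | a b. a \<in> A \<and> b \<in> B}. ?R x y}"
  proof (rule vset_repl)
    show "vset {PR a b | a b. a \<in> A \<and> b \<in> B}" using assms by (intro vset_times)
    show "D (\<lambda>e. ?R (e 1) (e 0))"
      using assms by (intro dfn dfun_app2[OF assms(3)])
    show "\<exists>!y. y \<in> V \<and> ?R x y" if "x \<in> {PR a b | a b. a \<in> A \<and> b \<in> B}" for x
      using that in_V f by auto
  qed
  moreover have "{y \<in> V. \<exists>x\<in>{PR a b | a b. a \<in> A \<and> b \<in> B}. ?R x y} = {f a b | a b. a \<in> A \<and> b \<in> B}"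
    using f in_V by auto
  ultimately show ?thesis by simp
qed

section \<open>Functions in a model\<close>

definition fn :: "'v set \<Rightarrow> ('v \<Rightarrow> 'v) \<Rightarrow> 'v" where
  "fn A f = SET ((\<lambda>x. PR x (f x)) ` A)"

lemma
  assumes "vset ((\<lambda>x. PR x (f x)) ` A)"
  shows fn_in: "fn A f \<in> V" and is_fun_fn: "is_fun mem (fn A f) A"
    and app_fn: "x \<in> A \<Longrightarrow> app mem (fn A f) x = f x"
proof -
  have El: "El (fn A f) = (\<lambda>x. PR x (f x)) ` A"
    using assms by (simp add: fn_def El_SET)
  show "fn A f \<in> V" using assms by (simp add: fn_def vset_SET_in)
  have *: "PR x y \<in> El (fn A f) \<longleftrightarrow> y = f x" if "x \<in> A" for x y
    using that El by auto
  show "is_fun mem (fn A f) A" using * El by (auto simp: is_fun_def)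
  show "app mem (fn A f) x = f x" if "x \<in> A" using * that by (simp add: app_def)
qed

section \<open>Natural numbers and finite iteration in a model\<close>

abbreviation "NC \<equiv> nat_code mem"

definition succ :: "'v \<Rightarrow> 'v" where
  "succ x = SET (insert x (El x))"

lemma succ_in: "x \<in> V \<Longrightarrow> succ x \<in> V"
  unfolding succ_def by (intro vset_SET_in vset_insert vset_El)

lemma El_succ: "x \<in> V \<Longrightarrow> El (succ x) = insert x (El x)"
  unfolding succ_def by (intro El_SET vset_insert vset_El)

lemma dfun_succ [dfn]: "dfun s \<Longrightarrow> dfun (\<lambda>e. succ (s e))"
  unfolding succ_def by (intro dfn)

lemma empty_in: "SET {} \<in> V"
  by (intro vset_SET_in vset_empty)

lemma El_empty: "El (SET {}) = {}"
  by (intro El_SET vset_empty)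

lemma NC_Suc: "NC (Suc n) = succ (NC n)"
  by (simp add: succ_def)

lemma NC_in: "NC n \<in> V"
  by (induction n) (simp add: empty_in, simp only: NC_Suc succ_in)

lemma El_NC: "El (NC n) = NC ` {..<n}"
proof (induction n)
  case 0
  then show ?case by (simp add: El_empty)
next
  case (Suc n)
  then show ?case
    unfolding NC_Suc El_succ[OF NC_in] by (simp add: lessThan_Suc)
qed

lemma NC_neq: "m < n \<Longrightarrow> NC m \<noteq> NC n"
  using El_NC[of n] El_irrefl by (metis imageI lessThan_iff)

lemma NC_eq_iff [simp]: "NC m = NC n \<longleftrightarrow> m = n"
  using NC_neq by (metis linorder_neqE_nat)

text \<open>The omega of the model is standard: in the least inductive subset of a given inductive
  set, a non-standard element minimal for background membership is neither zero nor a successor of a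
  member, so removing it would leave a smaller inductive set.\<close>

lemma vset_omega: "vset (range NC)"
proof -
  have "infinity mem V" using ZFC by (simp add: ZFC_def)
  then obtain I w where I: "I \<in> V" "w \<in> V" "mem w I" "\<forall>z\<in>V. \<not> mem z w"
    and I': "\<forall>y\<in>V. mem y I \<longrightarrow> (\<exists>s\<in>V. mem s I \<and> (\<forall>z\<in>V. mem z s \<longleftrightarrow> mem z y \<or> z = y))"
    unfolding infinity_def by metis
  define ind where "ind Y \<longleftrightarrow> SET {} \<in> Y \<and> (\<forall>y\<in>Y. succ y \<in> Y)" for Y
  have "El w = {}"
    using I(2,4) transitive[OF I(2)] by (auto simp: mem_iff)
  then have 0: "SET {} \<in> El I"
    using I(3) by (auto simp: mem_iff dest: SET_eqI)
  have "succ y \<in> El I" if yI: "y \<in> El I" for y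
  proof -
    have y: "y \<in> V" using yI transitive I(1) by blast
    then obtain s where s: "s \<in> V" "s \<in> El I" "\<forall>z\<in>V. z \<in> El s \<longleftrightarrow> z \<in> El y \<or> z = y"
      using I'[THEN bspec, OF y] yI by (auto simp: mem_iff)
    have "El s = insert y (El y)"
      using s(1,3) y transitive[OF s(1)] transitive[OF y] by auto
    then show ?thesis using s(2) SET_eqI by (metis succ_def)
  qed
  then have I_ind: "ind (El I)" using 0 by (simp add: ind_def)
  let ?P = "{y \<in> V. El y \<subseteq> El I}"
  have P: "vset ?P" using I(1) by (intro vset_Pow vset_El)
  define N where "N = {x \<in> El I. \<forall>Y\<in>?P. ind (El Y) \<longrightarrow> x \<in> El Y}"
  have "D (\<lambda>e. \<forall>Y\<in>?P. ind (El Y) \<longrightarrow> e 0 \<in> El Y)"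
    unfolding ind_def by (intro dfn P empty_in)
  then have N: "vset N"
    unfolding N_def using I(1) by (intro vset_sep vset_El)
  have N_ind: "ind N"
    using I_ind unfolding N_def ind_def by auto
  have N_least: "N \<subseteq> Y" if "vset Y" "ind Y" "Y \<subseteq> El I" for Y
  proof
    fix x assume "x \<in> N"
    moreover have "SET Y \<in> ?P" "ind (El (SET Y))"
      using that by (simp_all add: El_SET vset_SET_in)
    ultimately have "x \<in> El (SET Y)" unfolding N_def by blast
    then show "x \<in> Y" using that(1) by (simp add: El_SET)
  qed
  have "range NC \<subseteq> N"
  proof -
    have "NC n \<in> N" for n
      by (induction n) (use N_ind in \<open>auto simp: ind_def NC_Suc simp del: nat_code.simps(2)\<close>)
    then show ?thesis by auto
  qed
  moreover have "n \<in> range NC" if "n \<in> N" for n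
    using that
  proof (induction n rule: El_induct)
    case (1 n)
    show ?case
    proof (rule ccontr)
      assume n: "n \<notin> range NC"
      have "n \<noteq> SET {}" using n by (metis nat_code.simps(1) rangeI)
      moreover have "succ y \<noteq> n" if "y \<in> N" for y
      proof
        assume y: "succ y = n"
        have yV: "y \<in> V" using N that vset_subset by blast
        then have "y \<in> El n" using y by (auto simp: El_succ)
        then obtain k where "y = NC k" using 1(1)[of y] \<open>y \<in> N\<close> by blast
        then have "n = NC (Suc k)" using y NC_Suc by simp
        then show False using n by blast
      qed
      ultimately have "ind (N - {n})"
        using N_ind by (auto simp: ind_def)
      moreover have "vset (N - {n})"
        using N 1(2) vset_subset by (intro vset_Diff vset_single) auto
      moreover have "N - {n} \<subseteq> El I" by (auto simp: N_def)
      ultimately have "N \<subseteq> N - {n}" by (intro N_least)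
      then show False using 1(2) by blast
    qed
  qed
  ultimately have "N = range NC" by blast
  then show ?thesis using N by simp
qed

lemma vset_relpowp:
  assumes "vset B" "\<And>W. vset W \<Longrightarrow> vset {y. \<exists>p\<in>W. R p y}"
  shows "vset {y. \<exists>b\<in>B. (R ^^ n) b y}"
proof (induction n)
  case 0
  then show ?case using assms(1) by simp
next
  case (Suc n)
  have "{y. \<exists>b\<in>B. (R ^^ Suc n) b y} = {y. \<exists>p\<in>{y. \<exists>b\<in>B. (R ^^ n) b y}. R p y}"
    by auto
  then show ?case using assms(2)[OF Suc] by simp
qed

text \<open>
  The iterates of \<open>R\<close> on \<open>B\<close> are defined inside the model through sets \<open>C\<close> of pairs
  (stage, iterate) each of whose members is justified by an earlier one; well-foundedness of
  the background membership relation makes every such pair correct.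
\<close>

lemma vset_rtranclp:
  assumes B: "vset B" and R: "D (\<lambda>e. R (e 1) (e 0))"
    and img: "\<And>W. vset W \<Longrightarrow> vset {y. \<exists>p\<in>W. R p y}"
  shows "vset {y. \<exists>b\<in>B. R\<^sup>*\<^sup>* b y}"
proof -
  define L where "L n = {y. \<exists>b\<in>B. (R ^^ n) b y}" for n
  have L: "vset (L n)" for n
    unfolding L_def using B img by (rule vset_relpowp)
  have L_0: "L 0 = B" by (simp add: L_def)
  have L_Suc: "L (Suc n) = {y. \<exists>p\<in>L n. R p y}" for n by (auto simp: L_def)
  define ok where "ok C p \<longleftrightarrow> p = PR (SET {}) (SET B) \<or>
      (\<exists>n\<in>V. \<exists>w\<in>V. \<exists>w'\<in>V. PR n w \<in> El C \<and> p = PR (succ n) w' \<and>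
         (\<forall>y\<in>V. y \<in> El w' \<longleftrightarrow> (\<exists>q\<in>El w. R q y)))" for C p
  define \<Phi> where "\<Phi> m y \<longleftrightarrow> (\<exists>C\<in>V. (\<forall>p\<in>El C. ok C p) \<and> PR m y \<in> El C)" for m y
  have correct: "\<exists>k. m = NC k \<and> y = SET (L k)"
    if C: "C \<in> V" "\<forall>p\<in>El C. ok C p" and "PR m y \<in> El C" for C m y
    using that(3)
  proof (induction m arbitrary: y rule: El_induct)
    case (1 m)
    from 1(2) C(2) have "ok C (PR m y)" by blast
    then consider "m = SET {}" "y = SET B" | n w where "n \<in> V" "w \<in> V" "PR n w \<in> El C"
      "m = succ n" "y \<in> V" "\<forall>z\<in>V. z \<in> El y \<longleftrightarrow> (\<exists>q\<in>El w. R q z)"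
      unfolding ok_def by auto
    then show ?case
    proof cases
      case 1
      then show ?thesis using L_0 by (intro exI[of _ 0]) simp
    next
      case (2 n w)
      then have "n \<in> El m" by (simp add: El_succ)
      then obtain k where k: "n = NC k" "w = SET (L k)" using 1(1) 2(3) by blast
      have "El w = L k" using k L by (simp add: El_SET)
      then have "z \<in> El y \<longleftrightarrow> z \<in> L (Suc k)" for z
        using 2(6)[THEN bspec, of z] transitive[OF 2(5), of z] vset_subset[OF L, of z "Suc k"]
        unfolding L_Suc by blast
      then have "El y = L (Suc k)" by blast
      then show ?thesis using k 2(4) NC_Suc SET_eqI by (metis)
    qed
  qed
  \<comment> \<open>The first \<open>n + 1\<close> stages, as a finite subset of \<open>V\<close>,
    are themselves a justified set of pairs.\<close>
  have exists: "\<Phi> (NC n) (SET (L n))" for n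
  proof -
    let ?C = "(\<lambda>k. PR (NC k) (SET (L k))) ` {..n}"
    have "vset ?C" using L NC_in vset_SET_in by (intro vset_finite) auto
    moreover have "ok (SET ?C) p" if "p \<in> ?C" for p
    proof -
      obtain k where k: "p = PR (NC k) (SET (L k))" "k \<le> n" using \<open>p \<in> ?C\<close> by auto
      show ?thesis
      proof (cases k)
        case 0
        then show ?thesis using k L_0 by (simp add: ok_def)
      next
        case (Suc l)
        have "PR (NC l) (SET (L l)) \<in> El (SET ?C)"
          using \<open>vset ?C\<close> k(2) Suc by (simp add: El_SET)
        moreover have "\<forall>y\<in>V. y \<in> El (SET (L k)) \<longleftrightarrow> (\<exists>q\<in>El (SET (L l)). R q y)"
          using El_SET[OF L, of k] El_SET[OF L, of l] by (simp add: L_Suc Suc)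
        ultimately show ?thesis
          unfolding ok_def using k(1) Suc NC_in vset_SET_in[OF L]
          by (intro disjI2 bexI[of _ "NC l"] bexI[of _ "SET (L l)"] bexI[of _ "SET (L k)"])
            (auto simp: NC_Suc simp del: nat_code.simps)
      qed
    qed
    ultimately show ?thesis
      unfolding \<Phi>_def by (intro bexI[of _ "SET ?C"]) (auto simp: El_SET vset_SET_in)
  qed
  have \<Phi>_iff: "\<Phi> (NC n) y \<longleftrightarrow> y = SET (L n)" for n y
    using exists correct[of _ "NC n" y] unfolding \<Phi>_def by auto
  have "D (\<lambda>e. \<Phi> (e 1) (e 0))"
    unfolding \<Phi>_def ok_def by (intro dfn D_app2[OF R] empty_in vset_SET_in B)
  then have "vset {y \<in> V. \<exists>x\<in>range NC. \<Phi> x y}"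
    using \<Phi>_iff vset_SET_in[OF L] by (intro vset_repl vset_omega) auto
  also have "{y \<in> V. \<exists>x\<in>range NC. \<Phi> x y} = range (\<lambda>n. SET (L n))"
    using \<Phi>_iff vset_SET_in[OF L] by auto
  finally have "vset (\<Union>x\<in>range (\<lambda>n. SET (L n)). El x)" by (rule vset_UN)
  also have "(\<Union>x\<in>range (\<lambda>n. SET (L n)). El x) = {y. \<exists>b\<in>B. R\<^sup>*\<^sup>* b y}"
    using L by (auto simp: El_SET L_def rtranclp_power)
  finally show ?thesis .
qed


declare nat_code.simps [simp del]

text \<open>The bridge from HOL recursion to the model. As \<open>least\<close> ranges over all HOL
  sets, it is proved by plain HOL induction on naturals, lists or finite sets; the arithmetic
  tables, tuples and finite subsets below all arise this way, with \<open>A\<close> supplying the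
  item added at each step.\<close>

lemma vset_least_closed:
  assumes "vset B" "vset A" and f: "dfun (\<lambda>e. f (e 1) (e 0))"
    and "B \<subseteq> T" and closed: "\<And>p x. p \<in> T \<Longrightarrow> x \<in> A \<Longrightarrow> f x p \<in> T"
    and least: "\<And>S. B \<subseteq> S \<Longrightarrow> (\<And>p x. p \<in> S \<Longrightarrow> x \<in> A \<Longrightarrow> f x p \<in> S) \<Longrightarrow> T \<subseteq> S"
  shows "vset T"
proof -
  define R where "R p y \<longleftrightarrow> (\<exists>x\<in>A. y = f x p)" for p y
  let ?S = "{y. \<exists>b\<in>B. R\<^sup>*\<^sup>* b y}"
  have "vset ?S"
  proof (rule vset_rtranclp[OF assms(1)])
    show "D (\<lambda>e. R (e 1) (e 0))"
      unfolding R_def by (intro dfn dfun_app2[OF f] assms)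
    show "vset {y. \<exists>p\<in>W. R p y}" if "vset W" for W
      using vset_image2[OF assms(2) that f] by (rule back_subst[of vset]) (auto simp: R_def)
  qed
  moreover have "T \<subseteq> ?S"
  proof (rule least)
    show "f x p \<in> ?S" if "p \<in> ?S" "x \<in> A" for p x
    proof -
      have "R p (f x p)" using that by (auto simp: R_def)
      then show ?thesis using that by (auto intro: rtranclp.rtrancl_into_rtrancl)
    qed
  qed auto
  moreover have "y \<in> T" if "R\<^sup>*\<^sup>* b y" "b \<in> B" for b y
    using that by induction (use assms(4) closed in \<open>auto simp: R_def\<close>)
  then have "?S \<subseteq> T" by blast
  ultimately show ?thesis by (metis subset_antisym)
qed

lemma vset_image2_if:
  assumes "vset A" "vset B" "dfun (\<lambda>e. f (e 1) (e 0))" "D (\<lambda>e. P (e 1) (e 0))"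
  shows "vset {f a b | a b. a \<in> A \<and> b \<in> B \<and> P a b}"
proof (rule vset_subsetI[OF vset_image2[OF assms(1-3)]])
  have "D (\<lambda>e. \<exists>a\<in>A. \<exists>b\<in>B. P a b \<and> e 0 = f a b)"
    by (intro dfn dfun_app2[OF assms(3)] D_app2[OF assms(4)] assms)
  then show "D (\<lambda>e. e 0 \<in> {f a b | a b. a \<in> A \<and> b \<in> B \<and> P a b})"
    by (rule D_congI) auto
qed auto

section \<open>Total versions of projections and application\<close>

text \<open>The component is rebuilt from its own members, so that anything other than a pair yields
  the empty set. The function is then total on \<open>V\<close>, and its definability rule has no
  side condition, unlike for a description with \<open>THE\<close>.\<close>

definition pfst :: "'v \<Rightarrow> 'v" where
  "pfst p = SET {z. \<exists>a\<in>V. \<exists>b\<in>V. p = PR a b \<and> z \<in> El a}"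

definition psnd :: "'v \<Rightarrow> 'v" where
  "psnd p = SET {z. \<exists>a\<in>V. \<exists>b\<in>V. p = PR a b \<and> z \<in> El b}"

definition tapp :: "'v \<Rightarrow> 'v \<Rightarrow> 'v" where
  "tapp f x = SET {z. \<exists>y\<in>V. PR x y \<in> El f \<and> z \<in> El y}"

lemma pfst_PR [simp]: "a \<in> V \<Longrightarrow> b \<in> V \<Longrightarrow> pfst (PR a b) = a"
  by (auto simp: pfst_def)

lemma psnd_PR [simp]: "a \<in> V \<Longrightarrow> b \<in> V \<Longrightarrow> psnd (PR a b) = b"
  by (auto simp: psnd_def)

lemma dfun_pfst [dfn]:
  assumes "dfun s" shows "dfun (\<lambda>e. pfst (s e))"
  unfolding pfst_def
proof (rule dfun_SET)
  show "vset {z. \<exists>a\<in>V. \<exists>b\<in>V. s e = PR a b \<and> z \<in> El a}" for e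
    by (cases "\<exists>a\<in>V. \<exists>b\<in>V. s e = PR a b") (auto simp: vset_empty vset_El)
  show "D (\<lambda>e. e 0 \<in> {z. \<exists>a\<in>V. \<exists>b\<in>V. s (\<lambda>i. e (Suc i)) = PR a b \<and> z \<in> El a})"
    unfolding mem_Collect_eq by (intro dfn dfun_rename[OF assms])
qed

lemma dfun_psnd [dfn]:
  assumes "dfun s" shows "dfun (\<lambda>e. psnd (s e))"
  unfolding psnd_def
proof (rule dfun_SET)
  show "vset {z. \<exists>a\<in>V. \<exists>b\<in>V. s e = PR a b \<and> z \<in> El b}" for e
    by (cases "\<exists>a\<in>V. \<exists>b\<in>V. s e = PR a b") (auto simp: vset_empty vset_El)
  show "D (\<lambda>e. e 0 \<in> {z. \<exists>a\<in>V. \<exists>b\<in>V. s (\<lambda>i. e (Suc i)) = PR a b \<and> z \<in> El b})"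
    unfolding mem_Collect_eq by (intro dfn dfun_rename[OF assms])
qed

lemma tapp_eq:
  assumes "f \<in> V" "PR x y \<in> El f" "\<And>z. PR x z \<in> El f \<Longrightarrow> z = y"
  shows "tapp f x = y"
proof -
  have "y \<in> V" using transitive[OF assms(1,2)] by simp
  have "{z. \<exists>y\<in>V. PR x y \<in> El f \<and> z \<in> El y} = El y"
    using assms(2,3) \<open>y \<in> V\<close> by blast
  then show ?thesis by (simp add: tapp_def)
qed

lemma is_fun_app_iff:
  assumes "is_fun mem f A" "x \<in> A" shows "PR x y \<in> El f \<longleftrightarrow> y = app mem f x"
proof -
  have "\<exists>!y. PR x y \<in> El f" using assms by (simp add: is_fun_def)
  from theI'[OF this] this show ?thesis unfolding app_def by blast
qed

lemma is_fun_mem: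
  assumes "is_fun mem f A" "p \<in> El f" shows "\<exists>x\<in>A. p = PR x (app mem f x)"
proof -
  obtain x y where xy: "x \<in> A" "p = PR x y" using assms unfolding is_fun_def by blast
  then have "y = app mem f x" using is_fun_app_iff[OF assms(1)] assms(2) by blast
  then show ?thesis using xy by blast
qed

lemma tapp_app: "f \<in> V \<Longrightarrow> is_fun mem f A \<Longrightarrow> x \<in> A \<Longrightarrow> tapp f x = app mem f x"
  by (intro tapp_eq) (simp_all add: is_fun_app_iff)

lemma app_in: 
  assumes "f \<in> V" "is_fun mem f A" "x \<in> A" shows "app mem f x \<in> V" "x \<in> V"
proof -
  have "PR x (app mem f x) \<in> V"
    using transitive[OF assms(1)] is_fun_app_iff[OF assms(2,3)] by blast
  then show "app mem f x \<in> V" "x \<in> V" by simp_all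
qed

lemma dfun_tapp [dfn]:
  assumes "dfun s" "dfun t" shows "dfun (\<lambda>e. tapp (s e) (t e))"
  unfolding tapp_def
proof (rule dfun_SET)
  have "vset {z. \<exists>y\<in>V. PR x y \<in> El f \<and> z \<in> El y}" if "f \<in> V" "x \<in> V" for f x
  proof (rule vset_subsetI)
    \<comment> \<open>A value \<open>y\<close> of \<open>f\<close> is a member of the unordered pair
      of \<open>x\<close> and \<open>y\<close>, which is a member of the ordered pair, which is a
      member of \<open>f\<close>.\<close>
    let ?U = "\<Union>u\<in>\<Union>p\<in>El f. El p. El u"
    show "vset (\<Union>y\<in>?U. El y)" using that by (intro vset_UN vset_El)
    show "{z. \<exists>y\<in>V. PR x y \<in> El f \<and> z \<in> El y} \<subseteq> (\<Union>y\<in>?U. El y)"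
    proof clarify
      fix z y assume zy: "PR x y \<in> El f" "z \<in> El y"
      have "SET {x, y} \<in> El (PR x y)" by (simp add: El_PR)
      then have "SET {x, y} \<in> (\<Union>p\<in>El f. El p)" using zy(1) by blast
      moreover have "y \<in> El (SET {x, y})" by simp
      ultimately have "y \<in> ?U" by blast
      then show "z \<in> (\<Union>y\<in>?U. El y)" using zy by blast
    qed
    show "D (\<lambda>e. e 0 \<in> {z. \<exists>y\<in>V. PR x y \<in> El f \<and> z \<in> El y})"
      unfolding mem_Collect_eq by (intro dfn that)
  qed
  then show "vset {z. \<exists>y\<in>V. PR (t e) y \<in> El (s e) \<and> z \<in> El y}" if "range e \<subseteq> V" for e
    using dfun_in[OF assms(1) that] dfun_in[OF assms(2) that] by blast
  show "D (\<lambda>e. e 0 \<in> {z. \<exists>y\<in>V. PR (t (\<lambda>i. e (Suc i))) y \<in> El (s (\<lambda>i. e (Suc i))) \<and> z \<in> El y})"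
    unfolding mem_Collect_eq
    by (intro dfn dfun_rename[OF assms(1)] dfun_rename[OF assms(2)])
qed

lemma vset_graph: "vset A \<Longrightarrow> dfun (\<lambda>e. f (e 0)) \<Longrightarrow> vset ((\<lambda>x. PR x (f x)) ` A)"
  by (intro vset_image_dfun dfun_PR dfun_var)

section \<open>Arithmetic in a model\<close>

definition add_table :: "'v set" where
  "add_table = (\<lambda>(m, n). PR (PR (NC m) (NC n)) (NC (m + n))) ` UNIV"

definition mult_table :: "'v set" where
  "mult_table = (\<lambda>(m, n). PR (PR (NC m) (NC n)) (NC (m * n))) ` UNIV"

text \<open>Primitive recursion in the second argument: the entry for \<open>(m, n)\<close> produces
  the one for \<open>(m, Suc n)\<close> through \<open>h\<close>. The argument \<open>x\<close> of
  the step function is a dummy, so it ranges over a singleton.\<close>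

lemma vset_arith_table:
  assumes dfun: "dfun (\<lambda>e. h (e 1) (e 0))" and g0: "\<And>m. g m 0 = z m"
    and g: "\<And>m n. h (NC m) (NC (g m n)) = NC (g m (Suc n))"
    and base: "vset ((\<lambda>m. PR (PR (NC m) (NC 0)) (NC (z m))) ` UNIV)"
  shows "vset ((\<lambda>(m, n). PR (PR (NC m) (NC n)) (NC (g m n))) ` UNIV)"
proof -
  define f where "f x p = PR (PR (pfst (pfst p)) (succ (psnd (pfst p)))) (h (pfst (pfst p)) (psnd p))"
    for x p :: 'v
  let ?T = "(\<lambda>(m, n). PR (PR (NC m) (NC n)) (NC (g m n))) ` UNIV"
  have step: "f x (PR (PR (NC m) (NC n)) (NC (g m n))) = PR (PR (NC m) (NC (Suc n))) (NC (g m (Suc n)))"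
    for x m n by (simp add: f_def NC_in g NC_Suc)
  show ?thesis
  proof (rule vset_least_closed[where f = f, OF base vset_single[OF empty_in]])
    show "dfun (\<lambda>e. f (e 1) (e 0))" unfolding f_def by (intro dfn dfun_app2[OF dfun])
    show "(\<lambda>m. PR (PR (NC m) (NC 0)) (NC (z m))) ` UNIV \<subseteq> ?T"
      by (rule image_subsetI, rule image_eqI[of _ _ "(m, 0)" for m]) (simp_all add: g0)
    show "f x p \<in> ?T" if "p \<in> ?T" for p x
    proof -
      from that obtain m n where "p = PR (PR (NC m) (NC n)) (NC (g m n))" by auto
      then show ?thesis by (intro image_eqI[of _ _ "(m, Suc n)"]) (simp_all add: step)
    qed
  next
    fix S assume base: "(\<lambda>m. PR (PR (NC m) (NC 0)) (NC (z m))) ` UNIV \<subseteq> S"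
      and closed: "\<And>p x. p \<in> S \<Longrightarrow> x \<in> {SET {}} \<Longrightarrow> f x p \<in> S"
    have "PR (PR (NC m) (NC n)) (NC (g m n)) \<in> S" for m n
    proof (induction n)
      case 0
      show ?case using base by (auto simp: g0)
    next
      case (Suc n)
      show ?case using closed[OF Suc, of "SET {}"] by (simp add: step)
    qed
    then show "?T \<subseteq> S" by auto
  qed
qed

lemma vset_add_table: "vset add_table"
  unfolding add_table_def
proof (rule vset_arith_table[where h = "\<lambda>m k. succ k" and z = "\<lambda>m. m"])
  show "vset ((\<lambda>m. PR (PR (NC m) (NC 0)) (NC m)) ` UNIV)"
  proof -
    have "vset ((\<lambda>m. PR (PR m (NC 0)) m) ` range NC)"
      by (intro vset_image_dfun vset_omega dfn NC_in)
    then show ?thesis by (simp add: image_image)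
  qed
qed (intro dfn, auto simp: NC_Suc)

definition vadd :: "'v \<Rightarrow> 'v \<Rightarrow> 'v" where
  "vadd x y = tapp (SET add_table) (PR x y)"

lemma vadd [simp]: "vadd (NC m) (NC n) = NC (m + n)"
  unfolding vadd_def using El_SET[OF vset_add_table]
  by (intro tapp_eq vset_SET_in vset_add_table) (auto simp: add_table_def)

lemma dfun_vadd [dfn]: "dfun s \<Longrightarrow> dfun t \<Longrightarrow> dfun (\<lambda>e. vadd (s e) (t e))"
  unfolding vadd_def by (intro dfn vset_SET_in vset_add_table)

lemma vset_mult_table: "vset mult_table"
  unfolding mult_table_def
proof (rule vset_arith_table[where h = "\<lambda>m k. vadd k m" and z = "\<lambda>m. 0"])
  show "vset ((\<lambda>m. PR (PR (NC m) (NC 0)) (NC 0)) ` UNIV)"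
  proof -
    have "vset ((\<lambda>m. PR (PR m (NC 0)) (NC 0)) ` range NC)"
      by (intro vset_image_dfun vset_omega dfn NC_in)
    then show ?thesis by (simp add: image_image)
  qed
qed (intro dfn, auto simp: add.commute)

definition vmult :: "'v \<Rightarrow> 'v \<Rightarrow> 'v" where
  "vmult x y = tapp (SET mult_table) (PR x y)"

lemma vmult [simp]: "vmult (NC m) (NC n) = NC (m * n)"
  unfolding vmult_def using El_SET[OF vset_mult_table]
  by (intro tapp_eq vset_SET_in vset_mult_table) (auto simp: mult_table_def)

lemma dfun_vmult [dfn]: "dfun s \<Longrightarrow> dfun t \<Longrightarrow> dfun (\<lambda>e. vmult (s e) (t e))"
  unfolding vmult_def by (intro dfn vset_SET_in vset_mult_table)

lemma NC_mem_iff [simp]: "NC m \<in> El (NC n) \<longleftrightarrow> m < n"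
  by (auto simp: El_NC)

section \<open>Codes of rationals and reals\<close>

abbreviation "RC \<equiv> rat_code mem"

lemma RC_eq: "RC q = PR (PR (NC (nat (fst (quotient_of q)))) (NC (nat (- fst (quotient_of q)))))
    (NC (nat (snd (quotient_of q))))"
  by (simp add: rat_code_def split: prod.split)

lemma RC_eq_iff [simp]: "RC p = RC q \<longleftrightarrow> p = q"
proof
  assume "RC p = RC q"
  then have "nat (fst (quotient_of p)) = nat (fst (quotient_of q))"
    "nat (- fst (quotient_of p)) = nat (- fst (quotient_of q))"
    "nat (snd (quotient_of p)) = nat (snd (quotient_of q))"
    by (auto simp: RC_eq)
  then have "fst (quotient_of p) = fst (quotient_of q)" "snd (quotient_of p) = snd (quotient_of q)"
    using quotient_of_denom_pos'[of p] quotient_of_denom_pos'[of q] by linarith+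
  then have "quotient_of p = quotient_of q" by (simp add: prod_eq_iff)
  then show "p = q" by (simp add: quotient_of_inject_eq)
qed simp

lemma codes_real_mem: "codes_real mem x r \<Longrightarrow> RC q \<in> El x \<longleftrightarrow> of_rat q < r"
  by (auto simp: codes_real_def)

lemma codes_real_unique:
  assumes "codes_real mem x r" "codes_real mem x s" shows "r = s"
proof (rule ccontr)
  have *: False if "a < b" "codes_real mem x a" "codes_real mem x b" for a b
  proof -
    obtain q where "a < of_rat q" "of_rat q < b" using of_rat_dense[OF \<open>a < b\<close>] by blast
    then show False using that codes_real_mem by (metis less_asym)
  qed
  assume "r \<noteq> s"
  then show False using * assms by (metis linorder_neqE)
qed

lemma codes_real_inject:
  assumes "codes_real mem x r" "codes_real mem y r" shows "x = y"
  using assms by (auto simp: codes_real_def intro: elts_inject)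

text \<open>
  The inequality \<open>x * y < z\<close> of rationals, multiplied by the denominators and with numerators
  split into positive and negative parts, so that it is one between natural numbers.
\<close>

definition times_less :: "'v \<Rightarrow> 'v \<Rightarrow> 'v \<Rightarrow> bool" where
  "times_less x y z \<longleftrightarrow>
     vadd (vmult (vadd (vmult (pfst (pfst x)) (pfst (pfst y))) (vmult (psnd (pfst x)) (psnd (pfst y)))) (psnd z))
       (vmult (psnd (pfst z)) (vmult (psnd x) (psnd y)))
     \<in> El (vadd (vmult (vadd (vmult (pfst (pfst x)) (psnd (pfst y))) (vmult (psnd (pfst x)) (pfst (pfst y)))) (psnd z))
       (vmult (pfst (pfst z)) (vmult (psnd x) (psnd y))))"

lemma D_times_less [dfn]:
  "dfun r \<Longrightarrow> dfun s \<Longrightarrow> dfun t \<Longrightarrow> D (\<lambda>e. times_less (r e) (s e) (t e))"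
  unfolding times_less_def by (intro dfn)

lemma times_less_RC: "times_less (RC p) (RC q) (RC r) \<longleftrightarrow> p * q < r"
proof -
  have dec: "\<exists>a a' b. RC q = PR (PR (NC a) (NC a')) (NC b) \<and> b > 0 \<and> q = (of_nat a - of_nat a') / of_nat b" for q
  proof -
    obtain n d where nd: "quotient_of q = (n, d)" by fastforce
    then have d: "d > 0" "q = of_int n / of_int d"
      using quotient_of_denom_pos quotient_of_div by blast+
    have "(of_nat (nat n) - of_nat (nat (- n)) :: rat) = of_int n"
      by (cases "n \<ge> 0") auto
    then show ?thesis
      using d nd by (intro exI[of _ "nat n"] exI[of _ "nat (- n)"] exI[of _ "nat d"])
        (simp add: RC_eq)
  qed
  obtain a a' b where p: "RC p = PR (PR (NC a) (NC a')) (NC b)" "b > 0"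
    "p = (of_nat a - of_nat a') / of_nat b" using dec by blast
  obtain c c' d where q: "RC q = PR (PR (NC c) (NC c')) (NC d)" "d > 0"
    "q = (of_nat c - of_nat c') / of_nat d" using dec by blast
  obtain k k' l where r: "RC r = PR (PR (NC k) (NC k')) (NC l)" "l > 0"
    "r = (of_nat k - of_nat k') / of_nat l" using dec by blast
  have "times_less (RC p) (RC q) (RC r) \<longleftrightarrow>
      (a * c + a' * c') * l + k' * (b * d) < (a * c' + a' * c) * l + k * (b * d)"
    unfolding times_less_def p(1) q(1) r(1) by (simp add: NC_in)
  also have "\<dots> \<longleftrightarrow> (of_nat ((a * c + a' * c') * l + k' * (b * d)) :: rat)
      < of_nat ((a * c' + a' * c) * l + k * (b * d))"
    by (simp only: of_nat_less_iff)
  also have "\<dots> \<longleftrightarrow> p * q < r"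
    using p(2) q(2) r(2) unfolding p(3) q(3) r(3) by (simp add: field_simps)
  finally show ?thesis .
qed

text \<open>The positive part of the numerator is coded by 0, the empty set, exactly when the
  numerator is not positive; this makes positivity a definable test and cuts \<open>pos_rats\<close>
  out of \<open>rats\<close>.\<close>

lemma RC_pos_iff: "pfst (pfst (RC q)) \<noteq> SET {} \<longleftrightarrow> q > 0"
proof -
  have "pfst (pfst (RC q)) = SET {} \<longleftrightarrow> NC (nat (fst (quotient_of q))) = NC 0"
    by (simp add: RC_eq NC_in nat_code.simps(1)[symmetric])
  also have "\<dots> \<longleftrightarrow> fst (quotient_of q) \<le> 0" by simp
  also have "\<dots> \<longleftrightarrow> q \<le> 0"
  proof -
    have "q = of_int (fst (quotient_of q)) / of_int (snd (quotient_of q))"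
      by (simp add: quotient_of_div)
    moreover have "(of_int n / of_int d \<le> (0::rat)) = (n \<le> 0)" if "0 < d" for n d :: int
      using that by (simp add: divide_le_0_iff)
    ultimately show ?thesis using quotient_of_denom_pos'[of q] by metis
  qed
  finally show ?thesis by auto
qed

section \<open>Tuples and finite subsets in a model\<close>

abbreviation "TUP \<equiv> tup mem"

lemma TUP_in: "set as \<subseteq> V \<Longrightarrow> TUP as \<in> V"
  by (induction as) (auto simp: empty_in)

lemma PR_neq_empty: "PR a b \<noteq> SET {}"
  using El_PR El_empty by (metis insert_not_empty)

lemma TUP_eq_iff [simp]: "TUP as = TUP bs \<longleftrightarrow> as = bs"
proof (induction as arbitrary: bs)
  case Nil
  then show ?case by (cases bs) (auto simp: PR_neq_empty[symmetric])
next
  case (Cons a as)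
  then show ?case by (cases bs) (auto simp: PR_neq_empty)
qed

text \<open>The length is stored beside the tuple so that a formula can match it with the arity of a
  relation symbol.\<close>

lemma vset_tuples:
  assumes "vset A"
  shows "vset {PR (NC (length as)) (TUP as) | as. set as \<subseteq> A}" (is "vset ?T")
proof -
  define f where "f x p = PR (succ (pfst p)) (PR x (psnd p))" for x p
  have step: "f x (PR (NC (length as)) (TUP as)) = PR (NC (length (x # as))) (TUP (x # as))"
    if "x \<in> A" "set as \<subseteq> A" for x as
    using that vset_subset[OF assms] by (simp add: f_def NC_in subset_iff TUP_in NC_Suc)
  show ?thesis
  proof (rule vset_least_closed[where f = f, OF vset_single[of "PR (NC 0) (SET {})"] assms])
    show "dfun (\<lambda>e. f (e 1) (e 0))" unfolding f_def by (intro dfn)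
    show "PR (NC 0) (SET {}) \<in> V" by (simp add: NC_in empty_in)
    show "{PR (NC 0) (SET {})} \<subseteq> ?T" by (auto intro!: exI[of _ "[]"])
    show "f x p \<in> ?T" if p: "p \<in> ?T" and x: "x \<in> A" for p x
    proof -
      obtain as where "p = PR (NC (length as)) (TUP as)" "set as \<subseteq> A" using p by blast
      then show ?thesis using step[of x as] x
        by (intro CollectI exI[of _ "x # as"]) simp
    qed
  next
    fix S assume base: "{PR (NC 0) (SET {})} \<subseteq> S"
      and closed: "\<And>p x. p \<in> S \<Longrightarrow> x \<in> A \<Longrightarrow> f x p \<in> S"
    have "PR (NC (length as)) (TUP as) \<in> S" if "set as \<subseteq> A" for as
      using that
    proof (induction as)
      case (Cons x as)
      then have "f x (PR (NC (length as)) (TUP as)) \<in> S" by (intro closed) auto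
      then show ?case using step[of x as] Cons.prems by simp
    qed (use base in simp)
    then show "?T \<subseteq> S" by auto
  qed
qed

text \<open>Finiteness is that of HOL, so quantifiers over finite sets, as in \<open>fd\<close> and
  in the limit that defines the conditioned measure, become first-order.\<close>

lemma vset_finite_subsets:
  assumes "vset A"
  shows "vset {SET F | F. F \<subseteq> A \<and> finite F}" (is "vset ?T")
proof -
  define f where "f x p = SET (insert x (El p))" for x p
  have step: "f x (SET F) = SET (insert x F)" if "F \<subseteq> A" "finite F" for x F
  proof -
    have "vset F" using that vset_subset[OF assms] by (intro vset_finite) auto
    then show ?thesis by (simp add: f_def El_SET)
  qed
  show ?thesis
  proof (rule vset_least_closed[where f = f, OF vset_single[OF empty_in] assms])
    show "dfun (\<lambda>e. f (e 1) (e 0))" unfolding f_def by (intro dfn)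
    show "{SET {}} \<subseteq> ?T" by auto
    show "f x p \<in> ?T" if p: "p \<in> ?T" and x: "x \<in> A" for p x
    proof -
      obtain F where F: "p = SET F" "F \<subseteq> A" "finite F" using p by blast
      then show ?thesis using step[of F x] x
        by (intro CollectI exI[of _ "insert x F"]) simp
    qed
  next
    fix S assume base: "{SET {}} \<subseteq> S"
      and closed: "\<And>p x. p \<in> S \<Longrightarrow> x \<in> A \<Longrightarrow> f x p \<in> S"
    have "SET F \<in> S" if "finite F" "F \<subseteq> A" for F
      using that
    proof (induction F)
      case (insert x F)
      then have "f x (SET F) \<in> S" by (intro closed) auto
      then show ?case using step[of F x] insert by simp
    qed (use base in simp)
    then show "?T \<subseteq> S" by auto
  qed
qed

lemma tapp_in: "g \<in> V \<Longrightarrow> x \<in> V \<Longrightarrow> tapp g x \<in> V"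
  using dfun_in[OF dfun_tapp[OF dfun_const dfun_const], of g x "\<lambda>_. g"] by auto

text \<open>Applying a function to all components of a tuple is a recursion over the tuple; its
  graph is generated by prepending one component to both tuples while \<open>g\<close> is carried
  along unchanged.\<close>

lemma vset_tuple_maps:
  assumes "vset A" "vset G"
  shows "vset {PR g (PR (TUP as) (TUP (map (tapp g) as))) | g as. g \<in> G \<and> set as \<subseteq> A}" (is "vset ?T")
proof -
  define f where "f x p = PR (pfst p)
      (PR (PR x (pfst (psnd p))) (PR (tapp (pfst p) x) (psnd (psnd p))))" for x p
  define t where "t g as = PR g (PR (TUP as) (TUP (map (tapp g) as)))" for g as
  define B where "B = (\<lambda>g. PR g (PR (SET {}) (SET {}))) ` G"
  have T: "?T = {t g as | g as. g \<in> G \<and> set as \<subseteq> A}" by (simp add: t_def)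
  have t_Nil: "t g [] = PR g (PR (SET {}) (SET {}))" for g by (simp add: t_def)
  have step: "f x (t g as) = t g (x # as)" if "g \<in> G" "x \<in> A" "set as \<subseteq> A" for x g as
  proof -
    have g: "g \<in> V" using vset_subset[OF assms(2) that(1)] .
    have as: "x \<in> V" if "x \<in> set as" for x
      using vset_subset[OF assms(1)] \<open>set as \<subseteq> A\<close> that by blast
    have "set (map (tapp g) as) \<subseteq> V" using as tapp_in[OF g] by (simp add: image_subset_iff)
    then have "TUP as \<in> V" "TUP (map (tapp g) as) \<in> V"
      using as by (blast intro: TUP_in)+
    then show ?thesis using g by (simp add: f_def t_def)
  qed
  have "vset B" unfolding B_def using assms(2) by (intro vset_image_dfun dfn empty_in)
  then show ?thesis
    unfolding T
  proof (rule vset_least_closed[where f = f, OF _ assms(1)])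
    show "dfun (\<lambda>e. f (e 1) (e 0))" unfolding f_def by (intro dfn)
    show "B \<subseteq> {t g as | g as. g \<in> G \<and> set as \<subseteq> A}"
      unfolding B_def t_Nil[symmetric] by force
    show "f x p \<in> {t g as | g as. g \<in> G \<and> set as \<subseteq> A}"
      if p: "p \<in> {t g as | g as. g \<in> G \<and> set as \<subseteq> A}" and x: "x \<in> A" for p x
    proof -
      obtain g as where "p = t g as" "g \<in> G" "set as \<subseteq> A" using p by blast
      then show ?thesis using step[of g x as] x
        by (intro CollectI exI[of _ g] exI[of _ "x # as"]) simp
    qed
  next
    fix S assume base: "B \<subseteq> S"
      and closed: "\<And>p x. p \<in> S \<Longrightarrow> x \<in> A \<Longrightarrow> f x p \<in> S"
    have "t g as \<in> S" if "g \<in> G" "set as \<subseteq> A" for g as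
      using that(2)
    proof (induction as)
      case Nil
      then show ?case using base that(1) by (auto simp: B_def t_Nil)
    next
      case (Cons x as)
      then have "f x (t g as) \<in> S" by (intro closed) auto
      then show ?case using step[of g x as] Cons.prems that(1) by simp
    qed
    then show "{t g as | g as. g \<in> G \<and> set as \<subseteq> A} \<subseteq> S" by auto
  qed
qed

end

section \<open>Structures and permutations\<close>

locale str_model = model mem V for mem :: "'v \<Rightarrow> 'v \<Rightarrow> bool" and V :: "'v set" +
  fixes \<kappa> L X :: 'v
  assumes kappa_in: "\<kappa> \<in> V" and kappa_ordinal: "is_ordinal mem \<kappa>" and kappa_infinite: "infinite (elts mem \<kappa>)"
    and X_in: "X \<in> V" and X_infinite: "infinite (elts mem X)"
    and L_in: "L \<in> V"
begin

abbreviation "atom R as \<equiv> PR R (TUP as)"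

text \<open>The possible atomic facts; a structure is a set of them, so \<open>Structs\<close> is a
  power set in the model. \<open>V\<close> does not occur here, hence two models containing
  \<open>L\<close> and \<open>X\<close> have the same atoms.\<close>

definition atoms :: "'v set" where
  "atoms = {atom R as | R as. has_arity mem L R (length as) \<and> set as \<subseteq> El X}"

abbreviation "Structs \<equiv> Str mem V L X"

lemma Structs_iff: "M \<in> Structs \<longleftrightarrow> M \<in> V \<and> El M \<subseteq> atoms"
  by (simp add: Str_def atoms_def)

lemma X_mem: "x \<in> El X \<Longrightarrow> x \<in> V"
  using transitive X_in by blast

lemma atoms_tuple: "set as \<subseteq> El X \<Longrightarrow> TUP as \<in> V"
  using X_mem by (blast intro: TUP_in)

lemma arity_in: "has_arity mem L R n \<Longrightarrow> R \<in> V"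
  using transitive[OF L_in] unfolding has_arity_def by fastforce

text \<open>Join of the arity function with the set of tuples along the stored length.\<close>

lemma vset_atoms: "vset atoms"
proof -
  let ?T = "{PR (NC (length as)) (TUP as) | as. set as \<subseteq> El X}"
  let ?A = "{PR (pfst l) (psnd t) | l t. l \<in> El L \<and> t \<in> ?T \<and> l = PR (pfst l) (pfst t)}"
  have "vset ?A"
    using vset_tuples[OF vset_El[OF X_in]] L_in by (intro vset_image2_if vset_El dfn)
  also have "?A = atoms"
  proof (intro equalityI subsetI)
    fix y assume "y \<in> ?A"
    then obtain l as where l: "l \<in> El L" "set as \<subseteq> El X" "y = PR (pfst l) (psnd (PR (NC (length as)) (TUP as)))"
      "l = PR (pfst l) (pfst (PR (NC (length as)) (TUP as)))" by blast
    then have "y = atom (pfst l) as" "l = PR (pfst l) (NC (length as))"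
      using atoms_tuple[OF l(2)] NC_in by simp_all
    then show "y \<in> atoms" using l(1,2) unfolding atoms_def has_arity_def by auto
  next
    fix y assume "y \<in> atoms"
    then obtain R as where R: "y = atom R as" "PR R (NC (length as)) \<in> El L" "set as \<subseteq> El X"
      unfolding atoms_def has_arity_def by blast
    then have "R \<in> V" "TUP as \<in> V" using transitive[OF L_in R(2)] atoms_tuple by auto
    with R show "y \<in> ?A"
      by (intro CollectI exI[of _ "PR R (NC (length as))"] exI[of _ "PR (NC (length as)) (TUP as)"])
        (auto simp: NC_in)
  qed
  finally show ?thesis .
qed

lemma vset_Structs: "vset Structs"
proof -
  have "Structs = {y \<in> V. El y \<subseteq> atoms}" using Structs_iff by blast
  then show ?thesis using vset_Pow[OF vset_atoms] by simp
qed

text \<open>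
  A permutation of \<open>X\<close> in the model is represented by a HOL function, arbitrary outside \<open>X\<close>.
\<close>

definition perm :: "('v \<Rightarrow> 'v) \<Rightarrow> bool" where
  "perm \<pi> \<longleftrightarrow> bij_betw \<pi> (El X) (El X) \<and> vset ((\<lambda>x. PR x (\<pi> x)) ` El X)"

definition code :: "('v \<Rightarrow> 'v) \<Rightarrow> 'v" where
  "code \<pi> = fn (El X) \<pi>"

abbreviation "SYM \<equiv> Sym mem V X"

lemma perm_in: "perm \<pi> \<Longrightarrow> x \<in> El X \<Longrightarrow> \<pi> x \<in> El X"
  unfolding perm_def by (blast dest: bij_betwE)

lemma perm_inj: "perm \<pi> \<Longrightarrow> inj_on \<pi> (El X)"
  unfolding perm_def by (blast dest: bij_betw_imp_inj_on)

lemma app_code: "perm \<pi> \<Longrightarrow> x \<in> El X \<Longrightarrow> app mem (code \<pi>) x = \<pi> x"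
  unfolding perm_def code_def by (intro app_fn) auto

lemma code_SYM: "perm \<pi> \<Longrightarrow> code \<pi> \<in> SYM"
  using bij_betw_cong[of "El X" "app mem (code \<pi>)" \<pi> "El X"] app_code[of \<pi>]
  unfolding Sym_def perm_def code_def by (auto intro: fn_in is_fun_fn)

lemma SYM_graph:
  assumes "g \<in> SYM" shows "(\<lambda>x. PR x (app mem g x)) ` El X = El g"
proof -
  have g: "is_fun mem g (El X)" using assms by (simp add: Sym_def)
  show ?thesis using is_fun_app_iff[OF g] is_fun_mem[OF g] by blast
qed

lemma perm_app: "g \<in> SYM \<Longrightarrow> perm (app mem g)"
  using SYM_graph[of g] vset_El[of g] unfolding perm_def by (simp add: Sym_def)

lemma SYM_in: "g \<in> SYM \<Longrightarrow> g \<in> V" by (simp add: Sym_def)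

lemma tapp_SYM: "g \<in> SYM \<Longrightarrow> x \<in> El X \<Longrightarrow> tapp g x = app mem g x"
  unfolding Sym_def by (intro tapp_app) auto

lemma perm_comp:
  assumes "perm \<pi>" "perm \<sigma>" shows "perm (\<lambda>x. \<pi> (\<sigma> x))"
proof -
  have "vset ((\<lambda>x. PR x (tapp (code \<pi>) (tapp (code \<sigma>) x))) ` El X)"
    using code_SYM[OF assms(1)] code_SYM[OF assms(2)]
    by (intro vset_graph vset_El X_in dfn SYM_in)
  also have "(\<lambda>x. PR x (tapp (code \<pi>) (tapp (code \<sigma>) x))) ` El X = (\<lambda>x. PR x (\<pi> (\<sigma> x))) ` El X"
    by (rule image_cong) (simp_all add: tapp_SYM code_SYM assms app_code perm_in)
  finally have "vset \<dots>" .
  moreover have "bij_betw (\<lambda>x. \<pi> (\<sigma> x)) (El X) (El X)"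
    using bij_betw_trans[of \<sigma> "El X" "El X" \<pi> "El X"] assms by (simp add: perm_def comp_def)
  ultimately show ?thesis by (simp add: perm_def)
qed

lemma perm_inv:
  assumes "perm \<pi>" shows "perm (inv_into (El X) \<pi>)"
proof -
  have bij: "bij_betw \<pi> (El X) (El X)" using assms by (simp add: perm_def)
  have "vset ((\<lambda>p. PR (psnd p) (pfst p)) ` (\<lambda>x. PR x (\<pi> x)) ` El X)"
    by (rule vset_image_dfun) (use assms in \<open>simp add: perm_def\<close>, intro dfn)
  also have "(\<lambda>p. PR (psnd p) (pfst p)) ` (\<lambda>x. PR x (\<pi> x)) ` El X = (\<lambda>x. PR (\<pi> x) x) ` El X"
    unfolding image_image by (rule image_cong) (use X_mem perm_in[OF assms] in auto)
  also have "\<dots> = (\<lambda>x. PR (\<pi> x) (inv_into (El X) \<pi> (\<pi> x))) ` El X"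
    using perm_inj[OF assms] by (intro image_cong) auto
  also have "\<dots> = (\<lambda>y. PR y (inv_into (El X) \<pi> y)) ` \<pi> ` El X" by (simp add: image_image)
  also have "\<pi> ` El X = El X" using bij by (simp add: bij_betw_def)
  finally show ?thesis using bij_betw_inv_into[OF bij] by (simp add: perm_def)
qed

text \<open>The sets \<open>f\<close> applied to \<open>s\<close> minus \<open>s\<close>, and
  \<open>s\<close> minus that image, have equal size, so points hit from outside can be sent back by
  a bijection \<open>h\<close>; all other points stay fixed. The graph differs from the identity at
  finitely many points and is therefore in the model. This is the source of homogeneity in each
  model and of the comparison of permutations between models.\<close>

lemma perm_finite_extension:
  assumes "finite s" "s \<subseteq> El X" "inj_on f s" "f ` s \<subseteq> El X"
  obtains \<pi> where "perm \<pi>" "\<And>x. x \<in> s \<Longrightarrow> \<pi> x = f x"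
proof -
  have "card (f ` s - s) = card (s - f ` s)"
  proof -
    have "card (f ` s) = card s" using assms(3) by (rule card_image)
    moreover have "card (f ` s) = card (f ` s \<inter> s) + card (f ` s - s)"
      using assms(1) by (metis Int_commute card_Diff_subset_Int card_mono finite_Int finite_imageI inf_le2 le_add_diff_inverse)
    moreover have "card s = card (f ` s \<inter> s) + card (s - f ` s)"
      using assms(1) by (metis Int_commute card_Diff_subset_Int card_mono finite_Int inf_le2 le_add_diff_inverse)
    ultimately show ?thesis by linarith
  qed
  then obtain h where h: "bij_betw h (f ` s - s) (s - f ` s)"
    using assms(1) finite_same_card_bij[of "f ` s - s" "s - f ` s"] by auto
  define \<pi> where "\<pi> x = (if x \<in> s then f x else if x \<in> f ` s then h x else x)" for x
  have "bij_betw \<pi> s (f ` s)"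
    using inj_on_imp_bij_betw[OF assms(3)] by (subst bij_betw_cong[of _ \<pi> f]) (auto simp: \<pi>_def)
  moreover have "bij_betw \<pi> (f ` s - s) (s - f ` s)"
    using h by (subst bij_betw_cong[of _ \<pi> h]) (auto simp: \<pi>_def)
  ultimately have 1: "bij_betw \<pi> (s \<union> (f ` s - s)) (f ` s \<union> (s - f ` s))"
    by (rule bij_betw_combine) auto
  have 2: "bij_betw \<pi> (El X - (s \<union> f ` s)) (El X - (s \<union> f ` s))"
    by (subst bij_betw_cong[of _ \<pi> "\<lambda>x. x"]) (auto simp: \<pi>_def bij_betw_def)
  have "bij_betw \<pi> (s \<union> (f ` s - s) \<union> (El X - (s \<union> f ` s))) (f ` s \<union> (s - f ` s) \<union> (El X - (s \<union> f ` s)))"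
    by (rule bij_betw_combine[OF 1 2]) auto
  moreover have "s \<union> (f ` s - s) \<union> (El X - (s \<union> f ` s)) = El X"
    "f ` s \<union> (s - f ` s) \<union> (El X - (s \<union> f ` s)) = El X"
    using assms by auto
  ultimately have bij: "bij_betw \<pi> (El X) (El X)" by simp
  let ?g = "\<lambda>x. PR x (\<pi> x)"
  have "El X = (El X - (s \<union> f ` s)) \<union> (s \<union> f ` s)" using assms by auto
  then have "?g ` El X = ?g ` (El X - (s \<union> f ` s)) \<union> ?g ` (s \<union> f ` s)" by (metis image_Un)
  also have "?g ` (El X - (s \<union> f ` s)) = (\<lambda>x. PR x x) ` (El X - (s \<union> f ` s))"
    by (rule image_cong) (auto simp: \<pi>_def)
  finally have g: "?g ` El X = (\<lambda>x. PR x x) ` (El X - (s \<union> f ` s)) \<union> ?g ` (s \<union> f ` s)" .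
  have fin: "finite (s \<union> f ` s)" "s \<union> f ` s \<subseteq> V" using assms X_mem by auto
  have "\<pi> x \<in> V" if "x \<in> s \<union> f ` s" for x
    using bij_betwE[OF bij] that assms X_mem by blast
  then have "vset (?g ` (s \<union> f ` s))"
    using fin by (intro vset_finite) auto
  moreover have "vset ((\<lambda>x. PR x x) ` (El X - (s \<union> f ` s)))"
    using fin by (intro vset_graph vset_Diff vset_El X_in vset_finite dfn)
  ultimately have "vset (?g ` El X)" unfolding g by (intro vset_Un)
  then have "perm \<pi>" using bij by (simp add: perm_def)
  then show thesis by (rule that) (simp add: \<pi>_def)
qed

lemma perm_avoiding:
  assumes "finite s" "s \<subseteq> El X" "finite T"
  obtains \<pi> where "perm \<pi>" "\<pi> ` s \<inter> T = {}"
proof -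
  have "infinite (El X - T)" using X_infinite assms(3) by simp
  then obtain B where B: "B \<subseteq> El X - T" "finite B" "card B = card s"
    using infinite_arbitrarily_large by blast
  then obtain f where f: "bij_betw f s B" using finite_same_card_bij assms(1) by metis
  then have "inj_on f s" "f ` s \<subseteq> El X" using B by (auto simp: bij_betw_def)
  then obtain \<pi> where "perm \<pi>" "\<And>x. x \<in> s \<Longrightarrow> \<pi> x = f x"
    using perm_finite_extension[OF assms(1,2)] by metis
  moreover from this have "\<pi> ` s = B" using f by (auto simp: bij_betw_def)
  ultimately show thesis using B that by blast
qed

section \<open>The action of permutations on structures\<close>

definition supp :: "'v \<Rightarrow> 'v set" where
  "supp u = \<Union>{set as | as. \<exists>R. u = atom R as}"

definition amap :: "('v \<Rightarrow> 'v) \<Rightarrow> 'v \<Rightarrow> 'v" where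
  "amap \<pi> u = (THE v. \<exists>R as. u = atom R as \<and> v = atom R (map \<pi> as))"

lemma supp_atom [simp]: "supp (atom R as) = set as"
  by (auto simp: supp_def)

lemma amap_atom [simp]: "amap \<pi> (atom R as) = atom R (map \<pi> as)"
  by (auto simp: amap_def)

lemma atomsE:
  assumes "u \<in> atoms"
  obtains R as where "u = atom R as" "has_arity mem L R (length as)" "set as \<subseteq> El X"
  using assms by (auto simp: atoms_def)

lemma finite_supp: "u \<in> atoms \<Longrightarrow> finite (supp u)"
  by (erule atomsE) simp

lemma supp_subset: "u \<in> atoms \<Longrightarrow> supp u \<subseteq> El X"
  by (erule atomsE) simp

lemma amap_cong: "u \<in> atoms \<Longrightarrow> (\<And>x. x \<in> supp u \<Longrightarrow> \<pi> x = \<sigma> x) \<Longrightarrow> amap \<pi> u = amap \<sigma> u"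
  by (erule atomsE) simp

lemma amap_comp: "u \<in> atoms \<Longrightarrow> amap \<pi> (amap \<sigma> u) = amap (\<lambda>x. \<pi> (\<sigma> x)) u"
  by (erule atomsE) (simp add: comp_def)

lemma amap_id: "u \<in> atoms \<Longrightarrow> (\<And>x. x \<in> supp u \<Longrightarrow> \<pi> x = x) \<Longrightarrow> amap \<pi> u = u"
  by (erule atomsE) (simp add: map_idI)

lemma supp_amap: "u \<in> atoms \<Longrightarrow> supp (amap \<pi> u) = \<pi> ` supp u"
  by (erule atomsE) simp

lemma amap_in:
  assumes "perm \<pi>" "u \<in> atoms" shows "amap \<pi> u \<in> atoms"
proof -
  obtain R as where "u = atom R as" "has_arity mem L R (length as)" "set as \<subseteq> El X"
    using assms(2) by (rule atomsE)
  then show ?thesis using perm_in[OF assms(1)]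
    unfolding atoms_def by (intro CollectI exI[of _ R] exI[of _ "map \<pi> as"]) auto
qed

lemma amap_inv:
  assumes "perm \<pi>" "u \<in> atoms"
  shows "amap (inv_into (El X) \<pi>) (amap \<pi> u) = u" "amap \<pi> (amap (inv_into (El X) \<pi>) u) = u"
proof -
  have "\<pi> ` El X = El X" using assms(1) by (simp add: perm_def bij_betw_def)
  then show "amap (inv_into (El X) \<pi>) (amap \<pi> u) = u" "amap \<pi> (amap (inv_into (El X) \<pi>) u) = u"
    using supp_subset[OF assms(2)] perm_inj[OF assms(1)]
    by (simp_all add: amap_comp assms(2) amap_id subset_iff f_inv_into_f)
qed

definition amap_table :: "'v set" where
  "amap_table = {PR g (PR u (amap (tapp g) u)) | g u. g \<in> SYM \<and> u \<in> atoms}"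

text \<open>Being a function and being bijective are unfolded into quantifiers bounded by
  \<open>V\<close> or by sets of the model, the form that the definability rules accept.\<close>

lemma SYM_iff:
  "g \<in> SYM \<longleftrightarrow> g \<in> V \<and> (\<forall>p\<in>El g. \<exists>x\<in>El X. \<exists>y\<in>V. p = PR x y) \<and>
    (\<forall>x\<in>El X. \<exists>y\<in>El X. PR x y \<in> El g \<and> (\<forall>z\<in>V. PR x z \<in> El g \<longrightarrow> z = y)) \<and>
    (\<forall>y\<in>El X. \<exists>x\<in>El X. PR x y \<in> El g \<and> (\<forall>z\<in>El X. PR z y \<in> El g \<longrightarrow> z = x))" (is "_ \<longleftrightarrow> ?R")
proof
  assume g: "g \<in> SYM"
  then have isf: "is_fun mem g (El X)" and bij: "bij_betw (app mem g) (El X) (El X)" and gV: "g \<in> V"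
    by (simp_all add: Sym_def)
  note iff = is_fun_app_iff[OF isf]
  have "\<forall>p\<in>El g. \<exists>x\<in>El X. \<exists>y\<in>V. p = PR x y"
    using is_fun_mem[OF isf] app_in(1)[OF gV isf] by blast
  moreover have "\<exists>y\<in>El X. PR x y \<in> El g \<and> (\<forall>z\<in>V. PR x z \<in> El g \<longrightarrow> z = y)" if "x \<in> El X" for x
    using that iff bij_betwE[OF bij] by (intro bexI[of _ "app mem g x"]) auto
  moreover have "\<exists>x\<in>El X. PR x y \<in> El g \<and> (\<forall>z\<in>El X. PR z y \<in> El g \<longrightarrow> z = x)" if y: "y \<in> El X" for y
  proof -
    obtain x where x: "x \<in> El X" "y = app mem g x" using y bij unfolding bij_betw_def by blast
    have "z = x" if "z \<in> El X" "PR z y \<in> El g" for z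
    proof -
      have "app mem g z = app mem g x" using iff[of z y] that x(2) by blast
      then show ?thesis using inj_onD[OF bij_betw_imp_inj_on[OF bij]] that(1) x(1) by blast
    qed
    then show ?thesis using iff[of x y] x by blast
  qed
  ultimately show ?R using gV by blast
next
  assume R: ?R
  have V: "y \<in> V" if "PR x y \<in> El g" for x y
    using transitive[of g "PR x y"] that R by simp
  have isf: "is_fun mem g (El X)"
    unfolding is_fun_def
  proof (intro conjI ballI)
    show "\<exists>x\<in>El X. \<exists>y. p = PR x y" if "p \<in> El g" for p using R that by blast
    show "\<exists>!y. PR x y \<in> El g" if "x \<in> El X" for x using R that V by metis
  qed
  note iff = is_fun_app_iff[OF isf]
  have "bij_betw (app mem g) (El X) (El X)"
    unfolding bij_betw_def
  proof (intro conjI)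
    show "inj_on (app mem g) (El X)"
    proof (rule inj_onI)
      fix x x' assume x: "x \<in> El X" "x' \<in> El X" "app mem g x = app mem g x'"
      have "PR x (app mem g x) \<in> El g" "PR x' (app mem g x) \<in> El g" using x iff by auto
      moreover have "app mem g x \<in> El X" using R x(1) iff by metis
      ultimately show "x = x'" using R x(1,2) by metis
    qed
    show "app mem g ` El X = El X"
    proof
      show "app mem g ` El X \<subseteq> El X"
      proof (rule image_subsetI)
        fix x assume x: "x \<in> El X"
        then obtain y where "y \<in> El X" "PR x y \<in> El g" using R by blast
        then show "app mem g x \<in> El X" using iff[OF x, of y] by simp
      qed
      show "El X \<subseteq> app mem g ` El X"
      proof
        fix y assume "y \<in> El X"
        then obtain x where x: "x \<in> El X" "PR x y \<in> El g" using R by blast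
        then have "y = app mem g x" using iff[of x y] by simp
        then show "y \<in> app mem g ` El X" using x(1) by blast
      qed
    qed
  qed
  then show "g \<in> SYM" using isf R by (simp add: Sym_def)
qed

lemma vset_SYM: "vset SYM"
proof (rule vset_subsetI)
  let ?P = "{PR x y | x y. x \<in> El X \<and> y \<in> El X}"
  show "vset {g \<in> V. El g \<subseteq> ?P}" using X_in by (intro vset_Pow vset_times vset_El)
  show "SYM \<subseteq> {g \<in> V. El g \<subseteq> ?P}"
  proof
    fix g assume g: "g \<in> SYM"
    have "El g \<subseteq> ?P" using SYM_graph[OF g] perm_in[OF perm_app[OF g]] by blast
    then show "g \<in> {g \<in> V. El g \<subseteq> ?P}" using SYM_in[OF g] by simp
  qed
  have "D (\<lambda>e. True \<and> (\<forall>p\<in>El (e 0). \<exists>x\<in>El X. \<exists>y\<in>V. p = PR x y) \<and>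
    (\<forall>x\<in>El X. \<exists>y\<in>El X. PR x y \<in> El (e 0) \<and> (\<forall>z\<in>V. PR x z \<in> El (e 0) \<longrightarrow> z = y)) \<and>
    (\<forall>y\<in>El X. \<exists>x\<in>El X. PR x y \<in> El (e 0) \<and> (\<forall>z\<in>El X. PR z y \<in> El (e 0) \<longrightarrow> z = x)))"
    by (intro dfn X_in vset_El)
  then show "D (\<lambda>e. e 0 \<in> SYM)"
    by (rule D_congI) (auto simp only: SYM_iff image_subset_iff)
qed

lemma tapp_tuple: "g \<in> V \<Longrightarrow> set as \<subseteq> El X \<Longrightarrow> TUP (map (tapp g) as) \<in> V"
  using tapp_in[of g] X_mem by (intro TUP_in) auto

text \<open>Join of the table of componentwise images with the atoms along the argument
  tuple.\<close>

lemma vset_amap_table: "vset amap_table"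
proof -
  let ?T = "{PR g (PR (TUP as) (TUP (map (tapp g) as))) | g as. g \<in> SYM \<and> set as \<subseteq> El X}"
  let ?A = "{PR (pfst l) (PR u (PR (pfst u) (psnd (psnd l)))) | l u. l \<in> ?T \<and> u \<in> atoms \<and> psnd u = pfst (psnd l)}"
  have "vset ?A"
    using vset_tuple_maps[OF vset_El[OF X_in] vset_SYM] vset_atoms by (intro vset_image2_if dfn)
  also have "?A = amap_table"
  proof (intro equalityI subsetI)
    fix y assume "y \<in> ?A"
    then obtain g as u where y: "y = PR (pfst (PR g (PR (TUP as) (TUP (map (tapp g) as)))))
        (PR u (PR (pfst u) (psnd (psnd (PR g (PR (TUP as) (TUP (map (tapp g) as))))))))"
      "g \<in> SYM" "set as \<subseteq> El X" "u \<in> atoms" "psnd u = pfst (psnd (PR g (PR (TUP as) (TUP (map (tapp g) as)))))"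
      by blast
    obtain R bs where u: "u = atom R bs" "has_arity mem L R (length bs)" "set bs \<subseteq> El X"
      using y(4) by (rule atomsE)
    have V: "g \<in> V" "TUP as \<in> V" "TUP bs \<in> V" "R \<in> V"
      using SYM_in[OF y(2)] atoms_tuple[OF y(3)] atoms_tuple[OF u(3)] arity_in[OF u(2)] .
    have "TUP (map (tapp g) as) \<in> V" using tapp_tuple[OF V(1) y(3)] .
    with V have "as = bs" using y(5) by (simp add: u(1))
    with V \<open>TUP (map (tapp g) as) \<in> V\<close> have "y = PR g (PR u (amap (tapp g) u))"
      unfolding y(1) u(1) by simp
    then show "y \<in> amap_table" unfolding amap_table_def using y by blast
  next
    fix y assume "y \<in> amap_table"
    then obtain g u where y: "y = PR g (PR u (amap (tapp g) u))" "g \<in> SYM" "u \<in> atoms"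
      unfolding amap_table_def by blast
    obtain R bs where u: "u = atom R bs" "has_arity mem L R (length bs)" "set bs \<subseteq> El X"
      using y(3) by (rule atomsE)
    have V: "g \<in> V" "TUP bs \<in> V" "R \<in> V"
      using SYM_in[OF y(2)] atoms_tuple[OF u(3)] arity_in[OF u(2)] .
    have V': "TUP (map (tapp g) bs) \<in> V" using tapp_tuple[OF V(1) u(3)] .
    show "y \<in> ?A"
      unfolding mem_Collect_eq
      by (rule exI[of _ "PR g (PR (TUP bs) (TUP (map (tapp g) bs)))"], rule exI[of _ u])
        (use V V' y u in auto)
  qed
  finally show ?thesis .
qed

lemma amap_table_iff:
  assumes "g \<in> SYM" "u \<in> atoms"
  shows "PR g (PR u v) \<in> amap_table \<longleftrightarrow> v = amap (app mem g) u"
proof -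
  have "amap (tapp g) u = amap (app mem g) u"
    by (rule amap_cong) (use assms supp_subset tapp_SYM in blast)+
  then show ?thesis unfolding amap_table_def using assms by auto
qed

definition move :: "('v \<Rightarrow> 'v) \<Rightarrow> 'v \<Rightarrow> 'v" where
  "move \<pi> M = SET (amap \<pi> ` El M)"

text \<open>Definable twin of \<open>act\<close>: images of atoms are looked up in
  \<open>amap_table\<close>, which is a set of the model and can serve as a parameter.\<close>

definition vact :: "'v \<Rightarrow> 'v \<Rightarrow> 'v" where
  "vact g M = SET {v \<in> atoms. \<exists>u\<in>El M. PR g (PR u v) \<in> amap_table}"

lemma dfun_vact [dfn]:
  assumes "dfun s" "dfun t" shows "dfun (\<lambda>e. vact (s e) (t e))"
  unfolding vact_def
proof (rule dfun_SET)
  have "vset {v \<in> atoms. \<exists>u\<in>El M. PR g (PR u v) \<in> amap_table}" if "g \<in> V" "M \<in> V" for g M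
    using that by (intro vset_sep vset_atoms dfn vset_amap_table)
  then show "vset {v \<in> atoms. \<exists>u\<in>El (t e). PR (s e) (PR u v) \<in> amap_table}" if "range e \<subseteq> V" for e
    using dfun_in[OF assms(1) that] dfun_in[OF assms(2) that] by blast
  show "D (\<lambda>e. e 0 \<in> {v \<in> atoms. \<exists>u\<in>El (t (\<lambda>i. e (Suc i))). PR (s (\<lambda>i. e (Suc i))) (PR u v) \<in> amap_table})"
    unfolding mem_Collect_eq
    by (intro dfn vset_amap_table vset_atoms dfun_rename[OF assms(2)])
      (rule dfun_rename[OF assms(1), of "\<lambda>i. Suc (Suc i)"])
qed

lemma Structs_atoms: "M \<in> Structs \<Longrightarrow> u \<in> El M \<Longrightarrow> u \<in> atoms"
  using Structs_iff by blast

lemma amap_image_cong: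
  assumes "M \<in> Structs" "\<And>x. x \<in> El X \<Longrightarrow> \<pi> x = \<sigma> x"
  shows "amap \<pi> ` El M = amap \<sigma> ` El M"
proof (rule image_cong[OF refl], rule amap_cong)
  fix u x assume u: "u \<in> El M"
  show "u \<in> atoms" using Structs_atoms[OF assms(1) u] .
  assume "x \<in> supp u"
  then have "x \<in> El X" using supp_subset[OF \<open>u \<in> atoms\<close>] by blast
  then show "\<pi> x = \<sigma> x" by (rule assms(2))
qed

lemma move_cong: "M \<in> Structs \<Longrightarrow> (\<And>x. x \<in> El X \<Longrightarrow> \<pi> x = \<sigma> x) \<Longrightarrow> move \<pi> M = move \<sigma> M"
  unfolding move_def by (intro arg_cong[of _ _ SET] amap_image_cong)

lemma vact_elts:
  assumes "g \<in> SYM" "M \<in> Structs"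
  shows "{v \<in> atoms. \<exists>u\<in>El M. PR g (PR u v) \<in> amap_table} = amap (app mem g) ` El M"
proof -
  have "PR g (PR u v) \<in> amap_table \<longleftrightarrow> v = amap (app mem g) u" if "u \<in> El M" for u v
    using amap_table_iff[OF assms(1) Structs_atoms[OF assms(2) that]] .
  moreover have "amap (app mem g) u \<in> atoms" if "u \<in> El M" for u
    using amap_in[OF perm_app[OF assms(1)] Structs_atoms[OF assms(2) that]] .
  ultimately show ?thesis by auto
qed

lemma vact_move: "g \<in> SYM \<Longrightarrow> M \<in> Structs \<Longrightarrow> vact g M = move (app mem g) M"
  by (simp add: vact_def move_def vact_elts)

lemma act_move:
  assumes "g \<in> SYM" "M \<in> Structs" shows "act mem g M = move (app mem g) M"
proof -
  have "{atom R (map (app mem g) as) | R as. atom R as \<in> El M} = amap (app mem g) ` El M"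
  proof (intro equalityI subsetI)
    fix v assume "v \<in> amap (app mem g) ` El M"
    then obtain u where u: "v = amap (app mem g) u" "u \<in> El M" by blast
    obtain R as where "u = atom R as" using Structs_atoms[OF assms(2) u(2)] by (rule atomsE)
    then show "v \<in> {atom R (map (app mem g) as) | R as. atom R as \<in> El M}" using u by auto
  qed force
  then show ?thesis by (simp add: act_def move_def)
qed

lemma El_move:
  assumes "perm \<pi>" "M \<in> Structs" shows "El (move \<pi> M) = amap \<pi> ` El M"
proof -
  have M: "M \<in> V" using assms(2) Structs_iff by blast
  have "vset {v \<in> atoms. \<exists>u\<in>El M. PR (code \<pi>) (PR u v) \<in> amap_table}"
    using M SYM_in[OF code_SYM[OF assms(1)]] by (intro vset_sep vset_atoms dfn vset_amap_table)
  also have "{v \<in> atoms. \<exists>u\<in>El M. PR (code \<pi>) (PR u v) \<in> amap_table} = amap \<pi> ` El M"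
    unfolding vact_elts[OF code_SYM[OF assms(1)] assms(2)]
    by (rule amap_image_cong[OF assms(2) app_code[OF assms(1)]])
  finally show ?thesis by (simp add: move_def El_SET)
qed

lemma vact_code:
  assumes "perm \<pi>" "M \<in> Structs" shows "vact (code \<pi>) M = move \<pi> M"
  unfolding vact_move[OF code_SYM[OF assms(1)] assms(2)]
  by (rule move_cong[OF assms(2) app_code[OF assms(1)]])

lemma move_in:
  assumes "perm \<pi>" "M \<in> Structs" shows "move \<pi> M \<in> Structs"
proof -
  have M: "M \<in> V" using assms(2) Structs_iff by blast
  have "vact (code \<pi>) M \<in> V"
    using dfun_in[OF dfun_vact[OF dfun_const dfun_const], of "code \<pi>" M "\<lambda>_. M"] M
      SYM_in[OF code_SYM[OF assms(1)]] by simp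
  moreover have "amap \<pi> u \<in> atoms" if "u \<in> El M" for u
    using amap_in[OF assms(1) Structs_atoms[OF assms(2) that]] .
  ultimately show ?thesis
    unfolding Structs_iff El_move[OF assms] vact_code[OF assms] by blast
qed

lemma move_comp:
  assumes "perm \<pi>" "perm \<sigma>" "M \<in> Structs" shows "move \<pi> (move \<sigma> M) = move (\<lambda>x. \<pi> (\<sigma> x)) M"
proof -
  have "El (move \<pi> (move \<sigma> M)) = amap (\<lambda>x. \<pi> (\<sigma> x)) ` El M"
    unfolding El_move[OF assms(1) move_in[OF assms(2,3)]] El_move[OF assms(2,3)] image_image
    by (intro image_cong refl amap_comp Structs_atoms[OF assms(3)])
  from SET_eqI[OF this] show ?thesis by (simp add: move_def[of "\<lambda>x. \<pi> (\<sigma> x)"])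
qed

lemma move_id: "M \<in> Structs \<Longrightarrow> (\<And>x. x \<in> El X \<Longrightarrow> \<pi> x = x) \<Longrightarrow> move \<pi> M = M"
proof -
  assume M: "M \<in> Structs" and \<pi>: "\<And>x. x \<in> El X \<Longrightarrow> \<pi> x = x"
  have "amap \<pi> u = u" if "u \<in> El M" for u
    using amap_id[OF Structs_atoms[OF M that]] \<pi> supp_subset[OF Structs_atoms[OF M that]] by blast
  then have "amap \<pi> ` El M = El M" by simp
  then show ?thesis by (simp add: move_def)
qed

lemma move_inv:
  assumes "perm \<pi>" "M \<in> Structs"
  shows "move (inv_into (El X) \<pi>) (move \<pi> M) = M" "move \<pi> (move (inv_into (El X) \<pi>) M) = M"
proof -
  have "\<pi> ` El X = El X" using assms(1) by (simp add: perm_def bij_betw_def)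
  then have "inv_into (El X) \<pi> (\<pi> x) = x" "\<pi> (inv_into (El X) \<pi> x) = x" if "x \<in> El X" for x
    using that perm_inj[OF assms(1)] by (simp_all add: f_inv_into_f)
  then show "move (inv_into (El X) \<pi>) (move \<pi> M) = M" "move \<pi> (move (inv_into (El X) \<pi>) M) = M"
    unfolding move_comp[OF perm_inv[OF assms(1)] assms] move_comp[OF assms(1) perm_inv[OF assms(1)] assms(2)]
    by (simp_all add: move_id[OF assms(2)])
qed

lemma move_inj: "perm \<pi> \<Longrightarrow> inj_on (move \<pi>) Structs"
  using move_inv(1) by (metis inj_onI)

lemma move_image_Structs:
  assumes "perm \<pi>" shows "move \<pi> ` Structs = Structs"
proof
  show "move \<pi> ` Structs \<subseteq> Structs" using move_in[OF assms] by blast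
  show "Structs \<subseteq> move \<pi> ` Structs"
  proof
    fix M assume M: "M \<in> Structs"
    show "M \<in> move \<pi> ` Structs"
      using move_inv(2)[OF assms M] move_in[OF perm_inv[OF assms] M] by (intro image_eqI) simp_all
  qed
qed

end

section \<open>Measurable sets\<close>

context str_model
begin

definition small :: "'v set \<Rightarrow> bool" where
  "small S \<longleftrightarrow> vset S \<and> size_le mem V (SET S) \<kappa>"

lemma size_leI:
  assumes "vset ((\<lambda>x. PR x (f x)) ` El S)" "inj_on f (El S)" "f ` El S \<subseteq> El \<kappa>"
  shows "size_le mem V S \<kappa>"
proof -
  note app = app_fn[OF assms(1)]
  have "inj_on (app mem (fn (El S) f)) (El S)"
    using assms(2) by (subst inj_on_cong[of _ _ f]) (simp_all add: app)
  moreover have "app mem (fn (El S) f) ` El S \<subseteq> El \<kappa>"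
    using assms(3) app by auto
  ultimately show ?thesis
    unfolding size_le_def using fn_in[OF assms(1)] is_fun_fn[OF assms(1)] by blast
qed

lemma small_finite:
  assumes "finite S" "S \<subseteq> V" shows "small S"
proof -
  have S: "vset S" using assms by (rule vset_finite)
  obtain B where B: "B \<subseteq> El \<kappa>" "finite B" "card B = card S"
    using infinite_arbitrarily_large[OF kappa_infinite] by blast
  then obtain f where f: "bij_betw f S B" using finite_same_card_bij assms(1) by metis
  then have inj: "inj_on f S" and img: "f ` S \<subseteq> El \<kappa>" using B by (auto simp: bij_betw_def)
  have "f x \<in> V" if "x \<in> S" for x using img that transitive[OF kappa_in] by blast
  then have "vset ((\<lambda>x. PR x (f x)) ` S)" using assms by (intro vset_finite) auto
  then have "size_le mem V (SET S) \<kappa>" using inj img S by (intro size_leI) (simp_all add: El_SET)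
  then show ?thesis using S by (simp add: small_def)
qed

text \<open>Size is measured by injections that belong to the model, so the comparison map has to be
  definable and not merely injective.\<close>

lemma small_inj:
  assumes "small S" "vset T" "dfun (\<lambda>e. h (e 0))" "inj_on h T" "h ` T \<subseteq> S"
  shows "small T"
proof -
  have S: "vset S" using assms(1) by (simp add: small_def)
  obtain f where f: "f \<in> V" "is_fun mem f S" "inj_on (app mem f) S" "app mem f ` S \<subseteq> El \<kappa>"
    using assms(1) unfolding small_def size_le_def by (auto simp: El_SET)
  have "tapp f (h x) = app mem f (h x)" if "x \<in> T" for x
    using tapp_app[OF f(1,2)] assms(5) that by blast
  then have "(\<lambda>x. PR x (tapp f (h x))) ` T = (\<lambda>x. PR x (app mem f (h x))) ` T" by simp
  moreover have "vset ((\<lambda>x. PR x (tapp f (h x))) ` T)"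
    by (intro vset_graph assms(2) dfun_tapp dfun_const f(1) dfun_app1[OF assms(3)] dfun_var)
  moreover have "inj_on (\<lambda>x. app mem f (h x)) T"
    using comp_inj_on[OF assms(4) inj_on_subset[OF f(3) assms(5)]] by (simp add: comp_def)
  moreover have "(\<lambda>x. app mem f (h x)) ` T \<subseteq> El \<kappa>" using f(4) assms(5) by blast
  ultimately have "size_le mem V (SET T) \<kappa>"
    using assms(2) by (intro size_leI[where f = "\<lambda>x. app mem f (h x)"]) (simp_all add: El_SET)
  then show ?thesis using assms(2) by (simp add: small_def)
qed

lemma small_subset: "small S \<Longrightarrow> vset T \<Longrightarrow> T \<subseteq> S \<Longrightarrow> small T"
  by (rule small_inj[where h = "\<lambda>x. x"]) (auto intro: dfun_var)

lemma small_vset: "small S \<Longrightarrow> vset S" by (simp add: small_def)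

abbreviation "Meas \<equiv> measurable_sets mem V \<kappa> L X"

definition ms :: "'v set \<Rightarrow> bool" where
  "ms A \<longleftrightarrow> (\<exists>a\<in>Meas. A = El a)"

lemma ms_El: "a \<in> Meas \<Longrightarrow> ms (El a)" by (auto simp: ms_def)

lemma ms_SET: "ms A \<Longrightarrow> SET A \<in> Meas" by (auto simp: ms_def)

lemma Meas_in: "a \<in> Meas \<Longrightarrow> a \<in> V" by (simp add: measurable_sets_def)

lemma Meas_subset: "a \<in> Meas \<Longrightarrow> El a \<subseteq> Structs" by (simp add: measurable_sets_def)

lemma ms_vset: "ms A \<Longrightarrow> vset A" by (auto simp: ms_def intro: vset_El Meas_in)

lemma ms_subset: "ms A \<Longrightarrow> A \<subseteq> Structs" using Meas_subset by (auto simp: ms_def)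

lemma ms_El_SET: "ms A \<Longrightarrow> El (SET A) = A" by (intro El_SET ms_vset)

lemma msI:
  assumes "vset A" "A \<subseteq> Structs" "\<And>F. F \<in> V \<Longrightarrow> closed_family mem V \<kappa> L X F \<Longrightarrow> SET A \<in> El F"
  shows "ms A"
  unfolding ms_def using assms
  by (intro bexI[of _ "SET A"]) (simp_all add: El_SET measurable_sets_def vset_SET_in)

lemma closed_familyD: "a \<in> Meas \<Longrightarrow> F \<in> V \<Longrightarrow> closed_family mem V \<kappa> L X F \<Longrightarrow> a \<in> El F"
  by (simp add: measurable_sets_def)

lemma ms_Compl:
  assumes "ms A" shows "ms (Structs - A)"
proof (rule msI)
  show "vset (Structs - A)" using assms by (intro vset_Diff vset_Structs ms_vset)
  fix F assume F: "F \<in> V" "closed_family mem V \<kappa> L X F"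
  have "SET A \<in> El F" using closed_familyD[OF ms_SET[OF assms] F] .
  then have "SET (Structs - El (SET A)) \<in> El F" using F(2) by (simp add: closed_family_def)
  then show "SET (Structs - A) \<in> El F" using assms by (simp add: ms_El_SET)
qed blast

lemma ms_UN:
  assumes "small S" "S \<subseteq> Meas" shows "ms (\<Union>a\<in>S. El a)"
proof (rule msI)
  note S = small_vset[OF assms(1)]
  show "vset (\<Union>a\<in>S. El a)" using S by (rule vset_UN)
  show "(\<Union>a\<in>S. El a) \<subseteq> Structs" using assms(2) Meas_subset by blast
  fix F assume F: "F \<in> V" "closed_family mem V \<kappa> L X F"
  have "El (SET S) \<subseteq> El F" using closed_familyD[OF _ F] assms(2) S by (auto simp: El_SET)
  then have "SET (\<Union>a\<in>El (SET S). El a) \<in> El F"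
    using F(2) assms(1) vset_SET_in[OF S] unfolding closed_family_def small_def by blast
  then show "SET (\<Union>a\<in>S. El a) \<in> El F" using S by (simp add: El_SET)
qed

lemma ms_UN_finite:
  assumes "finite I" "\<And>i. i \<in> I \<Longrightarrow> ms (A i)" shows "ms (\<Union>i\<in>I. A i)"
proof -
  have "ms (\<Union>a\<in>(\<lambda>i. SET (A i)) ` I. El a)"
    using assms by (intro ms_UN small_finite) (auto intro: Meas_in ms_SET)
  then show ?thesis using assms(2) by (simp add: ms_El_SET)
qed

lemma ms_empty: "ms {}"
  using ms_UN_finite[of "{}" "\<lambda>_. {}"] by simp

lemma ms_Structs: "ms Structs"
  using ms_Compl[OF ms_empty] by simp

lemma ms_Un: "ms A \<Longrightarrow> ms B \<Longrightarrow> ms (A \<union> B)"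
  using ms_UN_finite[of "{True, False}" "\<lambda>b. if b then A else B"] by (auto simp: Un_commute)

lemma ms_Int: "ms A \<Longrightarrow> ms B \<Longrightarrow> ms (A \<inter> B)"
proof -
  assume AB: "ms A" "ms B"
  then have "ms (Structs - ((Structs - A) \<union> (Structs - B)))" by (intro ms_Compl ms_Un)
  also have "Structs - ((Structs - A) \<union> (Structs - B)) = A \<inter> B" using AB ms_subset by blast
  finally show ?thesis .
qed

lemma ms_Diff: "ms A \<Longrightarrow> ms B \<Longrightarrow> ms (A - B)"
proof -
  assume AB: "ms A" "ms B"
  then have "ms (A \<inter> (Structs - B))" by (intro ms_Compl ms_Int)
  also have "A \<inter> (Structs - B) = A - B" using AB ms_subset by blast
  finally show ?thesis .
qed

lemma D_holds:
  assumes "is_literal mem L (length as) \<phi>" "set as \<subseteq> El X"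
  shows "D (\<lambda>e. holds mem (e 0) \<phi> as)"
  using assms(1)
proof (induction \<phi>)
  case (LRel R js)
  then have "set (map ((!) as) js) \<subseteq> El X" using assms(2) nth_mem by fastforce
  then have "TUP (map ((!) as) js) \<in> V" by (rule atoms_tuple)
  moreover have "R \<in> V" using LRel arity_in by auto
  ultimately show ?case by (simp, intro dfn) simp_all
qed (auto intro: dfn)

lemma vset_holds:
  assumes "is_literal mem L (length as) \<phi>" "set as \<subseteq> El X"
  shows "vset {M \<in> Structs. holds mem M \<phi> as}"
  using vset_Structs D_holds[OF assms] by (rule vset_sep)

lemma ext_single: "ext mem V L X [\<phi>] as = SET {M \<in> Structs. holds mem M \<phi> as}"
  by (simp add: ext_def)

lemma ms_literal:
  assumes "is_literal mem L (length as) \<phi>" "set as \<subseteq> El X"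
  shows "ms {M \<in> Structs. holds mem M \<phi> as}"
proof (rule msI[OF vset_holds[OF assms]])
  fix F assume "F \<in> V" "closed_family mem V \<kappa> L X F"
  then have "ext mem V L X [\<phi>] as \<in> El F" using assms unfolding closed_family_def by blast
  then show "SET {M \<in> Structs. holds mem M \<phi> as} \<in> El F" by (simp add: ext_single)
qed blast

text \<open>Minimality of \<open>Meas\<close> concerns families that are elements of the model. The
  premise \<open>F\<close> therefore asks that the measurable sets with property \<open>P\<close>
  form such a family, and each use has to supply a definable form of \<open>P\<close>.\<close>

lemma Meas_induct:
  assumes a: "a \<in> Meas" and F: "vset {a \<in> Meas. P (El a)}"
    and Compl: "\<And>A. ms A \<Longrightarrow> P A \<Longrightarrow> P (Structs - A)"
    and UN: "\<And>S. small S \<Longrightarrow> S \<subseteq> Meas \<Longrightarrow> (\<And>a. a \<in> S \<Longrightarrow> P (El a)) \<Longrightarrow> P (\<Union>a\<in>S. El a)"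
    and lit: "\<And>\<phi> as. is_literal mem L (length as) \<phi> \<Longrightarrow> set as \<subseteq> El X \<Longrightarrow>
      P {M \<in> Structs. holds mem M \<phi> as}"
  shows "P (El a)"
proof -
  let ?F = "{a \<in> Meas. P (El a)}"
  have mem_F: "SET A \<in> ?F" if "ms A" "P A" for A
    using that ms_SET by (simp add: ms_El_SET)
  have "closed_family mem V \<kappa> L X (SET ?F)"
    unfolding closed_family_def El_SET[OF F]
  proof (intro conjI ballI allI impI)
    show "El a \<subseteq> Structs" if "a \<in> ?F" for a using that Meas_subset by blast
    show "SET (Structs - El a) \<in> ?F" if "a \<in> ?F" for a
      using that by (intro mem_F ms_Compl Compl ms_El) simp_all
    show "SET (\<Union>a\<in>El S. El a) \<in> ?F" if S: "S \<in> V" "El S \<subseteq> ?F \<and> size_le mem V S \<kappa>" for S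
    proof -
      have "small (El S)" using S by (simp add: small_def vset_El)
      then show ?thesis using S(2) by (intro mem_F ms_UN UN) auto
    qed
    show "ext mem V L X [\<phi>] as \<in> ?F"
      if "is_literal mem L (length as) \<phi> \<and> set as \<subseteq> El X" for \<phi> as
      unfolding ext_single using that by (intro mem_F ms_literal lit) simp_all
  qed
  then have "a \<in> El (SET ?F)" using closed_familyD[OF a vset_SET_in[OF F]] by blast
  then show ?thesis using F by (simp add: El_SET)
qed

section \<open>Cylinder sets\<close>

text \<open>The basic cylinder sets, given by required and excluded atomic facts. Keeping two sets
  of atoms turns intersection into union and translation into taking images.\<close>

definition con :: "'v set \<Rightarrow> 'v set \<Rightarrow> 'v set" where
  "con P N = {M \<in> Structs. P \<subseteq> El M \<and> N \<inter> El M = {}}"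

lemma ms_atom:
  assumes "u \<in> atoms" shows "ms {M \<in> Structs. u \<in> El M}"
proof -
  obtain R as where u: "u = atom R as" "has_arity mem L R (length as)" "set as \<subseteq> El X"
    using assms by (rule atomsE)
  have "ms {M \<in> Structs. holds mem M (LRel R [0..<length as]) as}"
    using u by (intro ms_literal) auto
  then show ?thesis by (simp add: u(1) map_nth)
qed

lemma ms_con:
  assumes "finite P" "finite N" "P \<subseteq> atoms" "N \<subseteq> atoms" shows "ms (con P N)"
proof -
  have "con P N = Structs - ((\<Union>u\<in>P. Structs - {M \<in> Structs. u \<in> El M}) \<union> (\<Union>u\<in>N. {M \<in> Structs. u \<in> El M}))"
    by (auto simp: con_def)
  also have "ms \<dots>"
    using assms by (intro ms_Compl ms_Un ms_UN_finite ms_atom) auto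
  finally show ?thesis .
qed

definition determined :: "'v set \<Rightarrow> 'v set \<Rightarrow> bool" where
  "determined u A \<longleftrightarrow> A \<subseteq> Structs \<and>
     (\<forall>M\<in>Structs. \<forall>N\<in>Structs. (\<forall>a\<in>u. a \<in> El M \<longleftrightarrow> a \<in> El N) \<longrightarrow> (M \<in> A \<longleftrightarrow> N \<in> A))"

definition fd :: "'v set \<Rightarrow> bool" where
  "fd A \<longleftrightarrow> (\<exists>u. finite u \<and> u \<subseteq> atoms \<and> determined u A)"

lemma determined_mono: "determined u A \<Longrightarrow> u \<subseteq> v \<Longrightarrow> determined v A"
  unfolding determined_def by (meson subsetD)

lemma determined_Compl: "determined u A \<Longrightarrow> determined u (Structs - A)"
  unfolding determined_def by blast

lemma determined_Un: "determined u A \<Longrightarrow> determined u B \<Longrightarrow> determined u (A \<union> B)"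
  unfolding determined_def by blast

lemma determined_Int: "determined u A \<Longrightarrow> determined u B \<Longrightarrow> determined u (A \<inter> B)"
  unfolding determined_def by blast

lemma fd_Compl: "fd A \<Longrightarrow> fd (Structs - A)"
  using determined_Compl unfolding fd_def by blast

lemma fd_Un: "fd A \<Longrightarrow> fd B \<Longrightarrow> fd (A \<union> B)"
  unfolding fd_def by (metis determined_Un determined_mono finite_Un Un_least Un_upper1 Un_upper2)

lemma fd_empty: "fd {}"
  unfolding fd_def determined_def by (intro exI[of _ "{}"]) auto

lemma determined_con: "determined (P \<union> N) (con P N)"
  unfolding determined_def con_def by blast

lemma fd_literal:
  assumes "is_literal mem L (length as) \<phi>" "set as \<subseteq> El X"
  shows "fd {M \<in> Structs. holds mem M \<phi> as}"
  using assms(1)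
proof (induction \<phi>)
  case (LRel R js)
  then have "set (map ((!) as) js) \<subseteq> El X" using assms(2) nth_mem by fastforce
  then have "atom R (map ((!) as) js) \<in> atoms"
    using LRel unfolding atoms_def by (intro CollectI exI[of _ R] exI[of _ "map ((!) as) js"]) auto
  then show ?case
    unfolding fd_def determined_def by (intro exI[of _ "{atom R (map ((!) as) js)}"]) auto
next
  case (LEq i j)
  then show ?case unfolding fd_def determined_def by (intro exI[of _ "{}"]) auto
next
  case (LNeg \<phi>)
  then have "fd (Structs - {M \<in> Structs. holds mem M \<phi> as})" by (intro fd_Compl) simp
  also have "Structs - {M \<in> Structs. holds mem M \<phi> as} = {M \<in> Structs. holds mem M (LNeg \<phi>) as}" by auto
  finally show ?case .
qed

lemma SET_Structs: "finite W \<Longrightarrow> W \<subseteq> atoms \<Longrightarrow> SET W \<in> Structs \<and> El (SET W) = W"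
proof -
  assume W: "finite W" "W \<subseteq> atoms"
  then have "vset W" using vset_subset[OF vset_atoms] by (intro vset_finite) auto
  then show ?thesis using W by (simp add: Structs_iff El_SET vset_SET_in)
qed

text \<open>Each \<open>W \<subseteq> u\<close> is itself the extension of a structure and
  represents the cell of all structures that agree with it on \<open>u\<close>; so a cell lies in
  \<open>A\<close> exactly when \<open>SET W\<close> does.\<close>

lemma determined_eq_UN:
  assumes "finite u" "u \<subseteq> atoms" "determined u A"
  shows "A = (\<Union>W\<in>{W \<in> Pow u. SET W \<in> A}. con W (u - W))"
proof (intro equalityI subsetI)
  fix M assume M: "M \<in> A"
  then have MS: "M \<in> Structs" using assms(3) by (auto simp: determined_def)
  let ?W = "El M \<inter> u"
  have W: "SET ?W \<in> Structs" "El (SET ?W) = ?W"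
    using SET_Structs[of ?W] assms(1,2) by auto
  then have "SET ?W \<in> A"
    using assms(3) M MS unfolding determined_def by blast
  moreover have "M \<in> con ?W (u - ?W)" using MS by (auto simp: con_def)
  ultimately show "M \<in> (\<Union>W\<in>{W \<in> Pow u. SET W \<in> A}. con W (u - W))" by blast
next
  fix M assume "M \<in> (\<Union>W\<in>{W \<in> Pow u. SET W \<in> A}. con W (u - W))"
  then obtain W where W: "W \<subseteq> u" "SET W \<in> A" "M \<in> con W (u - W)" by blast
  then have "SET W \<in> Structs" "El (SET W) = W"
    using SET_Structs[of W] assms(1,2) finite_subset[of W u] by auto
  moreover have "M \<in> Structs" "\<forall>a\<in>u. a \<in> El M \<longleftrightarrow> a \<in> W" using W by (auto simp: con_def)
  ultimately show "M \<in> A" using assms(3) W(2) unfolding determined_def by blast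
qed

lemma determined_ms:
  assumes "finite u" "u \<subseteq> atoms" "determined u A" shows "ms A"
proof -
  have "ms (\<Union>W\<in>{W \<in> Pow u. SET W \<in> A}. con W (u - W))"
    using assms(1,2) by (intro ms_UN_finite ms_con) (auto intro: finite_subset)
  then show ?thesis using determined_eq_UN[OF assms] by simp
qed

lemma fd_ms: "fd A \<Longrightarrow> ms A"
  using determined_ms by (auto simp: fd_def)

text \<open>The finite sets of atoms form a set of the model, so \<open>fd\<close> is definable;
  measurability is automatic. This family is the range of approximants in the inductions
  below.\<close>

lemma vset_fd: "vset {a \<in> Meas. fd (El a)}"
proof (rule vset_subsetI)
  let ?F = "{SET F | F. F \<subseteq> atoms \<and> finite F}"
  show "vset {y \<in> V. El y \<subseteq> Structs}" by (intro vset_Pow vset_Structs)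
  show "{a \<in> Meas. fd (El a)} \<subseteq> {y \<in> V. El y \<subseteq> Structs}" using Meas_in Meas_subset by blast
  have F: "vset ?F" by (intro vset_finite_subsets vset_atoms)
  have "D (\<lambda>e. (\<forall>M\<in>El (e 0). M \<in> Structs) \<and> (\<exists>u\<in>?F. \<forall>M\<in>Structs. \<forall>N\<in>Structs.
      (\<forall>a\<in>El u. a \<in> El M \<longleftrightarrow> a \<in> El N) \<longrightarrow> (M \<in> El (e 0) \<longleftrightarrow> N \<in> El (e 0))))"
    by (intro dfn F vset_Structs)
  then show "D (\<lambda>e. e 0 \<in> {a \<in> Meas. fd (El a)})"
  proof (rule D_congI)
    fix e :: "nat \<Rightarrow> 'v"
    have "e 0 \<in> {a \<in> Meas. fd (El a)} \<longleftrightarrow> fd (El (e 0))"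
      using fd_ms[of "El (e 0)"] ms_SET[of "El (e 0)"] by auto
    also have "\<dots> \<longleftrightarrow> (\<exists>u\<in>?F. determined (El u) (El (e 0)))"
    proof
      assume "fd (El (e 0))"
      then obtain u where u: "finite u" "u \<subseteq> atoms" "determined u (El (e 0))"
        unfolding fd_def by blast
      then show "\<exists>u\<in>?F. determined (El u) (El (e 0))"
        using SET_Structs[of u] by (intro bexI[of _ "SET u"]) auto
    next
      assume "\<exists>u\<in>?F. determined (El u) (El (e 0))"
      then obtain u where u: "u \<subseteq> atoms" "finite u" "determined (El (SET u)) (El (e 0))" by blast
      then show "fd (El (e 0))"
        unfolding fd_def using SET_Structs[of u] by (intro exI[of _ u]) simp
    qed
    finally show "(\<forall>M\<in>El (e 0). M \<in> Structs) \<and> (\<exists>u\<in>?F. \<forall>M\<in>Structs. \<forall>N\<in>Structs.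
      (\<forall>a\<in>El u. a \<in> El M \<longleftrightarrow> a \<in> El N) \<longrightarrow> (M \<in> El (e 0) \<longleftrightarrow> N \<in> El (e 0)))
      \<longleftrightarrow> e 0 \<in> {a \<in> Meas. fd (El a)}"
      unfolding determined_def by blast
  qed
qed

section \<open>Images of measurable sets under permutations\<close>

definition vimg :: "'v \<Rightarrow> 'v \<Rightarrow> 'v" where
  "vimg g a = SET (vact g ` El a)"

lemma dfun_vimg [dfn]:
  assumes "dfun s" "dfun t" shows "dfun (\<lambda>e. vimg (s e) (t e))"
  unfolding vimg_def
proof (rule dfun_SET)
  have "vset (vact g ` El a)" if "g \<in> V" "a \<in> V" for g a
    using that by (intro vset_image_dfun vset_El dfn)
  then show "vset (vact (s e) ` El (t e))" if "range e \<subseteq> V" for e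
    using dfun_in[OF assms(1) that] dfun_in[OF assms(2) that] by blast
  have "D (\<lambda>e. \<exists>M\<in>El (t (\<lambda>i. e (Suc i))). e 0 = vact (s (\<lambda>i. e (Suc i))) M)"
    by (intro dfn dfun_rename[OF assms(2)]) (rule dfun_rename[OF assms(1), of "\<lambda>i. Suc (Suc i)"])
  then show "D (\<lambda>e. e 0 \<in> vact (s (\<lambda>i. e (Suc i))) ` El (t (\<lambda>i. e (Suc i))))"
    by (rule D_congI) auto
qed

lemma vimg_move:
  assumes "perm \<pi>" "vset A" "A \<subseteq> Structs"
  shows "vimg (code \<pi>) (SET A) = SET (move \<pi> ` A)" "vset (move \<pi> ` A)"
proof -
  have *: "vact (code \<pi>) ` A = move \<pi> ` A"
    using assms(3) vact_code[OF assms(1)] by (intro image_cong) auto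
  then show "vimg (code \<pi>) (SET A) = SET (move \<pi> ` A)" using assms(2) by (simp add: vimg_def El_SET)
  have "vset (vact (code \<pi>) ` A)"
    using assms(2) SYM_in[OF code_SYM[OF assms(1)]] by (intro vset_image_dfun dfn)
  then show "vset (move \<pi> ` A)" by (simp add: *)
qed

lemma move_image_inv:
  assumes "perm \<pi>" "A \<subseteq> Structs"
  shows "move (inv_into (El X) \<pi>) ` move \<pi> ` A = A" "move \<pi> ` move (inv_into (El X) \<pi>) ` A = A"
  using assms(2) move_inv[OF assms(1)] by (force simp: image_image)+

lemma move_image_comp:
  assumes "perm \<pi>" "perm \<sigma>" "A \<subseteq> Structs"
  shows "move \<pi> ` move \<sigma> ` A = move (\<lambda>x. \<pi> (\<sigma> x)) ` A"
  unfolding image_image using assms(3) by (intro image_cong refl move_comp assms(1,2)) blast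

lemma move_image_con:
  assumes "perm \<pi>" "P \<subseteq> atoms" "N \<subseteq> atoms"
  shows "move \<pi> ` con P N = con (amap \<pi> ` P) (amap \<pi> ` N)"
proof -
  have inj: "inj_on (amap \<pi>) atoms" using amap_inv(1)[OF assms(1)] by (rule inj_on_inverseI)
  have iff: "move \<pi> M \<in> con (amap \<pi> ` P) (amap \<pi> ` N) \<longleftrightarrow> M \<in> con P N" if M: "M \<in> Structs" for M
  proof -
    have "El M \<subseteq> atoms" using M Structs_iff by blast
    then have *: "amap \<pi> u \<in> amap \<pi> ` El M \<longleftrightarrow> u \<in> El M" if "u \<in> atoms" for u
      using inj_on_image_mem_iff[OF inj that] by blast
    have "amap \<pi> ` P \<subseteq> amap \<pi> ` El M \<longleftrightarrow> P \<subseteq> El M"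
      unfolding image_subset_iff using * assms(2) by blast
    moreover have "amap \<pi> ` N \<inter> amap \<pi> ` El M = {} \<longleftrightarrow> (\<forall>u\<in>N. amap \<pi> u \<notin> amap \<pi> ` El M)" by blast
    moreover have "\<dots> \<longleftrightarrow> (\<forall>u\<in>N. u \<notin> El M)" using * assms(3) by blast
    moreover have "\<dots> \<longleftrightarrow> N \<inter> El M = {}" by blast
    ultimately have "amap \<pi> ` P \<subseteq> amap \<pi> ` El M \<longleftrightarrow> P \<subseteq> El M"
      "amap \<pi> ` N \<inter> amap \<pi> ` El M = {} \<longleftrightarrow> N \<inter> El M = {}" by simp_all
    then show ?thesis using M move_in[OF assms(1) M] by (simp add: con_def El_move[OF assms(1) M])
  qed
  show ?thesis
  proof (intro equalityI subsetI)
    fix M assume "M \<in> con (amap \<pi> ` P) (amap \<pi> ` N)"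
    then have M: "M \<in> Structs" "M \<in> con (amap \<pi> ` P) (amap \<pi> ` N)" by (auto simp: con_def)
    obtain N' where N': "N' \<in> Structs" "M = move \<pi> N'"
      using move_image_Structs[OF assms(1)] M(1) by blast
    then show "M \<in> move \<pi> ` con P N" using iff[of N'] M(2) by blast
  next
    fix M assume "M \<in> move \<pi> ` con P N"
    then obtain N' where N': "M = move \<pi> N'" "N' \<in> con P N" by blast
    then have "N' \<in> Structs" by (simp add: con_def)
    then show "M \<in> con (amap \<pi> ` P) (amap \<pi> ` N)" using iff N' by blast
  qed
qed

text \<open>Fixing all points that occur in \<open>u\<close> fixes the atoms in \<open>u\<close>, so
  a structure and its translate agree on \<open>u\<close>.\<close>

lemma move_image_determined:
  assumes "perm \<pi>" "determined u A" "u \<subseteq> atoms" "\<And>a x. a \<in> u \<Longrightarrow> x \<in> supp a \<Longrightarrow> \<pi> x = x"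
  shows "move \<pi> ` A = A"
proof -
  have AS: "A \<subseteq> Structs" using assms(2) by (simp add: determined_def)
  have fix_a: "amap \<pi> a = a" if "a \<in> u" for a
    using that assms(3,4) by (intro amap_id) auto
  have iff: "move \<pi> M \<in> A \<longleftrightarrow> M \<in> A" if M: "M \<in> Structs" for M
  proof -
    have "a \<in> El (move \<pi> M) \<longleftrightarrow> a \<in> El M" if a: "a \<in> u" for a
    proof -
      have "a \<in> El M" if b: "b \<in> El M" "a = amap \<pi> b" for b
      proof -
        have "b \<in> atoms" "a \<in> atoms" using Structs_atoms[OF M b(1)] a assms(3) by auto
        then have "b = a" using amap_inv(1)[OF assms(1)] fix_a[OF a] b(2) by metis
        then show ?thesis using b by simp
      qed
      moreover have "a \<in> amap \<pi> ` El M" if "a \<in> El M" using that fix_a[OF a] by (metis imageI)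
      ultimately show ?thesis unfolding El_move[OF assms(1) M] by blast
    qed
    then show ?thesis using assms(2) M move_in[OF assms(1) M] unfolding determined_def by blast
  qed
  show ?thesis
  proof (intro equalityI subsetI)
    fix M assume "M \<in> A"
    moreover obtain N where "N \<in> Structs" "M = move \<pi> N"
      using move_image_Structs[OF assms(1)] AS \<open>M \<in> A\<close> by blast
    ultimately show "M \<in> move \<pi> ` A" using iff by blast
  next
    fix M assume "M \<in> move \<pi> ` A"
    then show "M \<in> A" using iff AS by blast
  qed
qed

end

section \<open>Measures and approximation\<close>

context str_model
begin

lemma dfun_Diff [dfn]:
  assumes "dfun s" "dfun t" shows "dfun (\<lambda>e. SET (El (s e) - El (t e)))"
proof (rule dfun_SET)
  show "D (\<lambda>e. e 0 \<in> El (s (\<lambda>i. e (Suc i))) - El (t (\<lambda>i. e (Suc i))))"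
    unfolding Diff_iff
    by (intro dfn dfun_rename[OF assms(1)] dfun_rename[OF assms(2)])
qed (intro vset_Diff vset_El dfun_in assms)

section \<open>Set functions in HOL that stand for measures of the model\<close>

definition fin_additive :: "('v set \<Rightarrow> real) \<Rightarrow> bool" where
  "fin_additive m \<longleftrightarrow> (\<forall>A. ms A \<longrightarrow> 0 \<le> m A) \<and>
     (\<forall>A B. ms A \<longrightarrow> ms B \<longrightarrow> A \<inter> B = {} \<longrightarrow> m (A \<union> B) = m A + m B)"

text \<open>The form of \<kappa>-additivity suited to approximation: it speaks of arbitrary small
  unions, without disjointness and without an indexing.\<close>

definition smooth :: "('v set \<Rightarrow> real) \<Rightarrow> bool" where
  "smooth m \<longleftrightarrow> (\<forall>S \<epsilon>. small S \<longrightarrow> S \<subseteq> Meas \<longrightarrow> 0 < \<epsilon> \<longrightarrow>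
     (\<exists>F\<subseteq>S. finite F \<and> m (\<Union>a\<in>S. El a) \<le> m (\<Union>a\<in>F. El a) + \<epsilon>))"

text \<open>Makes a HOL set function visible to the model: the table of its comparisons with
  rationals serves as a parameter, which renders approximability definable.\<close>

definition comparable :: "('v set \<Rightarrow> real) \<Rightarrow> bool" where
  "comparable m \<longleftrightarrow> (\<exists>T. vset T \<and> (\<forall>A q. ms A \<longrightarrow> 0 < q \<longrightarrow> q < 1 \<longrightarrow>
     (PR (SET A) (RC q) \<in> T \<longleftrightarrow> of_rat q < m A)))"

text \<open>Stated for HOL functions so that the translate of a measure by a permutation qualifies
  without a code being constructed for it.\<close>

definition kmeas :: "('v set \<Rightarrow> real) \<Rightarrow> bool" where
  "kmeas m \<longleftrightarrow> fin_additive m \<and> smooth m \<and> comparable m"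

lemma fin_additive_nonneg: "fin_additive m \<Longrightarrow> ms A \<Longrightarrow> 0 \<le> m A"
  by (simp add: fin_additive_def)

lemma fin_additive_Un: "fin_additive m \<Longrightarrow> ms A \<Longrightarrow> ms B \<Longrightarrow> A \<inter> B = {} \<Longrightarrow> m (A \<union> B) = m A + m B"
  by (simp add: fin_additive_def)

lemma fin_additive_empty: "fin_additive m \<Longrightarrow> m {} = 0"
  using fin_additive_Un[of m "{}" "{}"] ms_empty by simp

lemma fin_additive_Diff:
  assumes "fin_additive m" "ms A" "ms B" "B \<subseteq> A" shows "m (A - B) = m A - m B"
proof -
  have "m (B \<union> (A - B)) = m B + m (A - B)"
    using assms by (intro fin_additive_Un ms_Diff) auto
  moreover have "B \<union> (A - B) = A" using assms(4) by blast
  ultimately show ?thesis by simp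
qed

lemma fin_additive_mono: "fin_additive m \<Longrightarrow> ms A \<Longrightarrow> ms B \<Longrightarrow> B \<subseteq> A \<Longrightarrow> m B \<le> m A"
  using fin_additive_Diff[of m A B] fin_additive_nonneg[of m "A - B"] ms_Diff by fastforce

lemma fin_additive_split:
  assumes "fin_additive m" "ms A" "ms B" shows "m A = m (A \<inter> B) + m (A - B)"
proof -
  have "m ((A \<inter> B) \<union> (A - B)) = m (A \<inter> B) + m (A - B)"
    using assms by (intro fin_additive_Un ms_Diff ms_Int) auto
  then show ?thesis by (simp add: Int_Diff_Un)
qed

lemma fin_additive_le_Un:
  assumes "fin_additive m" "ms A" "ms B" "ms C" "A \<subseteq> B \<union> C" shows "m A \<le> m B + m C"
proof -
  have "m A \<le> m (B \<union> (C - B))"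
    using assms by (intro fin_additive_mono ms_Un ms_Diff) auto
  also have "\<dots> = m B + m (C - B)"
    using assms by (intro fin_additive_Un ms_Diff) auto
  also have "m (C - B) \<le> m C"
    using assms by (intro fin_additive_mono ms_Diff) auto
  finally show ?thesis by simp
qed

lemma fin_additive_UN:
  assumes "fin_additive m" "finite I" "\<And>i. i \<in> I \<Longrightarrow> ms (A i)" "disjoint_family_on A I"
  shows "m (\<Union>i\<in>I. A i) = (\<Sum>i\<in>I. m (A i))"
  using assms(2,3,4)
proof (induction I)
  case empty
  then show ?case using assms(1) by (simp add: fin_additive_empty)
next
  case (insert i I)
  have "A i \<inter> A j = {}" if "j \<in> I" for j
    using disjoint_family_onD[OF insert.prems(2), of i j] insert.hyps(2) that by blast
  then have disj: "A i \<inter> (\<Union>j\<in>I. A j) = {}" by blast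
  have ms: "ms (A i)" "ms (\<Union>j\<in>I. A j)"
    using insert.hyps(1) insert.prems(1) by (simp_all add: ms_UN_finite)
  have "disjoint_family_on A I"
    using insert.prems(2) by (rule disjoint_family_on_mono[rotated]) blast
  then have "m (\<Union>j\<in>I. A j) = (\<Sum>j\<in>I. m (A j))"
    using insert.prems(1) by (intro insert.IH) simp_all
  then show ?case
    using fin_additive_Un[OF assms(1) ms disj] insert.hyps by simp
qed

lemma fin_additive_determined:
  assumes "fin_additive m" "finite u" "u \<subseteq> atoms" "determined u A"
  shows "m A = (\<Sum>W\<in>Pow u. if SET W \<in> A then m (con W (u - W)) else 0)"
proof -
  let ?\<W> = "{W \<in> Pow u. SET W \<in> A}"
  have fin: "finite (Pow u)" using assms(2) by simp
  have "m A = m (\<Union>W\<in>?\<W>. con W (u - W))"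
    using determined_eq_UN[OF assms(2-4)] by simp
  also have "\<dots> = (\<Sum>W\<in>?\<W>. m (con W (u - W)))"
    using assms by (intro fin_additive_UN ms_con)
      (auto simp: disjoint_family_on_def con_def intro: finite_subset)
  also have "\<dots> = (\<Sum>W\<in>Pow u. if SET W \<in> A then m (con W (u - W)) else 0)"
    using sum.inter_filter[OF fin] by simp
  finally show ?thesis .
qed

section \<open>Approximation by finitely determined sets\<close>

definition sdiff :: "'v set \<Rightarrow> 'v set \<Rightarrow> 'v set" where
  "sdiff A B = (A - B) \<union> (B - A)"

lemma ms_sdiff: "ms A \<Longrightarrow> ms B \<Longrightarrow> ms (sdiff A B)"
  unfolding sdiff_def by (intro ms_Un ms_Diff)

lemma fin_additive_sdiff:
  assumes "fin_additive m" "ms A" "ms B" shows "\<bar>m A - m B\<bar> \<le> m (sdiff A B)"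
proof -
  have "m A \<le> m B + m (sdiff A B)" "m B \<le> m A + m (sdiff A B)"
    using assms by (intro fin_additive_le_Un ms_sdiff; force simp: sdiff_def)+
  then show ?thesis by linarith
qed

text \<open>One and the same \<open>B\<close> serves both set functions; otherwise their values at
  \<open>A\<close> could not be compared through it. Errors are rationals between 0 and 1 since
  these are the ones whose codes \<open>pos_rats\<close> collects.\<close>

definition approximable :: "('v set \<Rightarrow> real) \<Rightarrow> ('v set \<Rightarrow> real) \<Rightarrow> 'v set \<Rightarrow> bool" where
  "approximable m m' A \<longleftrightarrow> (\<forall>q::rat. 0 < q \<longrightarrow> q < 1 \<longrightarrow>
     (\<exists>B. fd B \<and> m (sdiff A B) \<le> of_rat q \<and> m' (sdiff A B) \<le> of_rat q))"

lemma approximable_fd: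
  assumes "fin_additive m" "fin_additive m'" "fd A" shows "approximable m m' A"
  unfolding approximable_def using assms
  by (auto intro!: exI[of _ A] simp: sdiff_def fin_additive_empty)

lemma approximable_Compl:
  assumes "approximable m m' A" "ms A" shows "approximable m m' (Structs - A)"
  unfolding approximable_def
proof (intro allI impI)
  fix q :: rat assume "0 < q" "q < 1"
  then obtain B where B: "fd B" "m (sdiff A B) \<le> of_rat q" "m' (sdiff A B) \<le> of_rat q"
    using assms(1) unfolding approximable_def by blast
  have "sdiff (Structs - A) (Structs - B) = sdiff A B"
    using ms_subset[OF assms(2)] ms_subset[OF fd_ms[OF B(1)]] unfolding sdiff_def by blast
  then show "\<exists>B. fd B \<and> m (sdiff (Structs - A) B) \<le> of_rat q \<and> m' (sdiff (Structs - A) B) \<le> of_rat q"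
    using B fd_Compl by (intro exI[of _ "Structs - B"]) simp
qed

lemma approximable_Un:
  assumes m: "fin_additive m" "fin_additive m'" and ms: "ms A" "ms A'"
    and appr: "approximable m m' A" "approximable m m' A'"
  shows "approximable m m' (A \<union> A')"
  unfolding approximable_def
proof (intro allI impI)
  fix q :: rat assume q: "0 < q" "q < 1"
  then have q2: "0 < q / 2" "q / 2 < 1" by auto
  have half: "of_rat (q / 2) + of_rat (q / 2) = (of_rat q :: real)" by (simp flip: of_rat_add)
  obtain B where B: "fd B" "m (sdiff A B) \<le> of_rat (q / 2)" "m' (sdiff A B) \<le> of_rat (q / 2)"
    using appr(1) q2 unfolding approximable_def by blast
  obtain B' where B': "fd B'" "m (sdiff A' B') \<le> of_rat (q / 2)" "m' (sdiff A' B') \<le> of_rat (q / 2)"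
    using appr(2) q2 unfolding approximable_def by blast
  have "n (sdiff (A \<union> A') (B \<union> B')) \<le> n (sdiff A B) + n (sdiff A' B')" if "fin_additive n" for n
    using that ms fd_ms[OF B(1)] fd_ms[OF B'(1)]
    by (intro fin_additive_le_Un ms_sdiff ms_Un) (auto simp: sdiff_def)
  from this[OF m(1)] this[OF m(2)]
  show "\<exists>C. fd C \<and> m (sdiff (A \<union> A') C) \<le> of_rat q \<and> m' (sdiff (A \<union> A') C) \<le> of_rat q"
    using B B' half by (intro exI[of _ "B \<union> B'"] conjI fd_Un) linarith+
qed

lemma approximable_UN_finite:
  assumes "fin_additive m" "fin_additive m'" "finite F" "F \<subseteq> Meas"
    "\<And>a. a \<in> F \<Longrightarrow> approximable m m' (El a)"
  shows "approximable m m' (\<Union>a\<in>F. El a)"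
  using assms(3,4,5)
proof (induction F)
  case empty
  then show ?case using approximable_fd[OF assms(1,2) fd_empty] by simp
next
  case (insert a F)
  then have "ms (\<Union>a\<in>F. El a)" by (intro ms_UN_finite ms_El) auto
  then have "approximable m m' (El a \<union> (\<Union>a\<in>F. El a))"
    using insert by (intro approximable_Un assms(1,2) ms_El) auto
  then show ?case by simp
qed

text \<open>Smoothness gives one finite subfamily for \<open>m\<close> and another for
  \<open>m'\<close>; their union is good for both. Passing to the finite union and approximating it
  cost \<open>q / 2\<close> each.\<close>

lemma approximable_UN:
  assumes m: "fin_additive m" "fin_additive m'" and sm: "smooth m" "smooth m'"
    and S: "small S" "S \<subseteq> Meas" "\<And>a. a \<in> S \<Longrightarrow> approximable m m' (El a)"
  shows "approximable m m' (\<Union>a\<in>S. El a)"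
  unfolding approximable_def
proof (intro allI impI)
  fix q :: rat assume q: "0 < q" "q < 1"
  then have q2: "0 < q / 2" "q / 2 < 1" by auto
  have half: "of_rat (q / 2) + of_rat (q / 2) = (of_rat q :: real)" by (simp flip: of_rat_add)
  have pos: "0 < (of_rat (q / 2) :: real)" using q2 by simp
  obtain F where F: "F \<subseteq> S" "finite F" "m (\<Union>a\<in>S. El a) \<le> m (\<Union>a\<in>F. El a) + of_rat (q / 2)"
    using sm(1) S(1,2) pos unfolding smooth_def by blast
  obtain F' where F': "F' \<subseteq> S" "finite F'" "m' (\<Union>a\<in>S. El a) \<le> m' (\<Union>a\<in>F'. El a) + of_rat (q / 2)"
    using sm(2) S(1,2) pos unfolding smooth_def by blast
  let ?S = "\<Union>a\<in>S. El a" and ?G = "\<Union>a\<in>F \<union> F'. El a"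
  have msS: "ms ?S" using S by (intro ms_UN)
  have msG: "ms (\<Union>a\<in>G. El a)" if "G \<subseteq> S" "finite G" for G
    using that S(2) by (intro ms_UN_finite ms_El) auto
  have ms_FF: "ms ?G" using F(1,2) F'(1,2) by (intro msG) auto
  have "approximable m m' ?G"
    using F F' S by (intro approximable_UN_finite m) auto
  then obtain B where B: "fd B" "m (sdiff ?G B) \<le> of_rat (q / 2)" "m' (sdiff ?G B) \<le> of_rat (q / 2)"
    using q2 unfolding approximable_def by blast
  have *: "n (sdiff ?S B) \<le> of_rat (q / 2) + n (sdiff ?G B)"
    if n: "fin_additive n" "n ?S \<le> n (\<Union>a\<in>H. El a) + of_rat (q / 2)" and H: "H = F \<or> H = F'" for n H
  proof -
    have "n (\<Union>a\<in>H. El a) \<le> n ?G"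
      using H F F' by (intro fin_additive_mono n(1) ms_FF msG) auto
    moreover have "n (?S - ?G) = n ?S - n ?G"
      using F(1) F'(1) by (intro fin_additive_Diff n(1) msS ms_FF) blast
    moreover have "n (sdiff ?S B) \<le> n (?S - ?G) + n (sdiff ?G B)"
      using F(1) F'(1) fd_ms[OF B(1)]
      by (intro fin_additive_le_Un n(1) ms_sdiff ms_Diff msS ms_FF) (auto simp: sdiff_def)
    ultimately show ?thesis using n(2) by linarith
  qed
  have "m (sdiff ?S B) \<le> of_rat q" using *[OF m(1) F(3) disjI1[OF refl]] B(2) half by linarith
  moreover have "m' (sdiff ?S B) \<le> of_rat q" using *[OF m(2) F'(3) disjI2[OF refl]] B(3) half by linarith
  ultimately show "\<exists>B. fd B \<and> m (sdiff ?S B) \<le> of_rat q \<and> m' (sdiff ?S B) \<le> of_rat q"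
    using B(1) by blast
qed

end

text \<open>The fixed \<mu> witnesses that \<open>Meas\<close> and the rational codes are sets of
  the model; the results are then proved for arbitrary measures of that model.\<close>

locale meas_model = str_model mem V \<kappa> L X
  for mem :: "'v \<Rightarrow> 'v \<Rightarrow> bool" and V :: "'v set" and \<kappa> L X :: 'v +
  fixes \<mu> :: 'v
  assumes prob: "probability_kappa_measure mem V \<kappa> L X \<mu>"
begin

abbreviation meas :: "'v \<Rightarrow> 'v set \<Rightarrow> real" where
  "meas \<nu> A \<equiv> val mem \<nu> (SET A)"

abbreviation "pkm \<equiv> probability_kappa_measure mem V \<kappa> L X"

lemma pkm_fun: "pkm \<nu> \<Longrightarrow> \<nu> \<in> V \<and> is_fun mem \<nu> Meas"
  by (simp add: probability_kappa_measure_def probability_measure_def)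

lemma val_eqI: "codes_real mem (app mem \<nu> a) r \<Longrightarrow> val mem \<nu> a = r"
  unfolding val_def using codes_real_unique by (intro the_equality)

lemma pkm_codes:
  assumes "pkm \<nu>" "a \<in> Meas" shows "codes_real mem (app mem \<nu> a) (val mem \<nu> a)"
proof -
  obtain r where r: "codes_real mem (app mem \<nu> a) r"
    using assms unfolding probability_kappa_measure_def probability_measure_def by blast
  then show ?thesis using val_eqI[OF r] by simp
qed

lemma pkm_nonneg: "pkm \<nu> \<Longrightarrow> a \<in> Meas \<Longrightarrow> 0 \<le> val mem \<nu> a"
  by (simp add: probability_kappa_measure_def probability_measure_def)

lemma pkm_empty: "pkm \<nu> \<Longrightarrow> meas \<nu> {} = 0"
  by (simp add: probability_kappa_measure_def probability_measure_def)

lemma pkm_Structs: "pkm \<nu> \<Longrightarrow> meas \<nu> Structs = 1"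
  by (simp add: probability_kappa_measure_def probability_measure_def)

text \<open>Read off as the domain of the function \<mu>, in place of a transfinite generation of
  the family inside the model.\<close>

lemma vset_Meas: "vset Meas"
proof -
  have \<mu>: "\<mu> \<in> V" "is_fun mem \<mu> Meas" using pkm_fun[OF prob] by simp_all
  have "vset (pfst ` El \<mu>)" using \<mu>(1) by (intro vset_image_dfun vset_El dfn)
  also have "pfst ` El \<mu> = Meas"
  proof (intro equalityI subsetI)
    fix a assume "a \<in> pfst ` El \<mu>"
    then obtain p where p: "p \<in> El \<mu>" "a = pfst p" by blast
    then obtain b where "b \<in> Meas" "p = PR b (app mem \<mu> b)" using is_fun_mem[OF \<mu>(2)] by blast
    then show "a \<in> Meas" using p(2) app_in[OF \<mu>] Meas_in by simp
  next
    fix a assume a: "a \<in> Meas"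
    then have "PR a (app mem \<mu> a) \<in> El \<mu>" using is_fun_app_iff[OF \<mu>(2)] by blast
    moreover have "pfst (PR a (app mem \<mu> a)) = a" using a app_in[OF \<mu>] by simp
    ultimately show "a \<in> pfst ` El \<mu>" by force
  qed
  finally show ?thesis .
qed

definition rats :: "'v set" where
  "rats = {RC q | q. q < 1}"

definition pos_rats :: "'v set" where
  "pos_rats = {RC q | q. 0 < q \<and> q < 1}"

text \<open>The code of the total mass 1 is the cut of all rationals below 1.\<close>

lemma vset_rats: "vset rats"
proof -
  have \<mu>: "\<mu> \<in> V" "is_fun mem \<mu> Meas" using pkm_fun[OF prob] by simp_all
  have "El (app mem \<mu> (SET Structs)) = rats"
    using pkm_codes[OF prob ms_SET[OF ms_Structs]] pkm_Structs[OF prob]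
    by (auto simp: codes_real_def rats_def)
  then show ?thesis using vset_El[OF app_in(1)[OF \<mu> ms_SET[OF ms_Structs]]] by simp
qed

lemma vset_pos_rats: "vset pos_rats"
proof -
  have "vset {x \<in> rats. pfst (pfst x) \<noteq> SET {}}" by (intro vset_sep vset_rats dfn empty_in)
  also have "{x \<in> rats. pfst (pfst x) \<noteq> SET {}} = pos_rats"
    unfolding rats_def pos_rats_def using RC_pos_iff by auto
  finally show ?thesis .
qed

lemma approximable_ms:
  assumes m: "kmeas m" "kmeas m'" and "ms A" shows "approximable m m' A"
proof -
  note fa = m[unfolded kmeas_def]
  obtain T where T: "vset T"
    "\<And>A q. ms A \<Longrightarrow> 0 < q \<Longrightarrow> q < 1 \<Longrightarrow> PR (SET A) (RC q) \<in> T \<longleftrightarrow> of_rat q < m A"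
    using fa(1) unfolding comparable_def by blast
  obtain T' where T': "vset T'"
    "\<And>A q. ms A \<Longrightarrow> 0 < q \<Longrightarrow> q < 1 \<Longrightarrow> PR (SET A) (RC q) \<in> T' \<longleftrightarrow> of_rat q < m' A"
    using fa(2) unfolding comparable_def by blast
  let ?sd = "\<lambda>a b. SET (El (SET (El a - El b)) \<union> El (SET (El b - El a)))"
  \<comment> \<open>First-order form of approximability. The tables record \<open>q < m A\<close>,
    so an upper bound by \<open>q\<close> is non-membership.\<close>
  let ?P = "\<lambda>a. \<forall>q\<in>pos_rats. \<exists>b\<in>{a \<in> Meas. fd (El a)}. PR (?sd a b) q \<notin> T \<and> PR (?sd a b) q \<notin> T'"
  have P: "?P a \<longleftrightarrow> approximable m m' (El a)" if a: "a \<in> Meas" for a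
  proof -
    have sd: "?sd a b = SET (sdiff (El a) (El b))" if "b \<in> Meas" for b
      using ms_vset[OF ms_Diff[OF ms_El[OF a] ms_El[OF that]]]
        ms_vset[OF ms_Diff[OF ms_El[OF that] ms_El[OF a]]] by (simp add: El_SET sdiff_def)
    have ms: "ms (sdiff (El a) (El b))" if "b \<in> Meas" for b
      using ms_sdiff[OF ms_El[OF a] ms_El[OF that]] .
    have "(\<exists>b\<in>{a \<in> Meas. fd (El a)}. PR (?sd a b) (RC q) \<notin> T \<and> PR (?sd a b) (RC q) \<notin> T') \<longleftrightarrow>
        (\<exists>B. fd B \<and> m (sdiff (El a) B) \<le> of_rat q \<and> m' (sdiff (El a) B) \<le> of_rat q)" (is "?l \<longleftrightarrow> ?r")
      if q: "0 < q" "q < 1" for q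
    proof
      assume ?l
      then obtain b where b: "b \<in> Meas" "fd (El b)" "PR (?sd a b) (RC q) \<notin> T" "PR (?sd a b) (RC q) \<notin> T'"
        by blast
      then show ?r
        using T(2)[OF ms[OF b(1)] q] T'(2)[OF ms[OF b(1)] q] sd[OF b(1)]
        by (intro exI[of _ "El b"]) (simp add: not_less)
    next
      assume ?r
      then obtain B where B: "fd B" "m (sdiff (El a) B) \<le> of_rat q" "m' (sdiff (El a) B) \<le> of_rat q" by blast
      have b: "SET B \<in> Meas" "El (SET B) = B"
        using fd_ms[OF B(1)] by (simp_all add: ms_SET ms_El_SET)
      then show ?l
        using T(2)[OF ms[OF b(1)] q] T'(2)[OF ms[OF b(1)] q] sd[OF b(1)] B
        by (intro bexI[of _ "SET B"]) simp_all
    qed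
    then show ?thesis unfolding approximable_def pos_rats_def by blast
  qed
  have "vset {a \<in> Meas. ?P a}"
    by (intro vset_sep vset_Meas dfn vset_pos_rats vset_fd T(1) T'(1))
  also have "{a \<in> Meas. ?P a} = {a \<in> Meas. approximable m m' (El a)}" using P by blast
  finally have F: "vset {a \<in> Meas. approximable m m' (El a)}" .
  have "approximable m m' (El (SET A))"
  proof (rule Meas_induct[OF ms_SET[OF assms(3)], of "approximable m m'", OF F])
    show "approximable m m' (Structs - A)" if "ms A" "approximable m m' A" for A
      using that by (intro approximable_Compl)
    show "approximable m m' (\<Union>a\<in>S. El a)"
      if "small S" "S \<subseteq> Meas" "\<And>a. a \<in> S \<Longrightarrow> approximable m m' (El a)" for S
      using fa that by (intro approximable_UN) simp_all
    show "approximable m m' {M \<in> Structs. holds mem M \<phi> as}"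
      if "is_literal mem L (length as) \<phi>" "set as \<subseteq> El X" for \<phi> as
      using fa fd_literal[OF that] by (intro approximable_fd) simp_all
  qed
  then show ?thesis using assms(3) by (simp add: ms_El_SET)
qed

lemma kmeas_unique:
  assumes m: "kmeas m" "kmeas m'"
    and con: "\<And>P N. finite P \<Longrightarrow> finite N \<Longrightarrow> P \<subseteq> atoms \<Longrightarrow> N \<subseteq> atoms \<Longrightarrow> m (con P N) = m' (con P N)"
    and A: "ms A"
  shows "m A = m' A"
proof (rule ccontr)
  have fa: "fin_additive m" "fin_additive m'" using m by (simp_all add: kmeas_def)
  assume "m A \<noteq> m' A"
  then have pos: "0 < min (\<bar>m A - m' A\<bar> / 2) 1" by simp
  \<comment> \<open>Half of the gap, because the error is incurred once for \<open>m\<close> and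
    once for \<open>m'\<close>; below 1 to be admissible in \<open>approximable\<close>.\<close>
  obtain q where q: "0 < real_of_rat q" "real_of_rat q < min (\<bar>m A - m' A\<bar> / 2) 1"
    using of_rat_dense[OF pos] by auto
  then have "0 < q" "q < 1" by simp_all
  then obtain B where B: "fd B" "m (sdiff A B) \<le> of_rat q" "m' (sdiff A B) \<le> of_rat q"
    using approximable_ms[OF m A] unfolding approximable_def by blast
  obtain u where u: "finite u" "u \<subseteq> atoms" "determined u B" using B(1) by (auto simp: fd_def)
  have "m B = m' B"
    unfolding fin_additive_determined[OF fa(1) u] fin_additive_determined[OF fa(2) u]
    using u by (intro sum.cong refl if_cong con) (auto intro: finite_subset)
  then have le: "\<bar>m A - m' A\<bar> \<le> m (sdiff A B) + m' (sdiff A B)"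
    using fin_additive_sdiff[OF fa(1) A fd_ms[OF B(1)]] fin_additive_sdiff[OF fa(2) A fd_ms[OF B(1)]]
    by linarith
  have "m (sdiff A B) + m' (sdiff A B) \<le> of_rat q + of_rat q"
    using B(2,3) by (rule add_mono)
  also have "\<dots> < \<bar>m A - m' A\<bar>" using q(2) by simp
  finally show False using le by simp
qed

end

section \<open>Probability measures of a model\<close>

context meas_model
begin

lemma kappa_mem_trans: "\<alpha> \<in> El \<kappa> \<Longrightarrow> \<beta> \<in> El \<alpha> \<Longrightarrow> \<gamma> \<in> El \<beta> \<Longrightarrow> \<gamma> \<in> El \<alpha>"
  using kappa_ordinal unfolding is_ordinal_def by blast

lemma kappa_trans: "\<alpha> \<in> El \<kappa> \<Longrightarrow> \<beta> \<in> El \<alpha> \<Longrightarrow> \<beta> \<in> El \<kappa>"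
  using kappa_ordinal unfolding is_ordinal_def by blast

text \<open>Nested membership inductions: if two ordinals are incomparable while all smaller pairs
  are comparable, each is included in the other.\<close>

lemma kappa_trichotomy:
  "\<alpha> \<in> El \<kappa> \<Longrightarrow> \<beta> \<in> El \<kappa> \<Longrightarrow> \<alpha> \<in> El \<beta> \<or> \<alpha> = \<beta> \<or> \<beta> \<in> El \<alpha>"
proof (induction \<alpha> arbitrary: \<beta> rule: El_induct)
  case (1 \<alpha>)
  note IH_\<alpha> = 1(1) and \<alpha> = 1(2)
  from 1(3) show ?case
  proof (induction \<beta> rule: El_induct)
    case (1 \<beta>)
    show ?case
    proof (rule ccontr)
      assume neg: "\<not> (\<alpha> \<in> El \<beta> \<or> \<alpha> = \<beta> \<or> \<beta> \<in> El \<alpha>)"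
      have "x \<in> El \<beta>" if x: "x \<in> El \<alpha>" for x
        using IH_\<alpha>[OF x kappa_trans[OF \<alpha> x] 1(2)] neg x kappa_mem_trans[OF \<alpha> x] by blast
      moreover have "x \<in> El \<alpha>" if x: "x \<in> El \<beta>" for x
        using 1(1)[OF x kappa_trans[OF 1(2) x]] neg x kappa_mem_trans[OF 1(2) x] by blast
      ultimately have "El \<alpha> = El \<beta>" by blast
      then show False using neg elts_inject by blast
    qed
  qed
qed

text \<open>Countable additivity for the sequence \<open>A\<close>, \<open>B\<close>, followed by
  empty sets. It differs from a constant sequence at two indices only, so its code is in the
  model.\<close>

lemma pkm_fin_additive:
  assumes "pkm \<nu>" shows "fin_additive (meas \<nu>)"
  unfolding fin_additive_def
proof (intro conjI allI impI)
  show "0 \<le> meas \<nu> A" if "ms A" for A using pkm_nonneg[OF assms ms_SET[OF that]] .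
  fix A B assume AB: "ms A" "ms B" "A \<inter> B = {}"
  define f where "f i = (if i = NC 0 then SET A else if i = NC 1 then SET B else SET {})" for i
  have in_Meas: "f i \<in> Meas" for i
    using ms_SET AB ms_empty by (simp add: f_def)
  let ?I = "{NC 0, NC 1}"
  have "(range NC - ?I) \<union> ?I = range NC" by blast
  then have "(\<lambda>x. PR x (f x)) ` range NC = (\<lambda>x. PR x (f x)) ` (range NC - ?I) \<union> (\<lambda>x. PR x (f x)) ` ?I"
    by (metis image_Un)
  also have "(\<lambda>x. PR x (f x)) ` (range NC - ?I) = (\<lambda>x. PR x (SET {})) ` (range NC - ?I)"
    by (rule image_cong) (simp_all add: f_def)
  finally have "(\<lambda>x. PR x (f x)) ` range NC =
      (\<lambda>x. PR x (SET {})) ` (range NC - ?I) \<union> (\<lambda>x. PR x (f x)) ` ?I" .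
  moreover have "vset ((\<lambda>x. PR x (SET {})) ` (range NC - ?I))"
    by (intro vset_graph vset_Diff vset_omega vset_pair NC_in dfn empty_in)
  moreover have "vset ((\<lambda>x. PR x (f x)) ` ?I)"
    using in_Meas Meas_in NC_in by (intro vset_finite) auto
  ultimately have g: "vset ((\<lambda>x. PR x (f x)) ` range NC)" by (simp only: vset_Un)
  note app = app_fn[OF g]
  have El_f: "El (f (NC n)) = (if n = 0 then A else if n = 1 then B else {})" for n
    using AB by (simp add: f_def ms_El_SET El_empty)
  have UN: "(\<Union>i\<in>range NC. El (app mem (fn (range NC) f) i)) = A \<union> B"
  proof -
    have "(\<Union>i\<in>range NC. El (app mem (fn (range NC) f) i)) = (\<Union>n. El (f (NC n)))" by (simp add: app)
    also have "\<dots> = El (f (NC 0)) \<union> El (f (NC 1))"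
      unfolding El_f by (auto split: if_splits)
    finally show ?thesis by (simp add: El_f)
  qed
  have "((\<lambda>i. val mem \<nu> (app mem (fn (range NC) f) i)) has_sum
      meas \<nu> (\<Union>i\<in>range NC. El (app mem (fn (range NC) f) i))) (range NC)"
  proof -
    have "additive mem V \<kappa> L X \<nu> (range NC)"
      using assms by (simp add: probability_kappa_measure_def probability_measure_def)
    moreover have "app mem (fn (range NC) f) ` range NC \<subseteq> Meas" using app in_Meas by auto
    moreover have "\<forall>i\<in>range NC. \<forall>j\<in>range NC. i \<noteq> j \<longrightarrow>
        El (app mem (fn (range NC) f) i) \<inter> El (app mem (fn (range NC) f) j) = {}"
      using AB(3) by (auto simp: app El_f split: if_splits)
    ultimately show ?thesis
      unfolding additive_def using fn_in[OF g] is_fun_fn[OF g] by blast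
  qed
  then have sum_AB: "((\<lambda>i. val mem \<nu> (f i)) has_sum meas \<nu> (A \<union> B)) (range NC)"
    unfolding UN by (rule has_sum_cong[THEN iffD1, rotated]) (simp add: app)
  have "((\<lambda>i. val mem \<nu> (f i)) has_sum (\<Sum>i\<in>?I. val mem \<nu> (f i))) ?I"
    by (intro has_sum_finite) simp
  moreover have "((\<lambda>i. val mem \<nu> (f i)) has_sum s) ?I \<longleftrightarrow> ((\<lambda>i. val mem \<nu> (f i)) has_sum s) (range NC)" for s
  proof (rule has_sum_cong_neutral)
    show "val mem \<nu> (f i) = 0" if "i \<in> range NC - ?I" for i
      using that by (simp add: f_def pkm_empty[OF assms])
  qed auto
  ultimately have "((\<lambda>i. val mem \<nu> (f i)) has_sum (\<Sum>i\<in>?I. val mem \<nu> (f i))) (range NC)" by blast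
  with sum_AB have "meas \<nu> (A \<union> B) = (\<Sum>i\<in>?I. val mem \<nu> (f i))" by (rule has_sum_unique)
  then show "meas \<nu> (A \<union> B) = meas \<nu> A + meas \<nu> B" by (simp add: f_def)
qed

text \<open>
  A small family is made disjoint by keeping in its \<open>i\<close>-th member only what does not belong
  to members with a smaller index; \<open>\<kappa>\<close>-additivity then gives a finite subfamily of almost
  full measure.
\<close>

lemma pkm_smooth:
  assumes "pkm \<nu>" shows "smooth (meas \<nu>)"
  unfolding smooth_def
proof (intro allI impI)
  fix S and \<epsilon> :: real
  assume S: "small S" "S \<subseteq> Meas" and \<epsilon>: "0 < \<epsilon>"
  note fa = pkm_fin_additive[OF assms]
  have S_vset: "vset S" using S(1) by (simp add: small_def)
  obtain f where f: "f \<in> V" "is_fun mem f S" "inj_on (app mem f) S" "app mem f ` S \<subseteq> El \<kappa>"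
    using S(1) unfolding small_def size_le_def by (auto simp: El_SET)
  \<comment> \<open>Indices outside the range of \<open>f\<close> get the empty set, so the family
    is total on \<kappa>; writing it with the pairs in \<open>f\<close> keeps it definable.\<close>
  define B where "B i = {M \<in> Structs. \<exists>a\<in>S. PR a i \<in> El f \<and> M \<in> El a \<and>
      (\<forall>b\<in>S. \<forall>j\<in>El i. PR b j \<in> El f \<longrightarrow> M \<notin> El b)}" for i
  have f_iff: "PR a i \<in> El f \<longleftrightarrow> i = app mem f a" if "a \<in> S" for a i
    using is_fun_app_iff[OF f(2) that] .
  have B_iff: "M \<in> B i \<longleftrightarrow> M \<in> Structs \<and> (\<exists>a\<in>S. i = app mem f a \<and> M \<in> El a \<and>
      (\<forall>b\<in>S. app mem f b \<in> El i \<longrightarrow> M \<notin> El b))" for M i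
    unfolding B_def by (simp add: f_iff cong: bex_cong ball_cong)
  have B_app: "B (app mem f a) = El a - (\<Union>b\<in>{b \<in> S. app mem f b \<in> El (app mem f a)}. El b)"
    if a: "a \<in> S" for a
  proof -
    have "a' = a" if "a' \<in> S" "app mem f a = app mem f a'" for a'
      using inj_onD[OF f(3) that(2)] a that(1) by simp
    moreover have "El a \<subseteq> Structs" using a S(2) Meas_subset by blast
    ultimately have "M \<in> B (app mem f a) \<longleftrightarrow>
        M \<in> El a \<and> (\<forall>b\<in>S. app mem f b \<in> El (app mem f a) \<longrightarrow> M \<notin> El b)" for M
      using a unfolding B_iff by blast
    then show ?thesis by blast
  qed
  have B_other: "B i = {}" if "i \<notin> app mem f ` S" for i
    using that B_iff by blast
  have ms_B: "ms (B i)" for i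
  proof (cases "i \<in> app mem f ` S")
    case True
    then obtain a where a: "a \<in> S" "i = app mem f a" by blast
    have "vset {b \<in> S. \<exists>j\<in>El i. PR b j \<in> El f}"
      using a app_in(1)[OF f(1,2)] by (intro vset_sep S_vset dfn f(1)) simp
    also have "{b \<in> S. \<exists>j\<in>El i. PR b j \<in> El f} = {b \<in> S. app mem f b \<in> El (app mem f a)}"
      unfolding a(2) by (simp add: f_iff cong: conj_cong)
    finally have "small {b \<in> S. app mem f b \<in> El (app mem f a)}"
      using S(1) by (intro small_subset[OF S(1)]) auto
    then show ?thesis
      unfolding a(2) B_app[OF a(1)] using S(2) a(1) by (intro ms_Diff ms_UN ms_El) auto
  qed (simp add: B_other ms_empty)
  have dfun_B: "dfun (\<lambda>e. SET (B (e 0)))"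
  proof (rule dfun_SET)
    show "vset (B (e 0))" for e :: "nat \<Rightarrow> 'v" using ms_vset[OF ms_B] .
    show "D (\<lambda>e. e 0 \<in> B (e (Suc 0)))"
      unfolding B_def mem_Collect_eq by (intro dfn vset_Structs S_vset f(1))
  qed
  have \<kappa>_vset: "vset (El \<kappa>)" using kappa_in by (rule vset_El)
  have g: "vset ((\<lambda>i. PR i (SET (B i))) ` El \<kappa>)" by (rule vset_graph[OF \<kappa>_vset dfun_B])
  note app = app_fn[OF g]
  let ?F = "fn (El \<kappa>) (\<lambda>i. SET (B i))"
  have disj: "B i \<inter> B j = {}" if ij: "i \<in> El \<kappa>" "j \<in> El \<kappa>" "i \<noteq> j" for i j
  proof -
    have *: "B i \<inter> B j = {}" if "i \<in> El j" for i j
    proof -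
      have False if M: "M \<in> B i" "M \<in> B j" for M
      proof -
        obtain a where a: "a \<in> S" "i = app mem f a" "M \<in> El a" using M(1) unfolding B_iff by blast
        have "\<forall>b\<in>S. app mem f b \<in> El j \<longrightarrow> M \<notin> El b" using M(2) unfolding B_iff by blast
        then show False using a \<open>i \<in> El j\<close> by blast
      qed
      then show ?thesis by blast
    qed
    show ?thesis using kappa_trichotomy[OF ij(1,2)] ij(3) *[of i j] *[of j i] by blast
  qed
  have UN_B: "(\<Union>i\<in>El \<kappa>. B i) = (\<Union>a\<in>S. El a)"
  proof (intro equalityI subsetI)
    fix M assume "M \<in> (\<Union>i\<in>El \<kappa>. B i)"
    then obtain i where "M \<in> B i" by blast
    then show "M \<in> (\<Union>a\<in>S. El a)" unfolding B_iff by blast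
  next
    fix M assume "M \<in> (\<Union>a\<in>S. El a)"
    then obtain a where "a \<in> S" "M \<in> El a" by blast
    \<comment> \<open>Descent to the least index whose member contains \<open>M\<close>.\<close>
    then have "\<exists>b\<in>S. M \<in> B (app mem f b)"
    proof (induction "app mem f a" arbitrary: a rule: El_induct)
      case (1 a)
      show ?case
      proof (cases "\<exists>b\<in>S. app mem f b \<in> El (app mem f a) \<and> M \<in> El b")
        case True
        then show ?thesis using 1(1) by blast
      next
        case False
        then have "M \<in> B (app mem f a)" unfolding B_app[OF 1(2)] using 1(3) by blast
        then show ?thesis using 1(2) by blast
      qed
    qed
    then show "M \<in> (\<Union>i\<in>El \<kappa>. B i)" using f(4) by blast
  qed
  have sum: "((\<lambda>i. val mem \<nu> (app mem ?F i)) has_sum meas \<nu> (\<Union>i\<in>El \<kappa>. El (app mem ?F i))) (El \<kappa>)"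
  proof -
    have "additive mem V \<kappa> L X \<nu> (El \<kappa>)"
      using assms by (simp add: probability_kappa_measure_def)
    moreover have "app mem ?F ` El \<kappa> \<subseteq> Meas" using app ms_SET[OF ms_B] by auto
    moreover have "\<forall>i\<in>El \<kappa>. \<forall>j\<in>El \<kappa>. i \<noteq> j \<longrightarrow> El (app mem ?F i) \<inter> El (app mem ?F j) = {}"
      using disj by (simp add: app ms_El_SET[OF ms_B])
    ultimately show ?thesis
      unfolding additive_def using fn_in[OF g] is_fun_fn[OF g] by blast
  qed
  have UN_F: "(\<Union>i\<in>El \<kappa>. El (app mem ?F i)) = (\<Union>a\<in>S. El a)"
    unfolding UN_B[symmetric] by (simp add: app ms_El_SET[OF ms_B])
  have "((\<lambda>i. meas \<nu> (B i)) has_sum meas \<nu> (\<Union>a\<in>S. El a)) (El \<kappa>)"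
    using sum unfolding UN_F by (rule has_sum_cong[THEN iffD1, rotated]) (simp add: app)
  from has_sum_finite_approximation[OF this \<epsilon>]
  obtain I where I: "finite I" "I \<subseteq> El \<kappa>"
    "dist (\<Sum>i\<in>I. meas \<nu> (B i)) (meas \<nu> (\<Union>a\<in>S. El a)) \<le> \<epsilon>"
    by auto
  \<comment> \<open>Injectivity of \<open>f\<close> turns the finite set of indices into a finite
    subfamily of \<open>S\<close>.\<close>
  let ?A = "{a \<in> S. app mem f a \<in> I}"
  have fin: "finite ?A"
    using inj_on_subset[OF f(3), of ?A] I(1) by (intro inj_on_finite[of "app mem f" ?A I]) auto
  have "(\<Sum>i\<in>I. meas \<nu> (B i)) = meas \<nu> (\<Union>i\<in>I. B i)"
    using I(2) disj by (intro fin_additive_UN[OF fa I(1) ms_B, symmetric])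
      (auto simp: disjoint_family_on_def)
  also have "\<dots> \<le> meas \<nu> (\<Union>a\<in>?A. El a)"
  proof (rule fin_additive_mono[OF fa])
    show "ms (\<Union>a\<in>?A. El a)" using S(2) by (intro ms_UN_finite fin ms_El) auto
    show "ms (\<Union>i\<in>I. B i)" by (intro ms_UN_finite I(1) ms_B)
    show "(\<Union>i\<in>I. B i) \<subseteq> (\<Union>a\<in>?A. El a)"
    proof
      fix M assume "M \<in> (\<Union>i\<in>I. B i)"
      then obtain i where i: "i \<in> I" "M \<in> B i" by blast
      then obtain a where "a \<in> S" "i = app mem f a" "M \<in> El a" unfolding B_iff by blast
      then show "M \<in> (\<Union>a\<in>?A. El a)" using i(1) by blast
    qed
  qed
  finally show "\<exists>F\<subseteq>S. finite F \<and> meas \<nu> (\<Union>a\<in>S. El a) \<le> meas \<nu> (\<Union>a\<in>F. El a) + \<epsilon>"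
    using I(3) fin by (intro exI[of _ ?A]) (auto simp: dist_real_def abs_le_iff)
qed

lemma pkm_less_iff:
  assumes "pkm \<nu>" "a \<in> Meas"
  shows "(\<exists>y\<in>V. PR a y \<in> El \<nu> \<and> RC q \<in> El y) \<longleftrightarrow> of_rat q < val mem \<nu> a"
proof -
  have \<nu>: "\<nu> \<in> V" "is_fun mem \<nu> Meas" using pkm_fun[OF assms(1)] by simp_all
  have "(\<exists>y\<in>V. PR a y \<in> El \<nu> \<and> RC q \<in> El y) \<longleftrightarrow> RC q \<in> El (app mem \<nu> a)"
    using is_fun_app_iff[OF \<nu>(2) assms(2)] app_in(1)[OF \<nu> assms(2)] by simp
  also have "\<dots> \<longleftrightarrow> of_rat q < val mem \<nu> a"
    using codes_real_mem[OF pkm_codes[OF assms]] .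
  finally show ?thesis .
qed

lemma pkm_comparable:
  assumes "pkm \<nu>" shows "comparable (meas \<nu>)"
  unfolding comparable_def
proof (intro exI conjI allI impI)
  let ?T = "{PR a q | a q. a \<in> Meas \<and> q \<in> pos_rats \<and> (\<exists>y\<in>V. PR a y \<in> El \<nu> \<and> q \<in> El y)}"
  have \<nu>: "\<nu> \<in> V" using pkm_fun[OF assms] by simp
  show "vset ?T"
    by (intro vset_image2_if dfn vset_Meas vset_pos_rats \<nu>)
  show "PR (SET A) (RC q) \<in> ?T \<longleftrightarrow> of_rat q < meas \<nu> A" if "ms A" "0 < q" "q < 1" for A q
  proof -
    have "PR (SET A) (RC q) \<in> ?T \<longleftrightarrow> (\<exists>y\<in>V. PR (SET A) y \<in> El \<nu> \<and> RC q \<in> El y)"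
      using that by (simp add: pos_rats_def ms_SET)
    then show ?thesis
      unfolding pkm_less_iff[OF assms ms_SET[OF that(1)]] .
  qed
qed

lemma pkm_kmeas: "pkm \<nu> \<Longrightarrow> kmeas (meas \<nu>)"
  by (simp add: kmeas_def pkm_fin_additive pkm_smooth pkm_comparable)

end

section \<open>Invariance\<close>

context meas_model
begin

lemma fd_move:
  assumes "perm \<pi>" "fd A" shows "ms (move \<pi> ` A)"
proof -
  obtain u where u: "finite u" "u \<subseteq> atoms" "determined u A" using assms(2) by (auto simp: fd_def)
  have "move \<pi> ` A = (\<Union>W\<in>{W \<in> Pow u. SET W \<in> A}. move \<pi> ` con W (u - W))"
    unfolding image_UN[symmetric] by (rule arg_cong[OF determined_eq_UN[OF u]])
  also have "\<dots> = (\<Union>W\<in>{W \<in> Pow u. SET W \<in> A}. con (amap \<pi> ` W) (amap \<pi> ` (u - W)))"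
    using u(2) by (intro SUP_cong refl move_image_con[OF assms(1)]) auto
  also have "ms \<dots>"
    using u amap_in[OF assms(1)]
    by (intro ms_UN_finite ms_con) (auto intro: finite_subset)
  finally show ?thesis .
qed

lemma vimg_Meas:
  assumes "perm \<pi>" "a \<in> Meas" shows "El (vimg (code \<pi>) a) = move \<pi> ` El a"
  using vimg_move[OF assms(1), of "El a"] Meas_subset[OF assms(2)] vset_El[OF Meas_in[OF assms(2)]]
  by (simp add: El_SET)

lemma vimg_inv:
  assumes "perm \<pi>" "a \<in> Meas"
  shows "vimg (code (inv_into (El X) \<pi>)) (vimg (code \<pi>) a) = a"
proof -
  have "vimg (code \<pi>) a = SET (move \<pi> ` El a)"
    using vimg_move(1)[OF assms(1) vset_El[OF Meas_in[OF assms(2)]] Meas_subset[OF assms(2)]] by simp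
  moreover have "vset (move \<pi> ` El a)" "move \<pi> ` El a \<subseteq> Structs"
    using vimg_move(2)[OF assms(1) vset_El[OF Meas_in[OF assms(2)]] Meas_subset[OF assms(2)]]
      Meas_subset[OF assms(2)] move_image_Structs[OF assms(1)] by blast+
  ultimately have "vimg (code (inv_into (El X) \<pi>)) (vimg (code \<pi>) a)
      = SET (move (inv_into (El X) \<pi>) ` move \<pi> ` El a)"
    using vimg_move(1)[OF perm_inv[OF assms(1)]] by simp
  then show ?thesis using move_image_inv(1)[OF assms(1) Meas_subset[OF assms(2)]] by simp
qed

text \<open>The inverse permutation is a definable injection of the translated family back into
  \<open>S\<close>.\<close>

lemma small_vimg:
  assumes "perm \<pi>" "small S" "S \<subseteq> Meas" shows "small (vimg (code \<pi>) ` S)"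
proof (rule small_inj[OF assms(2)])
  let ?h = "vimg (code (inv_into (El X) \<pi>))"
  have h: "?h (vimg (code \<pi>) a) = a" if "a \<in> S" for a
    using vimg_inv[OF assms(1)] assms(3) that by blast
  show "vset (vimg (code \<pi>) ` S)"
    using SYM_in[OF code_SYM[OF assms(1)]] by (intro vset_image_dfun small_vset[OF assms(2)] dfn)
  show "dfun (\<lambda>e. ?h (e 0))"
    using SYM_in[OF code_SYM[OF perm_inv[OF assms(1)]]] by (intro dfn)
  show "inj_on ?h (vimg (code \<pi>) ` S)" using h by (intro inj_onI) auto
  show "?h ` vimg (code \<pi>) ` S \<subseteq> S" using h by auto
qed

lemma move_UN:
  assumes "perm \<pi>" "S \<subseteq> Meas"
  shows "move \<pi> ` (\<Union>a\<in>S. El a) = (\<Union>a\<in>vimg (code \<pi>) ` S. El a)"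
proof -
  have "(\<Union>a\<in>vimg (code \<pi>) ` S. El a) = (\<Union>a\<in>S. move \<pi> ` El a)"
    using assms(2) vimg_Meas[OF assms(1)] by (simp add: subset_iff)
  then show ?thesis by (simp add: image_UN)
qed

text \<open>Measurability of the translate is expressed as membership of \<open>vimg\<close> in
  \<open>Meas\<close>, a definable condition because \<open>Meas\<close> is a set of the model; this
  makes the induction applicable.\<close>

lemma ms_move:
  assumes "perm \<pi>" "ms A" shows "ms (move \<pi> ` A)"
proof -
  have iff: "vimg (code \<pi>) a \<in> Meas \<longleftrightarrow> ms (move \<pi> ` El a)" if a: "a \<in> Meas" for a
    using ms_El[of "vimg (code \<pi>) a"] ms_SET[of "move \<pi> ` El a"] vimg_Meas[OF assms(1) a]
    by (metis SET_El)
  have "vset {a \<in> Meas. vimg (code \<pi>) a \<in> Meas}"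
    using SYM_in[OF code_SYM[OF assms(1)]] by (intro vset_sep vset_Meas dfn)
  also have "{a \<in> Meas. vimg (code \<pi>) a \<in> Meas} = {a \<in> Meas. ms (move \<pi> ` El a)}"
    using iff by blast
  finally have F: "vset {a \<in> Meas. ms (move \<pi> ` El a)}" .
  have "ms (move \<pi> ` El (SET A))"
  proof (rule Meas_induct[OF ms_SET[OF assms(2)], of "\<lambda>A. ms (move \<pi> ` A)", OF F])
    show "ms (move \<pi> ` (Structs - B))" if "ms B" "ms (move \<pi> ` B)" for B
    proof -
      have "move \<pi> ` (Structs - B) = Structs - move \<pi> ` B"
        using inj_on_image_set_diff[OF move_inj[OF assms(1)], of Structs B] ms_subset[OF that(1)]
          move_image_Structs[OF assms(1)] by auto
      then show ?thesis using that(2) by (simp add: ms_Compl)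
    qed
    show "ms (move \<pi> ` (\<Union>a\<in>S. El a))"
      if S: "small S" "S \<subseteq> Meas" "\<And>a. a \<in> S \<Longrightarrow> ms (move \<pi> ` El a)" for S
      unfolding move_UN[OF assms(1) S(2)]
      using S iff by (intro ms_UN small_vimg assms(1)) auto
    show "ms (move \<pi> ` {M \<in> Structs. holds mem M \<phi> as})"
      if "is_literal mem L (length as) \<phi>" "set as \<subseteq> El X" for \<phi> as
      using fd_move[OF assms(1) fd_literal[OF that]] .
  qed
  then show ?thesis using assms(2) by (simp add: ms_El_SET)
qed

text \<open>Allows a measure to be compared with its translates by \<open>kmeas_unique\<close>.
  Small families are carried along by \<open>vimg\<close>, and a finite subfamily of the translated
  family is pulled back.\<close>

lemma kmeas_move:
  assumes "perm \<pi>" "kmeas m" shows "kmeas (\<lambda>A. m (move \<pi> ` A))"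
  unfolding kmeas_def
proof (intro conjI)
  have fa: "fin_additive m" and sm: "smooth m" and co: "comparable m"
    using assms(2) by (simp_all add: kmeas_def)
  have disj: "move \<pi> ` A \<inter> move \<pi> ` B = {}" if "ms A" "ms B" "A \<inter> B = {}" for A B
    using inj_on_image_Int[OF move_inj[OF assms(1)] ms_subset[OF that(1)] ms_subset[OF that(2)]] that(3)
    by simp
  show "fin_additive (\<lambda>A. m (move \<pi> ` A))"
    unfolding fin_additive_def
  proof (intro conjI allI impI)
    show "0 \<le> m (move \<pi> ` A)" if "ms A" for A
      using fin_additive_nonneg[OF fa ms_move[OF assms(1) that]] .
    show "m (move \<pi> ` (A \<union> B)) = m (move \<pi> ` A) + m (move \<pi> ` B)"
      if "ms A" "ms B" "A \<inter> B = {}" for A B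
      unfolding image_Un using that by (intro fin_additive_Un fa ms_move assms(1) disj)
  qed
  show "smooth (\<lambda>A. m (move \<pi> ` A))"
    unfolding smooth_def
  proof (intro allI impI)
    fix S and \<epsilon> :: real assume S: "small S" "S \<subseteq> Meas" and "0 < \<epsilon>"
    let ?v = "vimg (code \<pi>)"
    have "?v a \<in> Meas" if "a \<in> Meas" for a
      using ms_SET[OF ms_move[OF assms(1) ms_El[OF that]]] vimg_Meas[OF assms(1) that] by (metis SET_El)
    then have "?v ` S \<subseteq> Meas" using S(2) by blast
    from sm[unfolded smooth_def, rule_format, OF small_vimg[OF assms(1) S] this \<open>0 < \<epsilon>\<close>]
    obtain G where G: "G \<subseteq> ?v ` S" "finite G"
      "m (\<Union>a\<in>?v ` S. El a) \<le> m (\<Union>a\<in>G. El a) + \<epsilon>" by (elim exE conjE)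
    obtain F where F: "F \<subseteq> S" "finite F" "G = ?v ` F"
      using finite_subset_image[OF G(2,1)] by blast
    have "F \<subseteq> Meas" using F(1) S(2) by blast
    have "m (move \<pi> ` (\<Union>a\<in>S. El a)) \<le> m (move \<pi> ` (\<Union>a\<in>F. El a)) + \<epsilon>"
      unfolding move_UN[OF assms(1) S(2)] move_UN[OF assms(1) \<open>F \<subseteq> Meas\<close>] using G(3) F(3) by simp
    then show "\<exists>F\<subseteq>S. finite F \<and> m (move \<pi> ` (\<Union>a\<in>S. El a)) \<le> m (move \<pi> ` (\<Union>a\<in>F. El a)) + \<epsilon>"
      using F(1,2) by blast
  qed
  obtain T where T: "vset T"
    "\<And>A q. ms A \<Longrightarrow> 0 < q \<Longrightarrow> q < 1 \<Longrightarrow> PR (SET A) (RC q) \<in> T \<longleftrightarrow> of_rat q < m A"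
    using co unfolding comparable_def by blast
  show "comparable (\<lambda>A. m (move \<pi> ` A))"
    unfolding comparable_def
  proof (intro exI conjI allI impI)
    let ?T = "{PR a q | a q. a \<in> Meas \<and> q \<in> pos_rats \<and> PR (vimg (code \<pi>) a) q \<in> T}"
    show "vset ?T"
      using SYM_in[OF code_SYM[OF assms(1)]]
      by (intro vset_image2_if dfn vset_Meas vset_pos_rats T(1))
    show "PR (SET A) (RC q) \<in> ?T \<longleftrightarrow> of_rat q < m (move \<pi> ` A)" if A: "ms A" "0 < q" "q < 1" for A q
    proof -
      have "PR (SET A) (RC q) \<in> ?T \<longleftrightarrow> PR (vimg (code \<pi>) (SET A)) (RC q) \<in> T"
        using A by (simp add: pos_rats_def ms_SET)
      also have "vimg (code \<pi>) (SET A) = SET (move \<pi> ` A)"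
        using vimg_move(1)[OF assms(1) ms_vset[OF A(1)] ms_subset[OF A(1)]] .
      finally show ?thesis using T(2)[OF ms_move[OF assms(1) A(1)] A(2,3)] by simp
    qed
  qed
qed

abbreviation "invariant \<equiv> invariant_measure mem V \<kappa> L X"

lemma invariant_pkm: "invariant \<nu> \<Longrightarrow> pkm \<nu>"
  by (simp add: invariant_measure_def)

lemma act_image:
  assumes "g \<in> SYM" "a \<in> Meas" shows "act mem g ` El a = move (app mem g) ` El a"
  using act_move[OF assms(1)] Meas_subset[OF assms(2)] by (intro image_cong) auto

lemma invariant_iff:
  "invariant \<nu> \<longleftrightarrow> pkm \<nu> \<and> (\<forall>\<pi> A. perm \<pi> \<longrightarrow> ms A \<longrightarrow> meas \<nu> (move \<pi> ` A) = meas \<nu> A)"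
proof (intro iffI conjI allI impI)
  assume "invariant \<nu>"
  then show "pkm \<nu>" by (rule invariant_pkm)
  fix \<pi> A assume \<pi>: "perm \<pi>" and A: "ms A"
  have "val mem \<nu> (SET (act mem (code \<pi>) ` El (SET A))) = val mem \<nu> (SET A)"
    using \<open>invariant \<nu>\<close> code_SYM[OF \<pi>] ms_SET[OF A] unfolding invariant_measure_def by blast
  moreover have "act mem (code \<pi>) ` El (SET A) = move \<pi> ` A"
  proof -
    have "move (app mem (code \<pi>)) M = move \<pi> M" if "M \<in> A" for M
      using move_cong[OF subsetD[OF ms_subset[OF A] that] app_code[OF \<pi>]] .
    then show ?thesis
      using act_image[OF code_SYM[OF \<pi>] ms_SET[OF A]] by (simp add: ms_El_SET[OF A])
  qed
  ultimately show "meas \<nu> (move \<pi> ` A) = meas \<nu> A" by simp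
next
  assume R: "pkm \<nu> \<and> (\<forall>\<pi> A. perm \<pi> \<longrightarrow> ms A \<longrightarrow> meas \<nu> (move \<pi> ` A) = meas \<nu> A)"
  show "invariant \<nu>"
    unfolding invariant_measure_def
  proof (intro conjI ballI)
    show "pkm \<nu>" using R by blast
    show "val mem \<nu> (SET (act mem g ` El a)) = val mem \<nu> a" if "g \<in> SYM" "a \<in> Meas" for g a
    proof -
      have "meas \<nu> (move (app mem g) ` El a) = meas \<nu> (El a)"
        using R perm_app[OF that(1)] ms_El[OF that(2)] by blast
      then show ?thesis unfolding act_image[OF that] by simp
    qed
  qed
qed

lemma invariant_move: "invariant \<nu> \<Longrightarrow> perm \<pi> \<Longrightarrow> ms A \<Longrightarrow> meas \<nu> (move \<pi> ` A) = meas \<nu> A"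
  using invariant_iff by blast

text \<open>A measure and its translate are equal once they agree on cylinders, so invariance is a
  condition on cylinder values alone. This is how the relativization inherits it.\<close>

lemma invariantI_con:
  assumes "pkm \<nu>"
    and con: "\<And>\<pi> P N. perm \<pi> \<Longrightarrow> finite P \<Longrightarrow> finite N \<Longrightarrow> P \<subseteq> atoms \<Longrightarrow> N \<subseteq> atoms \<Longrightarrow>
      meas \<nu> (con (amap \<pi> ` P) (amap \<pi> ` N)) = meas \<nu> (con P N)"
  shows "invariant \<nu>"
  unfolding invariant_iff
proof (intro conjI allI impI assms(1))
  fix \<pi> A assume \<pi>: "perm \<pi>" and A: "ms A"
  show "meas \<nu> (move \<pi> ` A) = meas \<nu> A"
    by (rule kmeas_unique[OF kmeas_move[OF \<pi> pkm_kmeas[OF assms(1)]] pkm_kmeas[OF assms(1)] _ A])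
      (simp add: move_image_con[OF \<pi>] con[OF \<pi>])
qed

lemma pkm_eqI:
  assumes "pkm \<nu>" "pkm \<eta>"
    and "\<And>P N. finite P \<Longrightarrow> finite N \<Longrightarrow> P \<subseteq> atoms \<Longrightarrow> N \<subseteq> atoms \<Longrightarrow>
      meas \<nu> (con P N) = meas \<eta> (con P N)"
  shows "\<nu> = \<eta>"
proof -
  have "app mem \<nu> a = app mem \<eta> a" if a: "a \<in> Meas" for a
  proof -
    have "meas \<nu> (El a) = meas \<eta> (El a)"
      by (rule kmeas_unique[OF pkm_kmeas[OF assms(1)] pkm_kmeas[OF assms(2)] assms(3) ms_El[OF a]])
    then show ?thesis
      using codes_real_inject pkm_codes[OF assms(1) a] pkm_codes[OF assms(2) a] by simp
  qed
  moreover have "El \<rho> = (\<lambda>a. PR a (app mem \<rho> a)) ` Meas" if "pkm \<rho>" for \<rho>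
    using is_fun_app_iff[OF conjunct2[OF pkm_fun[OF that]]] is_fun_mem[OF conjunct2[OF pkm_fun[OF that]]]
    by (intro equalityI subsetI) (blast, auto)
  ultimately have "El \<nu> = El \<eta>" using assms(1,2) by simp
  then show ?thesis by (rule elts_inject)
qed

section \<open>Dissociated measures are extreme\<close>

definition ssupp :: "'v set \<Rightarrow> 'v set" where
  "ssupp Q = (\<Union>u\<in>Q. supp u)"

definition dissociated :: "'v \<Rightarrow> bool" where
  "dissociated \<nu> \<longleftrightarrow> (\<forall>P N P' N'. finite P \<longrightarrow> finite N \<longrightarrow> finite P' \<longrightarrow> finite N' \<longrightarrow>
     P \<subseteq> atoms \<longrightarrow> N \<subseteq> atoms \<longrightarrow> P' \<subseteq> atoms \<longrightarrow> N' \<subseteq> atoms \<longrightarrow>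
     ssupp (P \<union> N) \<inter> ssupp (P' \<union> N') = {} \<longrightarrow>
     meas \<nu> (con (P \<union> P') (N \<union> N')) = meas \<nu> (con P N) * meas \<nu> (con P' N'))"

lemma dissociatedD:
  assumes "dissociated \<nu>" "finite P" "finite N" "finite P'" "finite N'"
    "P \<subseteq> atoms" "N \<subseteq> atoms" "P' \<subseteq> atoms" "N' \<subseteq> atoms"
    "ssupp (P \<union> N) \<inter> ssupp (P' \<union> N') = {}"
  shows "meas \<nu> (con (P \<union> P') (N \<union> N')) = meas \<nu> (con P N) * meas \<nu> (con P' N')"
  using assms unfolding dissociated_def by simp

lemma finite_ssupp: "finite Q \<Longrightarrow> Q \<subseteq> atoms \<Longrightarrow> finite (ssupp Q)"
  unfolding ssupp_def using finite_supp by blast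

lemma ssupp_subset: "Q \<subseteq> atoms \<Longrightarrow> ssupp Q \<subseteq> El X"
  unfolding ssupp_def using supp_subset by blast

lemma ssupp_amap: "Q \<subseteq> atoms \<Longrightarrow> ssupp (amap \<pi> ` Q) = \<pi> ` ssupp Q"
  unfolding ssupp_def using supp_amap[of _ \<pi>] by (simp add: image_UN subset_iff)

lemma con_Int: "con P N \<inter> con P' N' = con (P \<union> P') (N \<union> N')"
  by (auto simp: con_def)

text \<open>The variance of the number of events \<open>A i\<close> that occur is nonnegative. One
  finite set \<open>?u\<close> determines all of them, so the expectation is a finite sum over the
  cells of \<open>?u\<close>.\<close>

lemma sum_le_sum_Int:
  fixes A :: "nat \<Rightarrow> 'v set"
  assumes fa: "fin_additive m" and one: "m Structs = 1" and fd: "\<And>i. i < n \<Longrightarrow> fd (A i)"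
  shows "(\<Sum>i<n. m (A i))\<^sup>2 \<le> (\<Sum>i<n. \<Sum>j<n. m (A i \<inter> A j))"
proof -
  have "\<forall>i. \<exists>u. i < n \<longrightarrow> finite u \<and> u \<subseteq> atoms \<and> determined u (A i)"
    using fd unfolding fd_def by blast
  then obtain u where u: "\<And>i. i < n \<Longrightarrow> finite (u i) \<and> u i \<subseteq> atoms \<and> determined (u i) (A i)"
    by metis
  let ?u = "\<Union>i<n. u i"
  have fin: "finite ?u" "?u \<subseteq> atoms" using u by auto
  have det: "determined ?u (A i)" if "i < n" for i
    using u[OF that] determined_mono[of "u i" "A i" ?u] that by blast
  define w where "w W = m (con W (?u - W))" for W
  define x where "x i W = (if SET W \<in> A i then 1 else 0 :: real)" for i W
  define y where "y W = (\<Sum>i<n. x i W)" for W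
  have w_nonneg: "0 \<le> w W" if "W \<in> Pow ?u" for W
    unfolding w_def using that fin by (intro fin_additive_nonneg fa ms_con) (auto intro: finite_subset)
  have m1: "m (A i) = (\<Sum>W\<in>Pow ?u. w W * x i W)" if "i < n" for i
    unfolding fin_additive_determined[OF fa fin det[OF that]] w_def x_def
    by (intro sum.cong) auto
  have m2: "m (A i \<inter> A j) = (\<Sum>W\<in>Pow ?u. w W * (x i W * x j W))" if "i < n" "j < n" for i j
    unfolding fin_additive_determined[OF fa fin determined_Int[OF det[OF that(1)] det[OF that(2)]]] w_def x_def
    by (intro sum.cong) auto
  have "determined ?u Structs" by (simp add: determined_def)
  note Structs_sum = fin_additive_determined[OF fa fin this]
  have "SET W \<in> Structs" if "W \<in> Pow ?u" for W
    using SET_Structs[of W] that fin finite_subset[of W ?u] by blast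
  then have total: "(\<Sum>W\<in>Pow ?u. w W) = 1"
    unfolding w_def one[symmetric] Structs_sum by (intro sum.cong) simp_all
  let ?c = "\<Sum>i<n. m (A i)"
  have c: "?c = (\<Sum>W\<in>Pow ?u. w W * y W)"
    unfolding y_def sum_distrib_left by (subst sum.swap) (simp add: m1)
  have "(\<Sum>i<n. \<Sum>j<n. m (A i \<inter> A j)) = (\<Sum>i<n. \<Sum>j<n. \<Sum>W\<in>Pow ?u. w W * (x i W * x j W))"
    by (simp add: m2)
  also have "\<dots> = (\<Sum>W\<in>Pow ?u. \<Sum>i<n. \<Sum>j<n. w W * (x i W * x j W))"
    by (simp add: sum.swap[of _ "Pow ?u"])
  also have "\<dots> = (\<Sum>W\<in>Pow ?u. w W * (y W)\<^sup>2)"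
    by (simp only: y_def power2_eq_square sum_product) (simp only: sum_distrib_left)
  finally have sq: "(\<Sum>i<n. \<Sum>j<n. m (A i \<inter> A j)) = (\<Sum>W\<in>Pow ?u. w W * (y W)\<^sup>2)" .
  have "0 \<le> (\<Sum>W\<in>Pow ?u. w W * (y W - ?c)\<^sup>2)"
    using w_nonneg by (intro sum_nonneg mult_nonneg_nonneg) auto
  also have "\<dots> = (\<Sum>W\<in>Pow ?u. w W * (y W)\<^sup>2 - 2 * ?c * (w W * y W) + ?c\<^sup>2 * w W)"
    by (intro sum.cong refl) (simp add: power2_eq_square algebra_simps)
  also have "\<dots> = (\<Sum>W\<in>Pow ?u. w W * (y W)\<^sup>2) - 2 * ?c * (\<Sum>W\<in>Pow ?u. w W * y W) + ?c\<^sup>2 * (\<Sum>W\<in>Pow ?u. w W)"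
    by (simp add: sum.distrib sum_subtractf sum_distrib_left)
  also have "\<dots> = (\<Sum>W\<in>Pow ?u. w W * (y W)\<^sup>2) - ?c\<^sup>2"
    unfolding c[symmetric] total by (simp add: power2_eq_square)
  finally show ?thesis using sq by simp
qed

lemma perm_disjoint_translates:
  fixes n :: nat
  assumes "finite s" "s \<subseteq> El X"
  shows "\<exists>\<pi>. (\<forall>i<n. perm (\<pi> i)) \<and> (\<forall>i<n. \<forall>j<n. i \<noteq> j \<longrightarrow> \<pi> i ` s \<inter> \<pi> j ` s = {})"
proof (induction n)
  case (Suc n)
  then obtain \<pi> where \<pi>: "\<forall>i<n. perm (\<pi> i)" "\<forall>i<n. \<forall>j<n. i \<noteq> j \<longrightarrow> \<pi> i ` s \<inter> \<pi> j ` s = {}" by blast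
  have "finite (\<Union>i<n. \<pi> i ` s)" using assms(1) by simp
  then obtain \<sigma> where \<sigma>: "perm \<sigma>" "\<sigma> ` s \<inter> (\<Union>i<n. \<pi> i ` s) = {}"
    using perm_avoiding[OF assms] by metis
  let ?\<pi> = "\<pi>(n := \<sigma>)"
  have "\<forall>i<Suc n. perm (?\<pi> i)" using \<pi>(1) \<sigma>(1) by (simp add: less_Suc_eq)
  moreover have "?\<pi> i ` s \<inter> ?\<pi> j ` s = {}" if ij: "i < Suc n" "j < Suc n" "i \<noteq> j" for i j
  proof -
    consider "i < n" "j < n" | "i = n" "j < n" | "i < n" "j = n" using ij by linarith
    moreover have "\<sigma> ` s \<inter> \<pi> k ` s = {}" if "k < n" for k using \<sigma>(2) that by blast
    ultimately show ?thesis using \<pi>(2) ij(3) by cases (simp_all add: Int_commute)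
  qed
  ultimately show ?case by blast
qed simp

lemma dissociated_extreme:
  assumes inv: "invariant \<rho>" and dis: "dissociated \<rho>"
  shows "extreme mem V \<kappa> L X \<rho>"
  unfolding extreme_def
proof (intro conjI allI ballI impI inv)
  fix \<nu> \<eta> r s
  assume H: "invariant \<nu> \<and> invariant \<eta> \<and> \<nu> \<noteq> \<eta> \<and> 0 \<le> r \<and> 0 \<le> s \<and> r + s = 1 \<and>
    (\<forall>a\<in>Meas. val mem \<rho> a = r * val mem \<nu> a + s * val mem \<eta> a)"
  show "r = 0 \<or> s = 0"
  proof (rule ccontr)
    assume "\<not> (r = 0 \<or> s = 0)"
    then have rs: "0 < r" "0 < s" "r + s = 1" using H by auto
    have pk: "pkm \<rho>" "pkm \<nu>" "pkm \<eta>" using H inv invariant_pkm by auto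
    have comb: "meas \<rho> A = r * meas \<nu> A + s * meas \<eta> A" if "ms A" for A
      using H ms_SET[OF that] by blast
    have "meas \<nu> (con P N) = meas \<eta> (con P N)"
      if fin: "finite P" "finite N" and PN: "P \<subseteq> atoms" "N \<subseteq> atoms" for P N
    proof -
      let ?S = "ssupp (P \<union> N)"
      have S: "finite ?S" "?S \<subseteq> El X"
        using fin PN by (auto intro!: finite_ssupp ssupp_subset)
      let ?b = "\<lambda>\<nu>. meas \<nu> (con P N)"
      have ms_C: "ms (con P N)" using fin PN by (intro ms_con)
      \<comment> \<open>The convexity gap of the square function, equal to \<open>r * s\<close>
        times the square of the difference of the two values; bounding \<open>n\<close> times it for
        all \<open>n\<close> forces it to vanish.\<close>
      let ?d = "r * (?b \<nu>)\<^sup>2 + s * (?b \<eta>)\<^sup>2 - (?b \<rho>)\<^sup>2"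
      have "real n * ?d \<le> ?b \<rho>" for n
      proof -
        obtain \<pi> where \<pi>': "(\<forall>i<n. perm (\<pi> i)) \<and>
            (\<forall>i<n. \<forall>j<n. i \<noteq> j \<longrightarrow> \<pi> i ` ?S \<inter> \<pi> j ` ?S = {})"
          using perm_disjoint_translates[OF S, of n] by (elim exE)
        then have \<pi>: "\<And>i. i < n \<Longrightarrow> perm (\<pi> i)"
          "\<And>i j. i < n \<Longrightarrow> j < n \<Longrightarrow> i \<noteq> j \<Longrightarrow> \<pi> i ` ?S \<inter> \<pi> j ` ?S = {}"
          by simp_all
        define A where "A i = move (\<pi> i) ` con P N" for i
        have A: "A i = con (amap (\<pi> i) ` P) (amap (\<pi> i) ` N)" if "i < n" for i
          unfolding A_def by (rule move_image_con[OF \<pi>(1)[OF that] PN])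
        have PNi: "amap (\<pi> i) ` P \<subseteq> atoms" "amap (\<pi> i) ` N \<subseteq> atoms" if "i < n" for i
          using amap_in[OF \<pi>(1)[OF that]] PN by blast+
        have fd_A: "fd (A i)" if "i < n" for i
          unfolding fd_def A[OF that] using fin PNi[OF that]
          by (intro exI[of _ "amap (\<pi> i) ` P \<union> amap (\<pi> i) ` N"] conjI determined_con) auto
        have m_A: "meas \<tau> (A i) = ?b \<tau>" if "invariant \<tau>" "i < n" for \<tau> i
          unfolding A_def using invariant_move[OF that(1) \<pi>(1)[OF that(2)] ms_C] .
        have m_AA: "meas \<rho> (A i \<inter> A j) = (if i = j then ?b \<rho> else (?b \<rho>)\<^sup>2)" if ij: "i < n" "j < n" for i j
        proof (cases "i = j")
          case False
          have "ssupp (amap (\<pi> i) ` P \<union> amap (\<pi> i) ` N) \<inter> ssupp (amap (\<pi> j) ` P \<union> amap (\<pi> j) ` N) = {}"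
            using \<pi>(2)[OF ij False] PN by (simp add: image_Un[symmetric] ssupp_amap)
          then have "meas \<rho> (A i \<inter> A j) = meas \<rho> (A i) * meas \<rho> (A j)"
            unfolding A[OF ij(1)] A[OF ij(2)] con_Int
            by (intro dissociatedD[OF dis] finite_imageI fin PNi ij)
          then show ?thesis using False m_A[OF inv] ij by (simp add: power2_eq_square)
        qed (use m_A[OF inv] ij in simp)
        have CS: "(real n * ?b \<tau>)\<^sup>2 \<le> (\<Sum>i<n. \<Sum>j<n. meas \<tau> (A i \<inter> A j))" if "invariant \<tau>" for \<tau>
          using sum_le_sum_Int[OF pkm_fin_additive[OF invariant_pkm[OF that]] pkm_Structs[OF invariant_pkm[OF that]] fd_A]
            m_A[OF that] by simp
        have "r * (real n * ?b \<nu>)\<^sup>2 + s * (real n * ?b \<eta>)\<^sup>2 \<le>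
            r * (\<Sum>i<n. \<Sum>j<n. meas \<nu> (A i \<inter> A j)) + s * (\<Sum>i<n. \<Sum>j<n. meas \<eta> (A i \<inter> A j))"
          using CS H rs by (intro add_mono mult_left_mono) auto
        also have "\<dots> = (\<Sum>i<n. \<Sum>j<n. meas \<rho> (A i \<inter> A j))"
          using fd_ms[OF fd_A] by (simp add: sum_distrib_left sum.distrib[symmetric] comb ms_Int)
        \<comment> \<open>By dissociation each off-diagonal term is a square; the \<open>n\<close>
          diagonal terms exceed it and give the contribution that is only linear in
          \<open>n\<close>.\<close>
        also have "\<dots> = (\<Sum>i<n. \<Sum>j<n. (?b \<rho>)\<^sup>2 + (if i = j then ?b \<rho> - (?b \<rho>)\<^sup>2 else 0))"
          by (intro sum.cong refl) (simp add: m_AA)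
        also have "\<dots> = (\<Sum>i<n. real n * (?b \<rho>)\<^sup>2 + (?b \<rho> - (?b \<rho>)\<^sup>2))"
          by (intro sum.cong refl) (simp add: sum.distrib)
        also have "\<dots> = (real n)\<^sup>2 * (?b \<rho>)\<^sup>2 + real n * (?b \<rho> - (?b \<rho>)\<^sup>2)"
          by (simp add: power2_eq_square algebra_simps)
        finally have "(real n)\<^sup>2 * ?d \<le> real n * (?b \<rho> - (?b \<rho>)\<^sup>2)"
          by (simp add: power_mult_distrib algebra_simps)
        then have "real n * (real n * ?d) \<le> real n * ?b \<rho>"
          using zero_le_power2[of "?b \<rho>"] by (simp add: power2_eq_square algebra_simps mult_left_mono order_trans[rotated])
        then show ?thesis
          using pkm_nonneg[OF pk(1) ms_SET[OF ms_C]] by (cases "n = 0") simp_all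
      qed
      then have "?d \<le> 0"
        using reals_Archimedean3[of ?d] by (metis linorder_not_le)
      moreover have "?d = r * s * (?b \<nu> - ?b \<eta>)\<^sup>2"
      proof -
        have s: "s = 1 - r" using rs(3) by simp
        show ?thesis unfolding comb[OF ms_C] s by (simp add: power2_eq_square algebra_simps)
      qed
      ultimately have "(?b \<nu> - ?b \<eta>)\<^sup>2 \<le> 0"
        using rs mult_pos_pos[OF rs(1,2)] by (simp add: mult_le_0_iff)
      then show ?thesis by simp
    qed
    then have "\<nu> = \<eta>" using pk(2,3) by (intro pkm_eqI)
    then show False using H by blast
  qed
qed

end

section \<open>Conditioning on a tail event\<close>

context meas_model
begin

text \<open>Permutations carrying \<open>s\<close> to infinity. Being a HOL filter, it makes the
  general limit calculus available although there need be no sequence of such permutations that is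
  cofinal.\<close>

definition escaping :: "'v set \<Rightarrow> ('v \<Rightarrow> 'v) filter" where
  "escaping s = (INF T\<in>{T. finite T}. principal {\<pi>. perm \<pi> \<and> \<pi> ` s \<inter> T = {}})"

lemma escaping_base:
  assumes "i \<in> {T. finite T}" "j \<in> {T. finite T}"
  shows "\<exists>k\<in>{T. finite T}. principal {\<pi>. perm \<pi> \<and> \<pi> ` s \<inter> k = {}} \<le>
    inf (principal {\<pi>. perm \<pi> \<and> \<pi> ` s \<inter> i = {}}) (principal {\<pi>. perm \<pi> \<and> \<pi> ` s \<inter> j = {}})"
  using assms by (intro bexI[of _ "i \<union> j"]) auto

lemma eventually_escaping:
  "eventually P (escaping s) \<longleftrightarrow> (\<exists>T. finite T \<and> (\<forall>\<pi>. perm \<pi> \<longrightarrow> \<pi> ` s \<inter> T = {} \<longrightarrow> P \<pi>))"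
  unfolding escaping_def
  by (subst eventually_INF_base[OF _ escaping_base]) (auto simp: eventually_principal)

lemma eventually_escapingI:
  "finite T \<Longrightarrow> (\<And>\<pi>. perm \<pi> \<Longrightarrow> \<pi> ` s \<inter> T = {} \<Longrightarrow> P \<pi>) \<Longrightarrow> eventually P (escaping s)"
  unfolding eventually_escaping by blast

lemma eventually_escaping_perm: "eventually perm (escaping s)"
  by (rule eventually_escapingI[of "{}"]) simp_all

lemma escaping_neq_bot:
  assumes "finite s" "s \<subseteq> El X" shows "escaping s \<noteq> bot"
proof
  assume "escaping s = bot"
  then have "eventually (\<lambda>_. False) (escaping s)" by simp
  then obtain T where "finite T" "\<And>\<pi>. perm \<pi> \<Longrightarrow> \<pi> ` s \<inter> T \<noteq> {}"
    unfolding eventually_escaping by blast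
  then show False using perm_avoiding[OF assms] by blast
qed

lemma dfun_Int [dfn]:
  assumes "dfun s" "dfun t" shows "dfun (\<lambda>e. SET (El (s e) \<inter> El (t e)))"
proof (rule dfun_SET)
  show "D (\<lambda>e. e 0 \<in> El (s (\<lambda>i. e (Suc i))) \<inter> El (t (\<lambda>i. e (Suc i))))"
    unfolding Int_iff
    by (intro dfn dfun_rename[OF assms(1)] dfun_rename[OF assms(2)])
qed (intro vset_Int vset_El dfun_in assms)

text \<open>Records what the limit needs of a cylinder, in a form that passes to complements, so
  that an event and its complement can be conditioned on alike.\<close>

definition supported :: "'v set \<Rightarrow> 'v set \<Rightarrow> bool" where
  "supported s E \<longleftrightarrow> finite s \<and> s \<subseteq> El X \<and> ms E \<and>
     (\<forall>\<pi> \<sigma>. perm \<pi> \<longrightarrow> perm \<sigma> \<longrightarrow> (\<forall>x\<in>s. \<pi> x = \<sigma> x) \<longrightarrow> move \<pi> ` E = move \<sigma> ` E)"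

lemma supported_eq:
  "supported s E \<Longrightarrow> perm \<pi> \<Longrightarrow> perm \<sigma> \<Longrightarrow> (\<And>x. x \<in> s \<Longrightarrow> \<pi> x = \<sigma> x) \<Longrightarrow> move \<pi> ` E = move \<sigma> ` E"
  unfolding supported_def by blast

lemma supported_ms: "supported s E \<Longrightarrow> ms E" by (simp add: supported_def)

lemma supported_con:
  assumes "finite P" "finite N" "P \<subseteq> atoms" "N \<subseteq> atoms"
  shows "supported (ssupp (P \<union> N)) (con P N)"
  unfolding supported_def
proof (intro conjI allI impI)
  show "finite (ssupp (P \<union> N))" "ssupp (P \<union> N) \<subseteq> El X"
    using assms by (auto intro!: finite_ssupp ssupp_subset)
  show "ms (con P N)" using assms by (intro ms_con)
  fix \<pi> \<sigma> assume p: "perm \<pi>" "perm \<sigma>" and eq: "\<forall>x\<in>ssupp (P \<union> N). \<pi> x = \<sigma> x"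
  have "amap \<pi> u = amap \<sigma> u" if "u \<in> P \<union> N" for u
    using that eq assms(3,4) by (intro amap_cong) (auto simp: ssupp_def)
  then have "amap \<pi> ` P = amap \<sigma> ` P" "amap \<pi> ` N = amap \<sigma> ` N" by auto
  then show "move \<pi> ` con P N = move \<sigma> ` con P N"
    using assms(3,4) p by (simp add: move_image_con)
qed

lemma move_Compl:
  assumes "perm \<pi>" "E \<subseteq> Structs" shows "move \<pi> ` (Structs - E) = Structs - move \<pi> ` E"
  using inj_on_image_set_diff[OF move_inj[OF assms(1)], of Structs E] assms(2)
    move_image_Structs[OF assms(1)] by auto

lemma supported_Compl:
  assumes "supported s E" shows "supported s (Structs - E)"
  unfolding supported_def
proof (intro conjI allI impI)
  show "finite s" "s \<subseteq> El X" using assms by (simp_all add: supported_def)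
  show "ms (Structs - E)" using supported_ms[OF assms] by (rule ms_Compl)
  fix \<pi> \<sigma> assume p: "perm \<pi>" "perm \<sigma>" and eq: "\<forall>x\<in>s. \<pi> x = \<sigma> x"
  have "move \<pi> ` E = move \<sigma> ` E" using eq by (intro supported_eq[OF assms p]) simp
  then show "move \<pi> ` (Structs - E) = move \<sigma> ` (Structs - E)"
    using p ms_subset[OF supported_ms[OF assms]] by (simp add: move_Compl)
qed

lemma move_Int:
  "perm \<pi> \<Longrightarrow> A \<subseteq> Structs \<Longrightarrow> B \<subseteq> Structs \<Longrightarrow> move \<pi> ` (A \<inter> B) = move \<pi> ` A \<inter> move \<pi> ` B"
  by (rule inj_on_image_Int[OF move_inj])

text \<open>The map that fixes the points of \<open>u\<close> and sends each \<open>\<pi> x\<close>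
  to \<open>\<sigma> x\<close> is a finite injection, because both images of \<open>s\<close> avoid
  these points. An extension \<tau> of it fixes \<open>B\<close> and carries one translate of
  \<open>E\<close> to the other, so invariance applies.\<close>

lemma supported_const:
  assumes inv: "invariant \<rho>" and E: "supported s E" and u: "finite u" "u \<subseteq> atoms" "determined u B"
    and \<pi>: "perm \<pi>" "\<pi> ` s \<inter> ssupp u = {}" and \<sigma>: "perm \<sigma>" "\<sigma> ` s \<inter> ssupp u = {}"
  shows "meas \<rho> (move \<pi> ` E \<inter> B) = meas \<rho> (move \<sigma> ` E \<inter> B)"
proof -
  have s: "finite s" "s \<subseteq> El X" "ms E" using E by (simp_all add: supported_def)
  let ?T = "ssupp u"
  have T: "finite ?T" "?T \<subseteq> El X" using u by (simp_all add: finite_ssupp ssupp_subset)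
  define f where "f y = (if y \<in> ?T then y else \<sigma> (inv_into s \<pi> y))" for y
  have inj_s: "inj_on \<pi> s" "inj_on \<sigma> s"
    using inj_on_subset[OF perm_inj s(2)] \<pi>(1) \<sigma>(1) by auto
  have f_T: "f y = y" if "y \<in> ?T" for y using that by (simp add: f_def)
  have f_s: "f (\<pi> x) = \<sigma> x" if "x \<in> s" for x
    using that \<pi>(2) inj_s(1) by (auto simp: f_def)
  have "inj_on f (?T \<union> \<pi> ` s)"
  proof (rule inj_onI)
    fix y z assume "y \<in> ?T \<union> \<pi> ` s" "z \<in> ?T \<union> \<pi> ` s" "f y = f z"
    moreover have "\<sigma> x \<notin> ?T" if "x \<in> s" for x using \<sigma>(2) that by blast
    ultimately show "y = z" using f_T f_s inj_onD[OF inj_s(2)] by (elim UnE imageE) (metis+)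
  qed
  moreover have "finite (?T \<union> \<pi> ` s)" "?T \<union> \<pi> ` s \<subseteq> El X"
    using T s perm_in[OF \<pi>(1)] by auto
  moreover have "f ` (?T \<union> \<pi> ` s) \<subseteq> El X"
    using f_T f_s T(2) s(2) perm_in[OF \<sigma>(1)] by auto
  ultimately obtain \<tau> where \<tau>: "perm \<tau>" "\<And>y. y \<in> ?T \<union> \<pi> ` s \<Longrightarrow> \<tau> y = f y"
    using perm_finite_extension by metis
  have ES: "E \<subseteq> Structs" and BS: "B \<subseteq> Structs"
    using ms_subset[OF s(3)] u(3) by (auto simp: determined_def)
  have ms_B: "ms B" using u by (rule determined_ms)
  have "move \<tau> ` move \<pi> ` E = move \<sigma> ` E"
    unfolding move_image_comp[OF \<tau>(1) \<pi>(1) ES]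
    using \<tau>(2) f_s by (intro supported_eq[OF E perm_comp[OF \<tau>(1) \<pi>(1)] \<sigma>(1)]) auto
  moreover have "move \<tau> ` B = B"
  proof (rule move_image_determined[OF \<tau>(1) u(3,2)])
    fix a x assume "a \<in> u" "x \<in> supp a"
    then have "x \<in> ?T" by (auto simp: ssupp_def)
    then show "\<tau> x = x" using \<tau>(2)[of x] f_T[of x] by simp
  qed
  moreover have "move \<pi> ` E \<subseteq> Structs" using ms_subset[OF ms_move[OF \<pi>(1) s(3)]] .
  ultimately have "move \<tau> ` (move \<pi> ` E \<inter> B) = move \<sigma> ` E \<inter> B"
    using BS by (simp add: move_Int[OF \<tau>(1)])
  then show ?thesis
    using invariant_move[OF inv \<tau>(1) ms_Int[OF ms_move[OF \<pi>(1) s(3)] ms_B]] by simp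
qed

text \<open>Left unnormalised, so that the contributions of \<open>E\<close> and of its complement
  simply add up to the measure; \<open>conditional\<close> divides by the mass of
  \<open>E\<close>.\<close>

definition tail :: "'v \<Rightarrow> 'v set \<Rightarrow> 'v set \<Rightarrow> 'v set \<Rightarrow> real" where
  "tail \<rho> s E B = Lim (escaping s) (\<lambda>\<pi>. meas \<rho> (move \<pi> ` E \<inter> B))"

lemma supported_neq_bot: "supported s E \<Longrightarrow> escaping s \<noteq> bot"
  by (simp add: supported_def escaping_neq_bot)

text \<open>For finitely determined sets the expression is eventually constant by
  \<open>supported_const\<close>. A general \<open>B\<close> is within \<open>q\<close> of such a
  set, uniformly in \<pi>, so the values are Cauchy.\<close>

lemma tail_tendsto:
  assumes inv: "invariant \<rho>" and E: "supported s E" and B: "ms B"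
  shows "((\<lambda>\<pi>. meas \<rho> (move \<pi> ` E \<inter> B)) \<longlongrightarrow> tail \<rho> s E B) (escaping s)"
proof -
  let ?f = "\<lambda>\<pi>. meas \<rho> (move \<pi> ` E \<inter> B)"
  have km: "kmeas (meas \<rho>)" using inv by (intro pkm_kmeas invariant_pkm)
  then have fa: "fin_additive (meas \<rho>)" by (simp add: kmeas_def)
  have "cauchy_filter (filtermap ?f (escaping s))"
    unfolding cauchy_filter_metric_filtermap
  proof (intro allI impI)
    fix \<epsilon> :: real assume "0 < \<epsilon>"
    then have pos: "0 < min (\<epsilon> / 2) 1" by simp
    obtain q where q: "0 < real_of_rat q" "real_of_rat q < min (\<epsilon> / 2) 1"
      using of_rat_dense[OF pos] by auto
    then have q01: "0 < q" "q < 1" by simp_all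
    obtain B' where B': "fd B'" "meas \<rho> (sdiff B B') \<le> of_rat q"
      using approximable_ms[OF km km B, unfolded approximable_def, rule_format, OF q01] by blast
    obtain u where u: "finite u" "u \<subseteq> atoms" "determined u B'" using B'(1) by (auto simp: fd_def)
    let ?P = "\<lambda>\<pi>. perm \<pi> \<and> \<pi> ` s \<inter> ssupp u = {}"
    have near: "\<bar>?f \<pi> - meas \<rho> (move \<pi> ` E \<inter> B')\<bar> \<le> of_rat q" if "perm \<pi>" for \<pi>
    proof -
      have ms: "ms (move \<pi> ` E)" using ms_move[OF that supported_ms[OF E]] .
      have "\<bar>?f \<pi> - meas \<rho> (move \<pi> ` E \<inter> B')\<bar> \<le> meas \<rho> (sdiff (move \<pi> ` E \<inter> B) (move \<pi> ` E \<inter> B'))"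
        using B fd_ms[OF B'(1)] by (intro fin_additive_sdiff fa ms_Int ms)
      also have "\<dots> \<le> meas \<rho> (sdiff B B')"
        using B fd_ms[OF B'(1)] by (intro fin_additive_mono fa ms_sdiff ms_Int ms) (auto simp: sdiff_def)
      finally show ?thesis using B'(2) by linarith
    qed
    have "dist (?f \<pi>) (?f \<sigma>) < \<epsilon>" if \<pi>: "?P \<pi>" and \<sigma>: "?P \<sigma>" for \<pi> \<sigma>
    proof -
      have "meas \<rho> (move \<pi> ` E \<inter> B') = meas \<rho> (move \<sigma> ` E \<inter> B')"
        using \<pi> \<sigma> by (intro supported_const[OF inv E u]) simp_all
      moreover have "real_of_rat q < \<epsilon> / 2" using q(2) by simp
      ultimately show ?thesis
        using near[of \<pi>] near[of \<sigma>] \<pi> \<sigma> by (simp add: dist_real_def abs_le_iff abs_less_iff)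
    qed
    moreover have "eventually ?P (escaping s)"
      using finite_ssupp[OF u(1,2)] by (rule eventually_escapingI) simp
    ultimately show "\<exists>P. eventually P (escaping s) \<and> (\<forall>\<pi> \<sigma>. P \<pi> \<and> P \<sigma> \<longrightarrow> dist (?f \<pi>) (?f \<sigma>) < \<epsilon>)"
      by blast
  qed
  then obtain l where "filtermap ?f (escaping s) \<le> nhds l"
    using cauchy_filter_complete_converges[of "filtermap ?f (escaping s)" UNIV]
      supported_neq_bot[OF E] complete_UNIV by (auto simp: filtermap_bot_iff)
  then have "(?f \<longlongrightarrow> l) (escaping s)" by (simp add: filterlim_def)
  with tendsto_Lim[OF supported_neq_bot[OF E] this] show ?thesis by (simp add: tail_def)
qed

lemma tail_eqI:
  "supported s E \<Longrightarrow> ((\<lambda>\<pi>. meas \<rho> (move \<pi> ` E \<inter> B)) \<longlongrightarrow> l) (escaping s) \<Longrightarrow> tail \<rho> s E B = l"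
  unfolding tail_def using tendsto_Lim supported_neq_bot by blast

lemma tail_fin_additive:
  assumes inv: "invariant \<rho>" and E: "supported s E"
  shows "fin_additive (tail \<rho> s E)"
  unfolding fin_additive_def
proof (intro conjI allI impI)
  note fa = pkm_fin_additive[OF invariant_pkm[OF inv]]
  have ms_E: "ms (move \<pi> ` E)" if "perm \<pi>" for \<pi> using ms_move[OF that supported_ms[OF E]] .
  show "0 \<le> tail \<rho> s E A" if "ms A" for A
  proof (rule tendsto_lowerbound[OF tail_tendsto[OF inv E that] _ supported_neq_bot[OF E]])
    show "\<forall>\<^sub>F \<pi> in escaping s. 0 \<le> meas \<rho> (move \<pi> ` E \<inter> A)"
      using eventually_escaping_perm
      by eventually_elim (intro fin_additive_nonneg[OF fa] ms_Int ms_E that)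
  qed
  show "tail \<rho> s E (A \<union> B) = tail \<rho> s E A + tail \<rho> s E B"
    if AB: "ms A" "ms B" "A \<inter> B = {}" for A B
  proof (rule tail_eqI[OF E])
    have "\<forall>\<^sub>F \<pi> in escaping s. meas \<rho> (move \<pi> ` E \<inter> A) + meas \<rho> (move \<pi> ` E \<inter> B) = meas \<rho> (move \<pi> ` E \<inter> (A \<union> B))"
      using eventually_escaping_perm
    proof eventually_elim
      case (elim \<pi>)
      show ?case
        unfolding Int_Un_distrib using AB
        by (intro fin_additive_Un[OF fa, symmetric] ms_Int ms_E elim) blast+
    qed
    then show "((\<lambda>\<pi>. meas \<rho> (move \<pi> ` E \<inter> (A \<union> B))) \<longlongrightarrow> tail \<rho> s E A + tail \<rho> s E B) (escaping s)"
      using tendsto_add[OF tail_tendsto[OF inv E AB(1)] tail_tendsto[OF inv E AB(2)]]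
      by (rule Lim_transform_eventually[rotated])
  qed
qed

lemma tail_Structs:
  assumes inv: "invariant \<rho>" and E: "supported s E"
  shows "tail \<rho> s E Structs = meas \<rho> E"
proof (rule tail_eqI[OF E])
  have "\<forall>\<^sub>F \<pi> in escaping s. meas \<rho> E = meas \<rho> (move \<pi> ` E \<inter> Structs)"
    using eventually_escaping_perm
  proof eventually_elim
    case (elim \<pi>)
    have "move \<pi> ` E \<inter> Structs = move \<pi> ` E"
      using ms_subset[OF ms_move[OF elim supported_ms[OF E]]] by blast
    then show ?case using invariant_move[OF inv elim supported_ms[OF E]] by simp
  qed
  then show "((\<lambda>\<pi>. meas \<rho> (move \<pi> ` E \<inter> Structs)) \<longlongrightarrow> meas \<rho> E) (escaping s)"
    by (rule Lim_transform_eventually[OF tendsto_const])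
qed

lemma tail_le:
  assumes inv: "invariant \<rho>" and E: "supported s E" and A: "ms A"
  shows "tail \<rho> s E A \<le> meas \<rho> A"
proof (rule tendsto_upperbound[OF tail_tendsto[OF inv E A] _ supported_neq_bot[OF E]])
  show "\<forall>\<^sub>F \<pi> in escaping s. meas \<rho> (move \<pi> ` E \<inter> A) \<le> meas \<rho> A"
    using eventually_escaping_perm
    by eventually_elim
      (intro fin_additive_mono pkm_fin_additive[OF invariant_pkm[OF inv]] A ms_Int ms_move supported_ms[OF E] Int_lower2)
qed

lemma tail_le_total:
  assumes inv: "invariant \<rho>" and E: "supported s E" and A: "ms A"
  shows "tail \<rho> s E A \<le> meas \<rho> E"
  using fin_additive_mono[OF tail_fin_additive[OF inv E] ms_Structs A ms_subset[OF A]]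
  by (simp add: tail_Structs[OF inv E])

text \<open>By invariance, translating \<open>A\<close> by \<sigma> amounts to replacing \<pi> by
  the inverse of \<sigma> after \<pi>. This substitution respects the filter, since \<sigma> maps
  finite sets to finite sets.\<close>

lemma tail_move:
  assumes inv: "invariant \<rho>" and E: "supported s E" and \<sigma>: "perm \<sigma>" and A: "ms A"
  shows "tail \<rho> s E (move \<sigma> ` A) = tail \<rho> s E A"
proof (rule tail_eqI[OF E])
  let ?i = "inv_into (El X) \<sigma>"
  have s: "s \<subseteq> El X" using E by (simp add: supported_def)
  have ms_E: "ms (move \<pi> ` E)" if "perm \<pi>" for \<pi> using ms_move[OF that supported_ms[OF E]] .
  have eq: "meas \<rho> (move (\<lambda>x. ?i (\<pi> x)) ` E \<inter> A) = meas \<rho> (move \<pi> ` E \<inter> move \<sigma> ` A)"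
    if \<pi>: "perm \<pi>" for \<pi>
  proof -
    have "move \<sigma> ` (move (\<lambda>x. ?i (\<pi> x)) ` E \<inter> A) = move \<sigma> ` move ?i ` move \<pi> ` E \<inter> move \<sigma> ` A"
      using move_image_comp[OF perm_inv[OF \<sigma>] \<pi> ms_subset[OF supported_ms[OF E]]]
        ms_subset[OF ms_E[OF perm_comp[OF perm_inv[OF \<sigma>] \<pi>]]] ms_subset[OF A]
      by (simp add: move_Int[OF \<sigma>])
    also have "\<dots> = move \<pi> ` E \<inter> move \<sigma> ` A"
      by (simp add: move_image_inv(2)[OF \<sigma> ms_subset[OF ms_E[OF \<pi>]]])
    finally show ?thesis
      using invariant_move[OF inv \<sigma> ms_Int[OF ms_E[OF perm_comp[OF perm_inv[OF \<sigma>] \<pi>]] A]] by simp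
  qed
  have "filterlim (\<lambda>\<pi> x. ?i (\<pi> x)) (escaping s) (escaping s)"
    unfolding filterlim_iff
  proof (intro allI impI)
    fix P assume "eventually P (escaping s)"
    then obtain T where T: "finite T" "\<And>\<pi>. perm \<pi> \<Longrightarrow> \<pi> ` s \<inter> T = {} \<Longrightarrow> P \<pi>"
      unfolding eventually_escaping by blast
    show "\<forall>\<^sub>F \<pi> in escaping s. P (\<lambda>x. ?i (\<pi> x))"
    proof (rule eventually_escapingI)
      show "finite (\<sigma> ` T)" using T(1) by simp
      fix \<pi> assume \<pi>: "perm \<pi>" "\<pi> ` s \<inter> \<sigma> ` T = {}"
      have "?i (\<pi> x) \<notin> T" if x: "x \<in> s" for x
      proof
        assume "?i (\<pi> x) \<in> T"
        moreover have "\<pi> x \<in> \<sigma> ` El X"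
          using perm_in[OF \<pi>(1)] x s \<sigma> by (auto simp: perm_def bij_betw_def)
        ultimately have "\<pi> x \<in> \<sigma> ` T" using f_inv_into_f by (metis imageI)
        then show False using \<pi>(2) x by blast
      qed
      then have "(\<lambda>x. ?i (\<pi> x)) ` s \<inter> T = {}" by blast
      with perm_comp[OF perm_inv[OF \<sigma>] \<pi>(1)] show "P (\<lambda>x. ?i (\<pi> x))" by (rule T(2))
    qed
  qed
  from filterlim_compose[OF tail_tendsto[OF inv E A] this]
  have "((\<lambda>\<pi>. meas \<rho> (move (\<lambda>x. ?i (\<pi> x)) ` E \<inter> A)) \<longlongrightarrow> tail \<rho> s E A) (escaping s)" .
  moreover have "\<forall>\<^sub>F \<pi> in escaping s.
      meas \<rho> (move (\<lambda>x. ?i (\<pi> x)) ` E \<inter> A) = meas \<rho> (move \<pi> ` E \<inter> move \<sigma> ` A)"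
    using eventually_escaping_perm by eventually_elim (rule eq)
  ultimately show "((\<lambda>\<pi>. meas \<rho> (move \<pi> ` E \<inter> move \<sigma> ` A)) \<longlongrightarrow> tail \<rho> s E A) (escaping s)"
    by (rule Lim_transform_eventually)
qed

text \<open>When \<open>s\<close> already avoids the points of \<open>u\<close>, the identity is one
  of the permutations on which the expression is constant.\<close>

lemma tail_determined:
  assumes inv: "invariant \<rho>" and E: "supported s E" and u: "finite u" "u \<subseteq> atoms" "determined u B"
    and "s \<inter> ssupp u = {}"
  shows "tail \<rho> s E B = meas \<rho> (E \<inter> B)"
proof (rule tail_eqI[OF E])
  have id: "perm (\<lambda>x. x)"
    by (simp add: perm_def bij_betw_def) (intro vset_graph vset_El X_in dfn)
  have "E \<subseteq> Structs" using ms_subset[OF supported_ms[OF E]] .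
  then have "move (\<lambda>x. x) ` E = E" using move_id[of _ "\<lambda>x. x"] by (simp add: subset_iff)
  then have "meas \<rho> (E \<inter> B) = meas \<rho> (move \<pi> ` E \<inter> B)" if "perm \<pi>" "\<pi> ` s \<inter> ssupp u = {}" for \<pi>
    using supported_const[OF inv E u id _ that] assms(6) by simp
  then have "\<forall>\<^sub>F \<pi> in escaping s. meas \<rho> (E \<inter> B) = meas \<rho> (move \<pi> ` E \<inter> B)"
    using finite_ssupp[OF u(1,2)] by (intro eventually_escapingI)
  then show "((\<lambda>\<pi>. meas \<rho> (move \<pi> ` E \<inter> B)) \<longlongrightarrow> meas \<rho> (E \<inter> B)) (escaping s)"
    by (rule Lim_transform_eventually[OF tendsto_const])
qed

lemma tail_Compl:
  assumes inv: "invariant \<rho>" and E: "supported s E" and A: "ms A"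
  shows "tail \<rho> s E A + tail \<rho> s (Structs - E) A = meas \<rho> A"
proof -
  have E': "supported s (Structs - E)" using E by (rule supported_Compl)
  have "\<forall>\<^sub>F \<pi> in escaping s. meas \<rho> A = meas \<rho> (move \<pi> ` E \<inter> A) + meas \<rho> (move \<pi> ` (Structs - E) \<inter> A)"
    using eventually_escaping_perm
  proof eventually_elim
    case (elim \<pi>)
    have "move \<pi> ` (Structs - E) \<inter> A = A - move \<pi> ` E"
      using move_Compl[OF elim ms_subset[OF supported_ms[OF E]]] ms_subset[OF A] by blast
    then show ?case
      using fin_additive_split[OF pkm_fin_additive[OF invariant_pkm[OF inv]] A ms_move[OF elim supported_ms[OF E]]]
      by (simp add: Int_commute)
  qed
  then have "((\<lambda>\<pi>. meas \<rho> (move \<pi> ` E \<inter> A) + meas \<rho> (move \<pi> ` (Structs - E) \<inter> A)) \<longlongrightarrow> meas \<rho> A) (escaping s)"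
    by (rule Lim_transform_eventually[OF tendsto_const])
  then show ?thesis
    using tendsto_add[OF tail_tendsto[OF inv E A] tail_tendsto[OF inv E' A]]
    by (rule tendsto_unique[OF supported_neq_bot[OF E], symmetric])
qed

end

text \<open>
  Only rationals below \<open>1\<close> are admitted: the set of their codes comes for free, as the code of
  the real \<open>1\<close> that a probability measure takes as a value.
\<close>

lemma rational_limit_test:
  fixes f :: "'a \<Rightarrow> real"
  assumes p: "0 < p" "p < 1" and W: "0 \<le> W" "W \<le> p" and lim: "(f \<longlongrightarrow> W) F" "F \<noteq> bot"
  shows "(\<exists>q'::rat<1. p \<le> of_rat q' \<and> (\<exists>q''::rat<1. q * q' < q'' \<and> (\<forall>\<^sub>F x in F. of_rat q'' < f x)))
    \<longleftrightarrow> of_rat q < W / p"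
proof
  assume "\<exists>q'::rat<1. p \<le> of_rat q' \<and> (\<exists>q''::rat<1. q * q' < q'' \<and> (\<forall>\<^sub>F x in F. of_rat q'' < f x))"
  then obtain q' q'' :: rat where q: "p \<le> of_rat q'" "q * q' < q''" "\<forall>\<^sub>F x in F. of_rat q'' < f x"
    by blast
  have "\<forall>\<^sub>F x in F. of_rat q'' \<le> f x" using q(3) by eventually_elim simp
  then have "of_rat q'' \<le> W" using tendsto_lowerbound[OF lim(1) _ lim(2)] by blast
  moreover have "real_of_rat q * of_rat q' < of_rat q''" using q(2) by (simp flip: of_rat_mult add: of_rat_less)
  ultimately have less: "real_of_rat q * of_rat q' < W" by linarith
  show "of_rat q < W / p"
  proof (cases "q < 0")
    case True
    then have "real_of_rat q < 0" by simp
    also have "0 \<le> W / p" using p W by simp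
    finally show ?thesis .
  next
    case False
    then have "real_of_rat q * p \<le> real_of_rat q * of_rat q'" using q(1) by (intro mult_left_mono) simp_all
    then show ?thesis using less p by (simp add: field_simps)
  qed
next
  assume "of_rat q < W / p"
  then have qp: "real_of_rat q * p < W" using p by (simp add: field_simps)
  \<comment> \<open>Room for a rational \<open>q'\<close> just above \<open>p\<close>: for
    \<open>q \<le> 0\<close> any bound below 1 works, for positive \<open>q\<close> it must also
    stay below \<open>W / q\<close>.\<close>
  have "\<exists>x>p. x < 1 \<and> (\<forall>y. p < y \<longrightarrow> y < x \<longrightarrow> real_of_rat q * y < W)"
  proof (cases "q \<le> 0")
    case True
    obtain x where "p < x" "x < 1" using dense p(2) by blast
    moreover have "real_of_rat q * y < W" if "p < y" for y
    proof -
      have "real_of_rat q * y \<le> real_of_rat q * p" using True that by (intro mult_left_mono_neg) simp_all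
      then show ?thesis using qp by linarith
    qed
    ultimately show ?thesis by blast
  next
    case False
    then have pos: "0 < real_of_rat q" by simp
    then have "p < min 1 (W / real_of_rat q)" using qp p by (simp add: field_simps)
    then obtain x where x: "p < x" "x < min 1 (W / real_of_rat q)" using dense by blast
    moreover have "real_of_rat q * y < W" if "y < x" for y
    proof -
      have "y < W / real_of_rat q" using that x(2) by simp
      then show ?thesis using pos_less_divide_eq[OF pos] by (simp add: mult.commute)
    qed
    ultimately show ?thesis by auto
  qed
  then obtain x where x: "p < x" "x < 1" "\<And>y. p < y \<Longrightarrow> y < x \<Longrightarrow> real_of_rat q * y < W" by blast
  obtain q' where q': "p < real_of_rat q'" "real_of_rat q' < x" using of_rat_dense[OF x(1)] by blast
  obtain q'' where q'': "real_of_rat q * of_rat q' < real_of_rat q''" "real_of_rat q'' < W"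
    using of_rat_dense[OF x(3)[OF q']] by blast
  have "real_of_rat q' < 1" "real_of_rat q'' < 1" using q' q'' x(2) W(2) p(2) by linarith+
  then have "q' < 1" "q'' < 1" by simp_all
  moreover have "q * q' < q''" using q''(1) by (simp flip: of_rat_mult add: of_rat_less)
  moreover have "\<forall>\<^sub>F x in F. of_rat q'' < f x" using order_tendstoD(1)[OF lim(1) q''(2)] .
  ultimately show "\<exists>q'::rat<1. p \<le> of_rat q' \<and> (\<exists>q''::rat<1. q * q' < q'' \<and> (\<forall>\<^sub>F x in F. of_rat q'' < f x))"
    using q'(1) by (intro exI[of _ q'] conjI exI[of _ q'']) simp_all
qed

section \<open>The conditioned measure as an element of the model\<close>

context meas_model
begin

text \<open>A membership-minimal element of \<kappa> outside \<open>NC n\<close> has exactly the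
  elements of \<open>NC n\<close>, and infinity of \<kappa> provides such an element.\<close>

lemma NC_in_kappa: "NC n \<in> El \<kappa>"
proof (induction n rule: less_induct)
  case (less n)
  have sub: "El (NC n) \<subseteq> El \<kappa>" using less by (auto simp: El_NC)
  then obtain \<alpha> where "\<alpha> \<in> El \<kappa> - El (NC n)"
    using kappa_infinite finite_subset[of "El \<kappa>" "El (NC n)"] by (auto simp: El_NC)
  then show ?case
  proof (induction \<alpha> rule: El_induct)
    case (1 \<alpha>)
    show ?case
    proof (cases "El \<alpha> \<subseteq> El (NC n)")
      case True
      have "NC k \<in> El \<alpha>" if "k < n" for k
        using kappa_trichotomy[of \<alpha> "NC k"] 1(2) less[OF that] that El_NC[of k] by auto
      then have "El (NC n) \<subseteq> El \<alpha>" by (auto simp: El_NC)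
      then have "\<alpha> = NC n" using True elts_inject by blast
      then show ?thesis using 1(2) by simp
    next
      case False
      then show ?thesis using 1 kappa_trans by blast
    qed
  qed
qed

text \<open>Closure of the measurable sets concerns sets of size at most \<kappa>, additivity
  concerns indexed families. Disjoint nonempty members are distinct, so after dropping the empty
  ones the inverse of the indexing is an injection into \<kappa>.\<close>

lemma ms_UN_indexed:
  assumes "vset I" "I \<subseteq> El \<kappa>" and A: "A \<in> V" "is_fun mem A I" "app mem A ` I \<subseteq> Meas"
    and disj: "\<forall>i\<in>I. \<forall>j\<in>I. i \<noteq> j \<longrightarrow> El (app mem A i) \<inter> El (app mem A j) = {}"
  shows "ms (\<Union>i\<in>I. El (app mem A i))"
proof -
  define J where "J = {i \<in> I. El (app mem A i) \<noteq> {}}"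
  define S where "S = app mem A ` J"
  have inj: "inj_on (app mem A) J"
  proof (rule inj_onI, rule ccontr)
    fix i j assume ij: "i \<in> J" "j \<in> J" "app mem A i = app mem A j" "i \<noteq> j"
    then have "i \<in> I" "j \<in> I" by (simp_all add: J_def)
    then have "El (app mem A i) \<inter> El (app mem A j) = {}" using disj ij(4) by blast
    then show False using ij(1,3) by (simp add: J_def)
  qed
  have tapp: "tapp A i = app mem A i" if "i \<in> J" for i
    using that tapp_app[OF A(1,2)] by (simp add: J_def)
  have "vset {i \<in> I. \<exists>M\<in>El (tapp A i). True}" using assms(1) A(1) by (intro vset_sep dfn)
  also have "{i \<in> I. \<exists>M\<in>El (tapp A i). True} = J"
    unfolding J_def by (auto simp: tapp_app[OF A(1,2)])
  finally have J: "vset J" .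
  have "vset (tapp A ` J)" using J A(1) by (intro vset_image_dfun dfn)
  then have S: "vset S" using tapp by (simp add: S_def)
  have "vset ((\<lambda>i. PR (tapp A i) i) ` J)" using J A(1) by (intro vset_image_dfun dfn)
  also have "(\<lambda>i. PR (tapp A i) i) ` J = (\<lambda>a. PR a (inv_into J (app mem A) a)) ` S"
    unfolding S_def image_image using inj tapp by (intro image_cong) simp_all
  finally have "size_le mem V (SET S) \<kappa>"
    using assms(2) S inj_on_inv_into[of S "app mem A" J] inv_into_into[of _ "app mem A" J]
    by (intro size_leI) (auto simp: El_SET S_def J_def)
  then have "ms (\<Union>a\<in>S. El a)" using S A(3) by (intro ms_UN) (auto simp: small_def S_def J_def)
  also have "(\<Union>a\<in>S. El a) = (\<Union>i\<in>I. El (app mem A i))" by (auto simp: S_def J_def)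
  finally show ?thesis .
qed

text \<open>The mass left over by a finite part of the family is at most \<open>c\<close> times that
  of \<rho>, which tends to 0. This recovers infinite additivity for a limit of measures, where only
  finite additivity passes to the limit directly.\<close>

lemma additive_dominated:
  assumes pk: "pkm \<rho>" and add: "additive mem V \<kappa> L X \<rho> I" and I: "vset I" "I \<subseteq> El \<kappa>"
    and fa: "fin_additive (meas \<nu>)" and dom: "\<And>A. ms A \<Longrightarrow> meas \<nu> A \<le> c * meas \<rho> A"
  shows "additive mem V \<kappa> L X \<nu> I"
  unfolding additive_def
proof (intro ballI impI, elim conjE)
  fix A assume A: "A \<in> V" "is_fun mem A I" "app mem A ` I \<subseteq> Meas"
    and disj: "\<forall>i\<in>I. \<forall>j\<in>I. i \<noteq> j \<longrightarrow> El (app mem A i) \<inter> El (app mem A j) = {}"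
  let ?U = "\<Union>i\<in>I. El (app mem A i)"
  have ms_U: "ms ?U" using I A disj by (rule ms_UN_indexed)
  have part: "(\<Sum>i\<in>F. val mem \<tau> (app mem A i)) = meas \<tau> (\<Union>i\<in>F. El (app mem A i))"
    "ms (\<Union>i\<in>F. El (app mem A i))" if F: "finite F" "F \<subseteq> I" and \<tau>: "fin_additive (meas \<tau>)" for F \<tau>
  proof -
    have ms: "ms (El (app mem A i))" if "i \<in> F" for i using A(3) F(2) that by (intro ms_El) blast
    show "ms (\<Union>i\<in>F. El (app mem A i))" using F(1) ms by (intro ms_UN_finite)
    have "disjoint_family_on (\<lambda>i. El (app mem A i)) F"
      using disj F(2) unfolding disjoint_family_on_def by blast
    from fin_additive_UN[OF \<tau> F(1) ms this]
    show "(\<Sum>i\<in>F. val mem \<tau> (app mem A i)) = meas \<tau> (\<Union>i\<in>F. El (app mem A i))" by simp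
  qed
  note fa' = pkm_fin_additive[OF pk]
  have sum: "((\<lambda>i. val mem \<rho> (app mem A i)) has_sum meas \<rho> ?U) I"
    using add A disj unfolding additive_def by blast
  have bounds: "meas \<nu> ?U - c * (meas \<rho> ?U - (\<Sum>i\<in>F. val mem \<rho> (app mem A i))) \<le> (\<Sum>i\<in>F. val mem \<nu> (app mem A i))"
    "(\<Sum>i\<in>F. val mem \<nu> (app mem A i)) \<le> meas \<nu> ?U" if F: "finite F" "F \<subseteq> I" for F
  proof -
    let ?F = "\<Union>i\<in>F. El (app mem A i)"
    have sub: "?F \<subseteq> ?U" using F(2) by blast
    note ms_F = part(2)[OF F fa]
    have "meas \<nu> ?U - meas \<nu> ?F \<le> c * (meas \<rho> ?U - meas \<rho> ?F)"
      using dom[OF ms_Diff[OF ms_U ms_F]]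
      by (simp add: fin_additive_Diff[OF fa ms_U ms_F sub] fin_additive_Diff[OF fa' ms_U ms_F sub])
    then show "meas \<nu> ?U - c * (meas \<rho> ?U - (\<Sum>i\<in>F. val mem \<rho> (app mem A i))) \<le> (\<Sum>i\<in>F. val mem \<nu> (app mem A i))"
      unfolding part(1)[OF F fa] part(1)[OF F fa'] by linarith
    show "(\<Sum>i\<in>F. val mem \<nu> (app mem A i)) \<le> meas \<nu> ?U"
      unfolding part(1)[OF F fa] using fin_additive_mono[OF fa ms_U ms_F sub] .
  qed
  have "((\<lambda>F. meas \<nu> ?U - c * (meas \<rho> ?U - (\<Sum>i\<in>F. val mem \<rho> (app mem A i)))) \<longlongrightarrow>
      meas \<nu> ?U - c * (meas \<rho> ?U - meas \<rho> ?U)) (finite_subsets_at_top I)"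
    using sum unfolding has_sum_def by (intro tendsto_intros)
  then have lower: "((\<lambda>F. meas \<nu> ?U - c * (meas \<rho> ?U - (\<Sum>i\<in>F. val mem \<rho> (app mem A i)))) \<longlongrightarrow>
      meas \<nu> ?U) (finite_subsets_at_top I)"
    by (simp only: diff_self mult_zero_right diff_zero)
  have "((\<lambda>F. \<Sum>i\<in>F. val mem \<nu> (app mem A i)) \<longlongrightarrow> meas \<nu> ?U) (finite_subsets_at_top I)"
    by (rule tendsto_sandwich[OF _ _ lower tendsto_const];
        rule eventually_finite_subsets_at_top_weakI, erule (1) bounds)
  then show "((\<lambda>i. val mem \<nu> (app mem A i)) has_sum meas \<nu> ?U) I" by (simp add: has_sum_def)
qed

definition fin_sets :: "'v set" where
  "fin_sets = {SET F | F. F \<subseteq> El X \<and> finite F}"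

lemma vset_fin_sets: "vset fin_sets"
  unfolding fin_sets_def using X_in by (intro vset_finite_subsets vset_El)

text \<open>Says that \<open>q\<close> is below the quotient of the tail by the mass of
  \<open>E\<close>, without division: \<open>q'\<close> is at least the mass of \<open>E\<close>,
  \<open>q''\<close> is eventually below the expression under the limit, and
  \<open>q * q' < q''\<close>.\<close>

definition tail_test :: "'v \<Rightarrow> 'v set \<Rightarrow> 'v set \<Rightarrow> 'v \<Rightarrow> 'v \<Rightarrow> bool" where
  "tail_test \<rho> s E a q \<longleftrightarrow> (\<exists>q'\<in>rats. q' \<notin> El (app mem \<rho> (SET E)) \<and> (\<exists>q''\<in>rats. times_less q q' q'' \<and>
     (\<exists>T\<in>fin_sets. \<forall>g\<in>SYM. (\<forall>x\<in>s. \<forall>y\<in>El T. PR x y \<notin> El g) \<longrightarrow>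
        (\<exists>y\<in>V. PR (SET (El (vimg g (SET E)) \<inter> El a)) y \<in> El \<rho> \<and> q'' \<in> El y))))"

lemma pkm_app_in: "pkm \<rho> \<Longrightarrow> a \<in> Meas \<Longrightarrow> app mem \<rho> a \<in> V"
  using app_in(1) pkm_fun by blast

lemma D_tail_test:
  assumes "pkm \<rho>" "supported s E" shows "D (\<lambda>e. tail_test \<rho> s E (e 1) (e 0))"
proof -
  have "vset s" using assms(2) X_mem by (intro vset_finite) (auto simp: supported_def)
  moreover have "\<rho> \<in> V" "SET E \<in> V" "app mem \<rho> (SET E) \<in> V"
    using assms pkm_fun supported_ms ms_SET Meas_in pkm_app_in by blast+
  ultimately show ?thesis
    unfolding tail_test_def
    by (intro dfn vset_rats vset_fin_sets vset_SYM)
qed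

lemma vimg_SYM:
  assumes "g \<in> SYM" "ms E" shows "El (vimg g (SET E)) = move (app mem g) ` E"
proof -
  have "vact g ` E = move (app mem g) ` E"
    using vact_move[OF assms(1)] ms_subset[OF assms(2)] by (intro image_cong) auto
  then show ?thesis
    using ms_vset[OF ms_move[OF perm_app[OF assms(1)] assms(2)]]
    by (simp add: vimg_def ms_El_SET[OF assms(2)] El_SET)
qed

text \<open>Replaces HOL functions and arbitrary finite sets by codes in the model: the finite set
  may be cut down to points of \<open>X\<close>, and \<open>P\<close> sees a permutation only on
  \<open>X\<close>.\<close>

lemma eventually_escaping_SYM:
  assumes "supported s E" and P: "\<And>\<pi> \<sigma>. perm \<pi> \<Longrightarrow> perm \<sigma> \<Longrightarrow> (\<And>x. x \<in> El X \<Longrightarrow> \<pi> x = \<sigma> x) \<Longrightarrow> P \<pi> \<Longrightarrow> P \<sigma>"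
  shows "eventually P (escaping s) \<longleftrightarrow> (\<exists>T\<in>fin_sets. \<forall>g\<in>SYM.
    (\<forall>x\<in>s. \<forall>y\<in>El T. PR x y \<notin> El g) \<longrightarrow> P (app mem g))"
proof -
  have s: "s \<subseteq> El X" using assms(1) by (simp add: supported_def)
  have El_F: "El (SET F) = F" if "F \<subseteq> El X" "finite F" for F
    using that X_mem by (intro El_SET vset_finite) auto
  have avoid: "(\<forall>x\<in>s. \<forall>y\<in>T. PR x y \<notin> El g) \<longleftrightarrow> app mem g ` s \<inter> T = {}" if "g \<in> SYM" for g T
  proof -
    have "is_fun mem g (El X)" using that by (simp add: Sym_def)
    then have "PR x y \<in> El g \<longleftrightarrow> y = app mem g x" if "x \<in> s" for x y
      using is_fun_app_iff s that by blast
    then show ?thesis by auto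
  qed
  show ?thesis
  proof
    assume "eventually P (escaping s)"
    then obtain T where T: "finite T" "\<And>\<pi>. perm \<pi> \<Longrightarrow> \<pi> ` s \<inter> T = {} \<Longrightarrow> P \<pi>"
      unfolding eventually_escaping by blast
    have F: "T \<inter> El X \<subseteq> El X" "finite (T \<inter> El X)" using T(1) by auto
    have "P (app mem g)" if g: "g \<in> SYM" "\<forall>x\<in>s. \<forall>y\<in>El (SET (T \<inter> El X)). PR x y \<notin> El g" for g
    proof (rule T(2)[OF perm_app[OF g(1)]])
      have "app mem g ` s \<inter> (T \<inter> El X) = {}" using g(2) unfolding El_F[OF F] avoid[OF g(1)] .
      moreover have "app mem g ` s \<subseteq> El X" using perm_in[OF perm_app[OF g(1)]] s by blast
      ultimately show "app mem g ` s \<inter> T = {}" by blast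
    qed
    then show "\<exists>T\<in>fin_sets. \<forall>g\<in>SYM.
        (\<forall>x\<in>s. \<forall>y\<in>El T. PR x y \<notin> El g) \<longrightarrow> P (app mem g)"
      using F unfolding fin_sets_def by (intro bexI[of _ "SET (T \<inter> El X)"]) blast+
  next
    assume "\<exists>T\<in>fin_sets. \<forall>g\<in>SYM.
        (\<forall>x\<in>s. \<forall>y\<in>El T. PR x y \<notin> El g) \<longrightarrow> P (app mem g)"
    then obtain F where F: "F \<subseteq> El X" "finite F"
      "\<And>g. g \<in> SYM \<Longrightarrow> \<forall>x\<in>s. \<forall>y\<in>El (SET F). PR x y \<notin> El g \<Longrightarrow> P (app mem g)"
      unfolding fin_sets_def by blast
    show "eventually P (escaping s)"
    proof (rule eventually_escapingI[OF F(2)])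
      fix \<pi> assume \<pi>: "perm \<pi>" "\<pi> ` s \<inter> F = {}"
      have c: "code \<pi> \<in> SYM" "\<And>x. x \<in> El X \<Longrightarrow> app mem (code \<pi>) x = \<pi> x"
        using code_SYM[OF \<pi>(1)] app_code[OF \<pi>(1)] by auto
      have "app mem (code \<pi>) ` s = \<pi> ` s" using c(2) s by (intro image_cong) auto
      then have "\<forall>x\<in>s. \<forall>y\<in>El (SET F). PR x y \<notin> El (code \<pi>)"
        unfolding El_F[OF F(1,2)] avoid[OF c(1)] using \<pi>(2) by simp
      note Pc = F(3)[OF c(1) this]
      show "P \<pi>" by (rule P[OF perm_app[OF c(1)] \<pi>(1) c(2) Pc])
    qed
  qed
qed

lemma tail_test_iff:
  assumes inv: "invariant \<rho>" and E: "supported s E" and p: "0 < meas \<rho> E" "meas \<rho> E < 1" and a: "a \<in> Meas"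
  shows "tail_test \<rho> s E a (RC q) \<longleftrightarrow> of_rat q < tail \<rho> s E (El a) / meas \<rho> E"
proof -
  have pk: "pkm \<rho>" using inv by (rule invariant_pkm)
  note ms_E = supported_ms[OF E]
  have test: "(\<exists>y\<in>V. PR (SET (El (vimg g (SET E)) \<inter> El a)) y \<in> El \<rho> \<and> RC r \<in> El y) \<longleftrightarrow>
      of_rat r < meas \<rho> (move (app mem g) ` E \<inter> El a)" if "g \<in> SYM" for g r
    unfolding vimg_SYM[OF that ms_E]
    using pkm_less_iff[OF pk ms_SET[OF ms_Int[OF ms_move[OF perm_app[OF that] ms_E] ms_El[OF a]]]] .
  have ev: "(\<exists>T\<in>fin_sets. \<forall>g\<in>SYM. (\<forall>x\<in>s. \<forall>y\<in>El T. PR x y \<notin> El g) \<longrightarrow>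
        (\<exists>y\<in>V. PR (SET (El (vimg g (SET E)) \<inter> El a)) y \<in> El \<rho> \<and> RC r \<in> El y)) \<longleftrightarrow>
      (\<forall>\<^sub>F \<pi> in escaping s. of_rat r < meas \<rho> (move \<pi> ` E \<inter> El a))" for r
  proof -
    have "(\<forall>\<^sub>F \<pi> in escaping s. of_rat r < meas \<rho> (move \<pi> ` E \<inter> El a)) \<longleftrightarrow>
        (\<exists>T\<in>fin_sets. \<forall>g\<in>SYM. (\<forall>x\<in>s. \<forall>y\<in>El T. PR x y \<notin> El g) \<longrightarrow>
          of_rat r < meas \<rho> (move (app mem g) ` E \<inter> El a))"
    proof (rule eventually_escaping_SYM[OF E])
      fix \<pi> \<sigma> assume \<pi>\<sigma>: "perm \<pi>" "perm \<sigma>" "\<And>x. x \<in> El X \<Longrightarrow> \<pi> x = \<sigma> x"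
        and less: "of_rat r < meas \<rho> (move \<pi> ` E \<inter> El a)"
      have "s \<subseteq> El X" using E by (simp add: supported_def)
      then have "move \<pi> ` E = move \<sigma> ` E" using \<pi>\<sigma> by (intro supported_eq[OF E]) blast+
      with less show "of_rat r < meas \<rho> (move \<sigma> ` E \<inter> El a)" by simp
    qed
    then show ?thesis by (simp only: test cong: ball_cong)
  qed
  have "RC r \<notin> El (app mem \<rho> (SET E)) \<longleftrightarrow> meas \<rho> E \<le> of_rat r" for r
    using codes_real_mem[OF pkm_codes[OF pk ms_SET[OF ms_E]]] by (simp add: not_less)
  moreover have "rats = RC ` {..<1}" by (auto simp: rats_def)
  ultimately have "tail_test \<rho> s E a (RC q) \<longleftrightarrow> (\<exists>q'\<in>{..<1}. meas \<rho> E \<le> of_rat q' \<and>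
      (\<exists>q''\<in>{..<1}. q * q' < q'' \<and> (\<forall>\<^sub>F \<pi> in escaping s. of_rat q'' < meas \<rho> (move \<pi> ` E \<inter> El a))))"
    unfolding tail_test_def by (simp only: bex_simps times_less_RC ev)
  also have "\<dots> \<longleftrightarrow> (\<exists>q'<1. meas \<rho> E \<le> of_rat q' \<and>
      (\<exists>q''<1. q * q' < q'' \<and> (\<forall>\<^sub>F \<pi> in escaping s. of_rat q'' < meas \<rho> (move \<pi> ` E \<inter> El a))))"
    by (simp only: Bex_def lessThan_iff)
  also have "\<dots> \<longleftrightarrow> of_rat q < tail \<rho> s E (El a) / meas \<rho> E"
    using fin_additive_nonneg[OF tail_fin_additive[OF inv E] ms_El[OF a]] tail_le_total[OF inv E ms_El[OF a]]
    by (intro rational_limit_test p tail_tendsto inv E ms_El a supported_neq_bot[OF E])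
  finally show ?thesis .
qed

text \<open>Each value is given directly by its Dedekind cut; as the values are at most 1, the cut
  is a subset of \<open>rats\<close> and separation yields it.\<close>

definition conditional :: "'v \<Rightarrow> 'v set \<Rightarrow> 'v set \<Rightarrow> 'v" where
  "conditional \<rho> s E = fn Meas (\<lambda>a. SET {q \<in> rats. tail_test \<rho> s E a q})"

context
  fixes \<rho> s E
  assumes inv: "invariant \<rho>" and E: "supported s E" and p: "0 < meas \<rho> E" "meas \<rho> E < 1"
begin

lemma vset_conditional: "vset ((\<lambda>a. PR a (SET {q \<in> rats. tail_test \<rho> s E a q})) ` Meas)"
proof (rule vset_graph[OF vset_Meas], rule dfun_SET)
  note test = D_tail_test[OF invariant_pkm[OF inv] E]
  show "vset {q \<in> rats. tail_test \<rho> s E (e 0) q}" if "range e \<subseteq> V" for e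
    using that by (intro vset_sep vset_rats D_app2[OF test] dfn) auto
  show "D (\<lambda>e. e 0 \<in> {q \<in> rats. tail_test \<rho> s E (e (Suc 0)) q})"
    unfolding mem_Collect_eq by (intro dfn vset_rats D_app2[OF test])
qed

lemma conditional_codes:
  assumes a: "a \<in> Meas"
  shows "codes_real mem (app mem (conditional \<rho> s E) a) (tail \<rho> s E (El a) / meas \<rho> E)"
proof -
  have "tail \<rho> s E (El a) / meas \<rho> E \<le> 1"
    using tail_le_total[OF inv E ms_El[OF a]] p by simp
  then have "{q \<in> rats. tail_test \<rho> s E a q} = RC ` {q. of_rat q < tail \<rho> s E (El a) / meas \<rho> E}"
    unfolding rats_def using tail_test_iff[OF inv E p a]
    by (auto simp: image_iff) (metis of_rat_less_1_iff order_less_le_trans)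
  moreover have "vset {q \<in> rats. tail_test \<rho> s E a q}"
    using a by (intro vset_sep vset_rats D_app2[OF D_tail_test[OF invariant_pkm[OF inv] E]] dfn Meas_in)
  ultimately show ?thesis
    unfolding conditional_def app_fn[OF vset_conditional a] codes_real_def by (simp add: El_SET)
qed

lemma conditional_val: "a \<in> Meas \<Longrightarrow> val mem (conditional \<rho> s E) a = tail \<rho> s E (El a) / meas \<rho> E"
  by (intro val_eqI conditional_codes)

lemma conditional_meas: "ms A \<Longrightarrow> meas (conditional \<rho> s E) A = tail \<rho> s E A / meas \<rho> E"
  using conditional_val[OF ms_SET] by (simp add: ms_El_SET)

lemma conditional_fin_additive: "fin_additive (meas (conditional \<rho> s E))"
  using tail_fin_additive[OF inv E] p(1) unfolding fin_additive_def
  by (simp add: conditional_meas ms_Un add_divide_distrib)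

lemma conditional_invariant: "invariant (conditional \<rho> s E)"
  unfolding invariant_iff probability_kappa_measure_def probability_measure_def
proof (intro conjI ballI allI impI)
  note pk = invariant_pkm[OF inv]
  \<comment> \<open>Domination by a multiple of \<rho> is the source of both countable and
    \<kappa>-additivity.\<close>
  have dom: "meas (conditional \<rho> s E) A \<le> (1 / meas \<rho> E) * meas \<rho> A" if "ms A" for A
    using tail_le[OF inv E that] p(1) by (simp add: conditional_meas[OF that] divide_right_mono)
  show "conditional \<rho> s E \<in> V" "is_fun mem (conditional \<rho> s E) Meas"
    unfolding conditional_def using fn_in[OF vset_conditional] is_fun_fn[OF vset_conditional] .
  show "\<exists>r. codes_real mem (app mem (conditional \<rho> s E) a) r" if "a \<in> Meas" for a
    using conditional_codes[OF that] by blast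
  show "0 \<le> val mem (conditional \<rho> s E) a" if "a \<in> Meas" for a
    using fin_additive_nonneg[OF conditional_fin_additive ms_El[OF that]] by simp
  show "meas (conditional \<rho> s E) {} = 0"
    using fin_additive_empty[OF conditional_fin_additive] .
  show "meas (conditional \<rho> s E) Structs = 1"
    using p(1) by (simp add: conditional_meas[OF ms_Structs] tail_Structs[OF inv E])
  show "additive mem V \<kappa> L X (conditional \<rho> s E) (range NC)"
    using pk NC_in_kappa
    by (intro additive_dominated[OF pk _ vset_omega _ conditional_fin_additive dom])
      (auto simp: probability_kappa_measure_def probability_measure_def)
  show "additive mem V \<kappa> L X (conditional \<rho> s E) (El \<kappa>)"
    using pk
    by (intro additive_dominated[OF pk _ vset_El[OF kappa_in] _ conditional_fin_additive dom])
      (auto simp: probability_kappa_measure_def)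
  show "meas (conditional \<rho> s E) (move \<pi> ` A) = meas (conditional \<rho> s E) A" if "perm \<pi>" "ms A" for \<pi> A
    using that by (simp add: conditional_meas ms_move tail_move[OF inv E])
qed

end

lemma extreme_dissociated:
  assumes ext: "extreme mem V \<kappa> L X \<rho>"
  shows "dissociated \<rho>"
  unfolding dissociated_def
proof (intro allI impI)
  fix P N P' N'
  assume fin: "finite P" "finite N" "finite P'" "finite N'"
    and at: "P \<subseteq> atoms" "N \<subseteq> atoms" "P' \<subseteq> atoms" "N' \<subseteq> atoms"
    and disj: "ssupp (P \<union> N) \<inter> ssupp (P' \<union> N') = {}"
  have inv: "invariant \<rho>" using ext by (simp add: extreme_def)
  note pk = invariant_pkm[OF inv]
  note fa = pkm_fin_additive[OF pk]
  let ?E = "con P N" and ?B = "con P' N'" and ?s = "ssupp (P \<union> N)"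
  have E: "supported ?s ?E" using fin at by (intro supported_con)
  then have E': "supported ?s (Structs - ?E)" by (rule supported_Compl)
  have ms: "ms ?E" "ms ?B" using fin at by (simp_all add: ms_con)
  have compl: "meas \<rho> (Structs - ?E) = 1 - meas \<rho> ?E"
    using fin_additive_Diff[OF fa ms_Structs ms(1) ms_subset[OF ms(1)]] pkm_Structs[OF pk] by simp
  have "meas \<rho> (?E \<inter> ?B) = meas \<rho> ?E * meas \<rho> ?B"
  \<comment> \<open>Conditioning requires that neither \<open>?E\<close> nor its complement is null;
    if one of them is, independence is immediate.\<close>
  proof (cases "0 < meas \<rho> ?E \<and> meas \<rho> ?E < 1")
    case False
    then consider "meas \<rho> ?E = 0" | "meas \<rho> (Structs - ?E) = 0"
      using fin_additive_nonneg[OF fa ms(1)] fin_additive_nonneg[OF fa supported_ms[OF E']] compl by linarith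
    then show ?thesis
    proof cases
      case 1
      then show ?thesis
        using fin_additive_mono[OF fa ms(1) ms_Int[OF ms]] fin_additive_nonneg[OF fa ms_Int[OF ms]] by simp
    next
      case 2
      have "meas \<rho> (?B - ?E) \<le> meas \<rho> (Structs - ?E)"
        using ms_subset[OF ms(2)] by (intro fin_additive_mono fa ms_Diff ms ms_Structs) blast
      then have "meas \<rho> (?B - ?E) = 0"
        using 2 fin_additive_nonneg[OF fa ms_Diff[OF ms(2,1)]] by simp
      then show ?thesis
        using fin_additive_split[OF fa ms(2,1)] 2 compl by (simp add: Int_commute)
    qed
  next
    case True
    let ?p = "meas \<rho> ?E"
    let ?\<nu> = "conditional \<rho> ?s ?E" and ?\<eta> = "conditional \<rho> ?s (Structs - ?E)"
    have p: "0 < ?p" "?p < 1" using True by auto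
    have p': "0 < meas \<rho> (Structs - ?E)" "meas \<rho> (Structs - ?E) < 1" using p compl by auto
    have comb: "meas \<rho> A = ?p * meas ?\<nu> A + (1 - ?p) * meas ?\<eta> A" if "ms A" for A
      using tail_Compl[OF inv E that] p
      by (simp add: conditional_meas[OF inv E p that] conditional_meas[OF inv E' p' that] compl)
    \<comment> \<open>Extremality admits only weights coded in the model; the two weights used are
      values of \<rho> at the event and at its complement.\<close>
    have real: "meas \<rho> A \<in> reals_of mem V" if "ms A" for A
      unfolding reals_of_def using pkm_codes[OF pk ms_SET[OF that]] pkm_app_in[OF pk ms_SET[OF that]] by blast
    have "val mem \<rho> a = ?p * val mem ?\<nu> a + (1 - ?p) * val mem ?\<eta> a" if "a \<in> Meas" for a
      using comb[OF ms_El[OF that]] by simp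
    then have "?\<nu> = ?\<eta>"
      using ext conditional_invariant[OF inv E p] conditional_invariant[OF inv E' p']
        real[OF ms(1)] real[OF supported_ms[OF E']] p
      unfolding extreme_def compl by (metis add_diff_cancel_left' diff_add_cancel diff_gt_0_iff_gt less_eq_real_def less_irrefl)
    \<comment> \<open>With the two conditioned measures equal, their convex combination \<rho> takes
      the same value.\<close>
    then have "meas \<rho> ?B = meas ?\<nu> ?B"
      using comb[OF ms(2)] by (simp add: algebra_simps)
    also have "\<dots> = meas \<rho> (?E \<inter> ?B) / ?p"
      using disj fin at
      by (simp add: conditional_meas[OF inv E p ms(2)] tail_determined[OF inv E _ _ determined_con])
    finally show ?thesis using p by (simp add: field_simps)
  qed
  then show "meas \<rho> (con (P \<union> P') (N \<union> N')) = meas \<rho> (con P N) * meas \<rho> (con P' N')"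
    by (simp add: con_Int)
qed

lemma extreme_iff_dissociated: "invariant \<rho> \<Longrightarrow> extreme mem V \<kappa> L X \<rho> \<longleftrightarrow> dissociated \<rho>"
  using extreme_dissociated dissociated_extreme by blast

end

section \<open>Cylinder sets as extensions of formulas\<close>

lemma literal_append:
  assumes "is_literal mem L (length as) \<phi>"
  shows "is_literal mem L (length (as @ bs)) \<phi>" "holds mem M \<phi> (as @ bs) \<longleftrightarrow> holds mem M \<phi> as"
  using assms by (induction \<phi>) (auto simp: nth_append cong: map_cong)

context str_model
begin

lemma con_formula_insert:
  assumes "\<forall>\<phi>\<in>set \<phi>s. is_literal mem L (length as) \<phi>" "set as \<subseteq> El X" "u \<in> atoms"
  obtains bs \<psi> where "set bs \<subseteq> El X" "is_literal mem L (length (as @ bs)) \<psi>"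
    "\<And>M. holds mem M \<psi> (as @ bs) \<longleftrightarrow> u \<in> El M"
proof -
  obtain R bs where u: "u = atom R bs" "has_arity mem L R (length bs)" "set bs \<subseteq> El X"
    using assms(3) by (rule atomsE)
  let ?\<psi> = "LRel R [length as..<length as + length bs]"
  have "map ((!) (as @ bs)) [length as..<length as + length bs] = bs"
    by (rule nth_equalityI) (simp_all add: nth_append)
  then have "holds mem M ?\<psi> (as @ bs) \<longleftrightarrow> u \<in> El M" for M by (simp add: u(1))
  moreover have "is_literal mem L (length (as @ bs)) ?\<psi>" using u(2) by simp
  ultimately show thesis using u(3) that by blast
qed

text \<open>The formula must not depend on the model, hence the unbounded quantifier over \<open>M\<close>.\<close>

lemma con_formula:
  assumes "finite P" "finite N" "P \<subseteq> atoms" "N \<subseteq> atoms"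
  shows "\<exists>\<phi>s as. (\<forall>\<phi>\<in>set \<phi>s. is_literal mem L (length as) \<phi>) \<and> set as \<subseteq> El X \<and>
    (\<forall>M. (\<forall>\<phi>\<in>set \<phi>s. holds mem M \<phi> as) \<longleftrightarrow> P \<subseteq> El M \<and> N \<inter> El M = {})"
    (is "?Q P N")
proof -
  \<comment> \<open>One step for both signs: \<open>b\<close> tells whether the new atom is required
    or excluded. Its points are appended to the tuple, so the earlier literals keep their
    variables.\<close>
  have add: "?Q P' N'"
    if IH: "?Q P N" and u: "u \<in> atoms"
      and iff: "\<And>E. P' \<subseteq> E \<and> N' \<inter> E = {} \<longleftrightarrow> (P \<subseteq> E \<and> N \<inter> E = {}) \<and> (u \<in> E \<longleftrightarrow> b)" for P N P' N' u b
  proof -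
    obtain \<phi>s as where \<phi>s: "\<forall>\<phi>\<in>set \<phi>s. is_literal mem L (length as) \<phi>" "set as \<subseteq> El X"
      "\<forall>M. (\<forall>\<phi>\<in>set \<phi>s. holds mem M \<phi> as) \<longleftrightarrow> P \<subseteq> El M \<and> N \<inter> El M = {}"
      using IH by blast
    obtain bs \<psi> where \<psi>: "set bs \<subseteq> El X" "is_literal mem L (length (as @ bs)) \<psi>"
      "\<And>M. holds mem M \<psi> (as @ bs) \<longleftrightarrow> u \<in> El M"
      using con_formula_insert[OF \<phi>s(1,2) u] by blast
    define \<chi> where "\<chi> = (if b then \<psi> else LNeg \<psi>)"
    have "\<forall>\<phi>\<in>set (\<chi> # \<phi>s). is_literal mem L (length (as @ bs)) \<phi>"
      using \<phi>s(1) \<psi>(2) literal_append(1)[of mem L as _ bs] by (auto simp: \<chi>_def)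
    moreover have "set (as @ bs) \<subseteq> El X" using \<phi>s(2) \<psi>(1) by simp
    moreover have "(\<forall>\<phi>\<in>set (\<chi> # \<phi>s). holds mem M \<phi> (as @ bs)) \<longleftrightarrow> P' \<subseteq> El M \<and> N' \<inter> El M = {}" for M
    proof -
      have "(\<forall>\<phi>\<in>set \<phi>s. holds mem M \<phi> (as @ bs)) \<longleftrightarrow> (\<forall>\<phi>\<in>set \<phi>s. holds mem M \<phi> as)"
        using \<phi>s(1) literal_append(2)[of mem L as _ M bs] by simp
      moreover have "holds mem M \<chi> (as @ bs) \<longleftrightarrow> (u \<in> El M \<longleftrightarrow> b)"
        using \<psi>(3) by (simp add: \<chi>_def)
      ultimately show ?thesis using \<phi>s(3) iff by auto
    qed
    ultimately show ?thesis by blast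
  qed
  have "?Q {} N"
    using assms(2,4)
  proof (induction N)
    case empty
    show ?case by (intro exI[of _ "[]"]) simp
  next
    case (insert u N)
    then show ?case by (intro add[of "{}" N u "{}" "insert u N" False]) auto
  qed
  with assms(1,3) show ?thesis
  proof (induction P)
    case (insert u P)
    then show ?case by (intro add[of P N u "insert u P" N True]) auto
  qed simp
qed

lemma ext_con:
  assumes "\<And>M. (\<forall>\<phi>\<in>set \<phi>s. holds mem M \<phi> as) \<longleftrightarrow> P \<subseteq> El M \<and> N \<inter> El M = {}"
  shows "ext mem V L X \<phi>s as = SET (con P N)"
  using assms by (simp add: ext_def con_def)

end

section \<open>Absoluteness of extremality\<close>

lemma background_universe: "background_model mem \<Longrightarrow> universe mem"
proof
  assume bg: "background_model mem"
  then have ext: "extensionality mem UNIV" and pair: "pairing mem UNIV" and wf: "wfp mem"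
    by (simp_all add: background_model_def ZFC_def)
  show "wfp mem" by (rule wf)
  show "x = y" if "elts mem x = elts mem y" for x y
  proof -
    have "\<forall>z\<in>UNIV. mem z x \<longleftrightarrow> mem z y" using that by (auto simp: elts_def)
    then show ?thesis using ext unfolding extensionality_def by blast
  qed
  show "\<exists>p. elts mem p = {a, b}" for a b
  proof -
    have "\<exists>p. \<forall>z. mem z p \<longleftrightarrow> z = a \<or> z = b" using pair by (simp add: pairing_def)
    then obtain p where "\<forall>z. mem z p \<longleftrightarrow> z = a \<or> z = b" by (elim exE)
    then have "elts mem p = {a, b}" by (simp add: elts_def set_eq_iff)
    then show ?thesis by blast
  qed
qed

lemma model_of_set_theory_model:
  assumes "background_model mem" "model_of_set_theory mem V" shows "model mem V"
proof -
  interpret universe mem using assms(1) by (rule background_universe)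
  show ?thesis
    by unfold_locales (use assms(2) in \<open>auto simp: model_of_set_theory_def elts_def\<close>)
qed

text \<open>With \<open>extreme_iff_dissociated\<close> in each model, it remains to see that the
  relativization is unique and invariant and has the same cylinder values as \<mu>.\<close>

theorem proposition5p20:
  fixes mem :: "'v \<Rightarrow> 'v \<Rightarrow> bool"
    and V\<^sub>0 V\<^sub>1 :: "'v set"
    and \<kappa> X L \<mu> :: 'v
  assumes "background_model mem"
    and "model_of_set_theory mem V\<^sub>0" and "model_of_set_theory mem V\<^sub>1" and "V\<^sub>0 \<subseteq> V\<^sub>1"
    and "\<kappa> \<in> V\<^sub>0" and "is_ordinal mem \<kappa>" and "infinite (elts mem \<kappa>)"
    and "X \<in> V\<^sub>0" and "infinite (elts mem X)"
    and "L \<in> V\<^sub>0" and "relational_language mem L"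
    and "invariant_measure mem V\<^sub>0 \<kappa> L X \<mu>"
    and "\<exists>\<mu>'. is_relativization mem V\<^sub>0 V\<^sub>1 \<kappa> L X \<mu> \<mu>'"
  shows "extreme mem V\<^sub>0 \<kappa> L X \<mu> \<longleftrightarrow>
         extreme mem V\<^sub>1 \<kappa> L X (relativization mem V\<^sub>0 V\<^sub>1 \<kappa> L X \<mu>)"
proof -
  obtain \<mu>' where \<mu>': "is_relativization mem V\<^sub>0 V\<^sub>1 \<kappa> L X \<mu> \<mu>'" using assms(13) by blast
  interpret M0: model mem V\<^sub>0 using assms(1,2) by (rule model_of_set_theory_model)
  interpret M1: model mem V\<^sub>1 using assms(1,3) by (rule model_of_set_theory_model)
  interpret M0: meas_model mem V\<^sub>0 \<kappa> L X \<mu>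
    by unfold_locales (use assms in \<open>simp_all add: invariant_measure_def\<close>)
  interpret M1: meas_model mem V\<^sub>1 \<kappa> L X \<mu>'
    by unfold_locales (use assms \<mu>' in \<open>auto simp: is_relativization_def\<close>)
  \<comment> \<open>Atoms do not depend on the model, so \<open>P\<close> and \<open>N\<close>
    describe a cylinder in both, and one conjunction of literals defines both cylinders.\<close>
  have con_eq: "M1.meas \<nu> (M1.con P N) = M0.meas \<mu> (M0.con P N)"
    if \<nu>: "is_relativization mem V\<^sub>0 V\<^sub>1 \<kappa> L X \<mu> \<nu>"
      and PN: "finite P" "finite N" "P \<subseteq> M0.atoms" "N \<subseteq> M0.atoms" for \<nu> P N
  proof -
    obtain \<phi>s as where \<phi>s: "(\<forall>\<phi>\<in>set \<phi>s. is_literal mem L (length as) \<phi>) \<and> set as \<subseteq> elts mem X"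
      "\<And>M. (\<forall>\<phi>\<in>set \<phi>s. holds mem M \<phi> as) \<longleftrightarrow> P \<subseteq> elts mem M \<and> N \<inter> elts mem M = {}"
      using M0.con_formula[OF PN] by blast
    have "val mem \<nu> (ext mem V\<^sub>1 L X \<phi>s as) = val mem \<mu> (ext mem V\<^sub>0 L X \<phi>s as)"
      using \<nu> \<phi>s(1) unfolding is_relativization_def by blast
    then show ?thesis using M0.ext_con[OF \<phi>s(2)] M1.ext_con[OF \<phi>s(2)] by simp
  qed
  \<comment> \<open>Relativizations share all cylinder values and hence coincide, which justifies
    the definite description.\<close>
  have "\<nu> = \<mu>'" if "is_relativization mem V\<^sub>0 V\<^sub>1 \<kappa> L X \<mu> \<nu>" for \<nu>
    using con_eq[OF that] con_eq[OF \<mu>'] that M1.prob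
    by (intro M1.pkm_eqI) (simp_all add: is_relativization_def)
  then have rel: "relativization mem V\<^sub>0 V\<^sub>1 \<kappa> L X \<mu> = \<mu>'"
    unfolding relativization_def using \<mu>' by (intro the_equality)
  have inv: "M1.invariant \<mu>'"
  proof (rule M1.invariantI_con[OF M1.prob])
    fix \<pi> P N
    assume \<pi>: "M1.perm \<pi>" and PN: "finite P" "finite N" "P \<subseteq> M1.atoms" "N \<subseteq> M1.atoms"
    have s: "finite (M0.ssupp (P \<union> N))" "M0.ssupp (P \<union> N) \<subseteq> elts mem X"
      using PN by (simp_all add: M0.finite_ssupp M0.ssupp_subset)
    \<comment> \<open>The permutation \<pi> may exist only in the larger model; on the finitely many
      points that matter for \<open>P\<close> and \<open>N\<close> it is replaced by a permutation
      of the smaller one, where \<mu> is invariant.\<close>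
    obtain \<sigma> where \<sigma>: "M0.perm \<sigma>" "\<And>x. x \<in> M0.ssupp (P \<union> N) \<Longrightarrow> \<sigma> x = \<pi> x"
      using M0.perm_finite_extension[OF s inj_on_subset[OF M1.perm_inj[OF \<pi>] s(2)]]
        M1.perm_in[OF \<pi>] s(2) by blast
    have "M0.amap \<pi> u = M0.amap \<sigma> u" if u: "u \<in> P \<union> N" for u
    proof (rule M0.amap_cong)
      show "u \<in> M0.atoms" using u PN(3,4) by blast
      show "\<pi> x = \<sigma> x" if "x \<in> M0.supp u" for x
        by (rule \<sigma>(2)[symmetric]) (use u that in \<open>auto simp: M0.ssupp_def\<close>)
    qed
    then have eq: "M0.amap \<pi> ` P = M0.amap \<sigma> ` P" "M0.amap \<pi> ` N = M0.amap \<sigma> ` N" by auto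
    have "M0.amap \<pi> ` P \<subseteq> M1.atoms" "M0.amap \<pi> ` N \<subseteq> M1.atoms"
      using M1.amap_in[OF \<pi>] PN by blast+
    then have "M1.meas \<mu>' (M1.con (M0.amap \<pi> ` P) (M0.amap \<pi> ` N)) =
        M0.meas \<mu> (M0.con (M0.amap \<sigma> ` P) (M0.amap \<sigma> ` N))"
      using PN by (simp add: con_eq[OF \<mu>'] eq)
    also have "\<dots> = M0.meas \<mu> (M0.con P N)"
      unfolding M0.move_image_con[OF \<sigma>(1) PN(3,4), symmetric]
      using PN by (intro M0.invariant_move assms(12) \<sigma>(1) M0.ms_con)
    also have "\<dots> = M1.meas \<mu>' (M1.con P N)" using con_eq[OF \<mu>' PN] by simp
    finally show "M1.meas \<mu>' (M1.con (M0.amap \<pi> ` P) (M0.amap \<pi> ` N)) = M1.meas \<mu>' (M1.con P N)" .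
  qed
  have "M0.dissociated \<mu> \<longleftrightarrow> M1.dissociated \<mu>'"
    unfolding M0.dissociated_def M1.dissociated_def by (simp add: con_eq[OF \<mu>'])
  then show ?thesis
    unfolding rel using M0.extreme_iff_dissociated[OF assms(12)] M1.extreme_iff_dissociated[OF inv] by simp
qed

end
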